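(* Let $\Lambda$ be a locally finite multiset in $\mathbb C$. Then $\Lambda$ is a zero set for $\mathcal F^2$ if and only if $$n_\Lambda(r)=O(r^2)\ (r\to\infty)\qquad\text{and}\qquad \mathcal H(\Lambda)<\infty.$$ Moreover, whenever $n_\Lambda(r)=O(r^2)$, the identity $$\exp\mathcal H(\Lambda)=\inf_{a,b\in\mathbb C}E_\Lambda(a,b)$$ holds in the extended real numbers. If this value is finite, the infimum is attained at a unique pair $(a,b)\in\mathbb C^2$, and the corresponding function $P_\Lambda(z)e^{az+bz^2}$ belongs to $\mathcal F^2$ and has zero multiset exactly $\Lambda$.
   Context: $dA$ is planar Lebesgue measure and $d\gamma_0(z)=\pi^{-1}e^{-|z|^2}dA(z)$. The Bargmann–Fock space $\mathcal F^2$ is the space of entire functions $f$ with $\frac1\pi\int_{\mathbb C}|f|^2e^{-|z|^2}dA<\infty$. Multisets in $\mathbb C$ have locally finite support and finite multiplicities; $m_\lambda$ is the multiplicity of $\lambda$ in $\Lambda$ ($m_0$ that of the origin, possibly $0$), and sums and products with explicit factors or exponents $m_\lambda$ use each support point once. $n_\Lambda(r)$ is the number of points of $\Lambda$ in $|z|\le r$, with multiplicity. $\Lambda$ is a zero set for $\mathcal F^2$ if there is a nonzero $f\in\mathcal F^2$ whose zero multiset (with multiplicities) is exactly $\Lambda$. Suppose $n_\Lambda(r)=O(r^2)$. The genus-two canonical product is $$P_\Lambda(z)=z^{m_0}\prod_{\lambda\ne0}E_2(z/\lambda)^{m_\lambda},\qquad E_2(w)=(1-w)e^{w+w^2/2},$$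 which converges locally uniformly. With $\ell(w)=\log\max\{1,|w|\}$, put $$\mathcal U^{\mathrm{can}}_\Lambda(z)=m_0\ell(z)+\sum_{\lambda\ne0}m_\lambda\Bigl\{\ell(z-\lambda)-\log|\lambda|+\Re\Bigl(\frac z\lambda+\frac{z^2}{2\lambda^2}\Bigr)\Bigr\},$$ with terms in braces grouped (the series converges locally uniformly to a continuous function; it equals the mean of $\log|P_\Lambda|$ over the circle of radius $1$ centered at $z$). Put $$E_\Lambda(a,b)=\int_{\mathbb C}e^{2\mathcal U^{\mathrm{can}}_\Lambda(z)+2\Re(az+bz^2)}\,d\gamma_0(z)\in(0,+\infty].$$ For a probability measure $\mu\ll\gamma_0$ the relative entropy is $\operatorname{Ent}(\mu\mid\gamma_0)=\int_{\mathbb C}\log\bigl(\frac{d\mu}{d\gamma_0}\bigr)d\mu$, with value $+\infty$ if the integral is not finite. $\mathcal P_2$ is the class of compactly supported probability measures $\mu\ll\gamma_0$ on $\mathbb C$ with finite relative entropy and $\int z\,d\mu=0$, $\int z^2\,d\mu=0$ (complex moments). Finally $$\mathcal H(\Lambda)=\sup_{\mu\in\mathcal P_2}\Bigl\{2\int_{\mathbb C}\mathcal U^{\mathrm{can}}_\Lambda\,d\mu-\operatorname{Ent}(\mu\mid\gamma_0)\Bigr\},$$ defined when $n_\Lambda(r)=O(r^2)$. *)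

theory Defs
  imports
    "HOL-Library.Landau_Symbols"
    "HOL-Probability.Probability"
    "HOL-Complex_Analysis.Complex_Analysis"
begin

text \<open>A multiset in the plane is given by its multiplicity function.\<close>

type_synonym cmult = "complex \<Rightarrow> nat"

definition locally_finite :: "cmult \<Rightarrow> bool" where
  "locally_finite m \<longleftrightarrow> (\<forall>r. finite {w. cmod w \<le> r \<and> m w \<noteq> 0})"

definition nonzero_pts :: "cmult \<Rightarrow> complex set" where
  "nonzero_pts m = {w. m w \<noteq> 0 \<and> w \<noteq> 0}"

definition counting_fn :: "cmult \<Rightarrow> real \<Rightarrow> nat" where
  "counting_fn m r = (\<Sum>w | cmod w \<le> r \<and> m w \<noteq> 0. m w)"

definition quadratic_growth :: "cmult \<Rightarrow> bool" where
  "quadratic_growth m \<longleftrightarrow> (\<lambda>r. real (counting_fn m r)) \<in> O[at_top](\<lambda>r. r\<^sup>2)"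

definition gauss_measure :: "complex measure" where
  "gauss_measure = density lborel (\<lambda>z. ennreal (exp (- (cmod z)\<^sup>2) / pi))"

definition fock_space :: "(complex \<Rightarrow> complex) set" where
  "fock_space = {f. f holomorphic_on UNIV \<and>
     (\<integral>\<^sup>+z. ennreal ((cmod (f z))\<^sup>2) \<partial>gauss_measure) < \<infinity>}"

text \<open>For an entire function that is not identically zero, \<^const>\<open>zorder\<close> is the order of
  vanishing, and it is 0 at the points where the function does not vanish.\<close>

definition has_zero_multiset :: "(complex \<Rightarrow> complex) \<Rightarrow> cmult \<Rightarrow> bool" where
  "has_zero_multiset f m \<longleftrightarrow>
     f holomorphic_on UNIV \<and> (\<exists>z. f z \<noteq> 0) \<and> (\<forall>z. zorder f z = int (m z))"

definition fock_zero_set :: "cmult \<Rightarrow> bool" where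
  "fock_zero_set m \<longleftrightarrow> (\<exists>f \<in> fock_space. has_zero_multiset f m)"

text \<open>The infinite product is the limit of the finite subproducts over the directed family of all
  finite sets of points, hence independent of any enumeration;
  \<open>weierstrass_factor 2 w = (1 - w) * exp (w + w\<^sup>2 / 2)\<close>.\<close>

definition canonical_product :: "cmult \<Rightarrow> complex \<Rightarrow> complex" where
  "canonical_product m z = z ^ m 0 *
     Lim (finite_subsets_at_top (nonzero_pts m))
       (\<lambda>F. \<Prod>w\<in>F. weierstrass_factor 2 (z / w) ^ m w)"

definition log_plus :: "complex \<Rightarrow> real" where
  "log_plus w = ln (max 1 (cmod w))"

definition canonical_potential :: "cmult \<Rightarrow> complex \<Rightarrow> real" where
  "canonical_potential m z = real (m 0) * log_plus z +
     (\<Sum>\<^sub>\<infinity>w\<in>nonzero_pts m.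
        real (m w) * (log_plus (z - w) - ln (cmod w) + Re (z / w + z\<^sup>2 / (2 * w\<^sup>2))))"

definition gauss_energy :: "cmult \<Rightarrow> complex \<Rightarrow> complex \<Rightarrow> ennreal" where
  "gauss_energy m a b =
     (\<integral>\<^sup>+z. ennreal (exp (2 * canonical_potential m z + 2 * Re (a * z + b * z\<^sup>2))) \<partial>gauss_measure)"

text \<open>\<open>entropy_density (exp 1) M N\<close> is the natural logarithm of the density of \<open>N\<close> with
  respect to \<open>M\<close>, and \<open>KL_divergence (exp 1) M N\<close> is its integral with respect to \<open>N\<close>;
  the Bochner integral would be 0 in the non-integrable case.\<close>

definition rel_entropy :: "'a measure \<Rightarrow> 'a measure \<Rightarrow> ereal" where
  "rel_entropy N M =
     (if integrable N (entropy_density (exp 1) M N)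
      then ereal (KL_divergence (exp 1) M N) else \<infinity>)"

definition test_measures :: "complex measure set" where
  "test_measures = {\<mu>. prob_space \<mu> \<and> sets \<mu> = sets borel \<and>
     absolutely_continuous gauss_measure \<mu> \<and>
     (\<exists>K. compact K \<and> emeasure \<mu> (- K) = 0) \<and>
     rel_entropy \<mu> gauss_measure < \<infinity> \<and>
     (\<integral>z. z \<partial>\<mu>) = 0 \<and> (\<integral>z. z\<^sup>2 \<partial>\<mu>) = 0}"

definition entropy_functional :: "cmult \<Rightarrow> ereal" where
  "entropy_functional m =
     (SUP \<mu>\<in>test_measures.
        ereal (2 * (\<integral>z. canonical_potential m z \<partial>\<mu>)) - rel_entropy \<mu> gauss_measure)"

definition exp_ereal :: "ereal \<Rightarrow> ennreal" where
  "exp_ereal x = (case x of ereal r \<Rightarrow> ennreal (exp r) | PInfty \<Rightarrow> \<infinity> | MInfty \<Rightarrow> 0)"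

end

theory Submission
  imports Defs "HOL-Real_Asymp.Real_Asymp"
begin

text \<open>
  The functions \<open>P exp (a z + b z\<^sup>2)\<close>, with \<open>P\<close> the canonical product of \<open>m\<close>, are up to constants the
  only candidates for a Fock space function with zero multiset \<open>m\<close>, so everything turns on whether some
  choice of \<open>(a, b)\<close> makes it square integrable. Three facts translate this into entropy.

  Replacing \<open>\<bar>P\<bar>\<close> by \<open>exp U\<close>, where \<open>U\<close> is the canonical potential, does not change the question.
  The value \<open>exp (U z)\<close> is the modulus at \<open>z\<close> of \<open>P\<close> after the zeros in the closed unit disc
  around \<open>z\<close> have been divided out (\<open>exp_canonical_potential\<close>). The removed factors have modulus at most
  1, so \<open>\<bar>P\<bar> \<le> exp U\<close>. Conversely, replacing each factor \<open>u - \<lambda>\<close> by the factor reflected in the circle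
  of radius 1 leaves the modulus on that circle alone, and the mean value inequality bounds
  \<open>exp (2 U)\<close> by the mean of \<open>\<bar>P\<bar>\<^sup>2\<close> over the circle. Translation is unbounded on the Fock space, but
  multiplying by the zero-free function \<open>exp (- cnj z u)\<close> before taking the mean turns the Gaussian weight at
  \<open>z\<close> into the one at \<open>z + u\<close>, up to the factor \<open>e\<close>; Tonelli's theorem then gives
  \<open>energy_finite_if_fock\<close>.

  A Fock space function with zero multiset \<open>m\<close> is of this form. It is bounded by a multiple of
  \<open>exp ((\<bar>z\<bar> + 1)\<^sup>2 / 2)\<close>, so the maximum principle applied after dividing out zeros gives quadratic growth of
  the counting function; then \<open>f = P exp g\<close> with \<open>g\<close> entire. On a disc of radius comparable to \<open>r\<close>, the
  zeros in \<open>\<bar>w\<bar> \<le> r\<close> contribute to \<open>log P\<close> linear factors and a quadratic polynomial, and the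
  remaining ones \<open>o(r\<^sup>3)\<close>. Hence \<open>g\<close> plus a quadratic polynomial depending on \<open>r\<close> has real part at most
  \<open>o(r\<^sup>3)\<close> there, and the Borel--Caratheodory inequality kills all Taylor coefficients of \<open>g\<close> of order at least 3
  (\<open>quadratic_exponent\<close>).

  The duality \<open>exp H = inf E\<close> is convex duality for a continuous potential (\<open>entropy_duality\<close>). Test measures do not see
  the tilt \<open>Re (a z + b z\<^sup>2)\<close>, so the Gibbs variational inequality bounds the functional at every test measure
  by \<open>log E(a, b)\<close> for every \<open>(a, b)\<close>. For the integral over a disc, the minimum over \<open>(a, b)\<close> exists by
  coercivity, and its first-order condition says that the normalised tilted density is itself a test measure,
  at which the functional equals the logarithm of the minimum. As the disc grows, the minimisers stay
  bounded, and a limit point minimises \<open>E\<close>. Uniqueness is strict convexity.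
\<close>

section \<open>Tilted masses\<close>

text \<open>The vanishing of both complex moments of a measure says that every \<open>tilt p\<close> has mean zero.
  Pairing with \<open>p\<close> turns the two complex constraints into real ones that are linear in \<open>p\<close>.\<close>

definition tilt :: "complex \<times> complex \<Rightarrow> complex \<Rightarrow> real" where
  "tilt p z = Re (fst p * z + snd p * z\<^sup>2)"

lemma tilt_add: "tilt (p + q) z = tilt p z + tilt q z"
  by (simp add: tilt_def algebra_simps)

lemma tilt_diff: "tilt (p - q) z = tilt p z - tilt q z"
  by (simp add: tilt_def algebra_simps)

lemma tilt_scaleR: "tilt (s *\<^sub>R p) z = s * tilt p z"
  by (simp add: tilt_def algebra_simps)

lemma abs_tilt_le: "\<bar>tilt p z\<bar> \<le> norm p * (cmod z + (cmod z)\<^sup>2)"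
proof -
  have "\<bar>tilt p z\<bar> \<le> cmod (fst p * z + snd p * z\<^sup>2)"
    unfolding tilt_def by (rule abs_Re_le_cmod)
  also have "\<dots> \<le> cmod (fst p) * cmod z + cmod (snd p) * (cmod z)\<^sup>2"
    by (metis norm_triangle_ineq norm_mult norm_power)
  also have "\<dots> \<le> norm p * cmod z + norm p * (cmod z)\<^sup>2"
    using norm_fst_le[of "fst p" "snd p"] norm_snd_le[of "snd p" "fst p"]
    by (intro add_mono mult_right_mono) auto
  finally show ?thesis by (simp add: algebra_simps)
qed

lemma continuous_on_tilt [continuous_intros]:
  "continuous_on A f \<Longrightarrow> continuous_on A g \<Longrightarrow> continuous_on A (\<lambda>x. tilt (f x) (g x))"
  unfolding tilt_def by (intro continuous_intros)

lemma borel_measurable_tilt [measurable]: "tilt p \<in> borel_measurable borel"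
  by (intro borel_measurable_continuous_onI continuous_intros)

text \<open>Let \<open>p = (a, b)\<close>. If \<open>b \<noteq> 0\<close>, make \<open>b z\<^sup>2\<close> positive and choose the sign of \<open>z\<close> so that the linear part does not hurt;
  otherwise point \<open>z\<close> along \<open>cnj a\<close>. This is what makes nonzero tilts visible to a measure that charges
  open sets.\<close>

lemma tilt_positive_somewhere:
  assumes "p \<noteq> 0" "e > 0"
  shows "\<exists>z. cmod z < e \<and> tilt p z > 0"
proof (cases "snd p = 0")
  case True
  with assms have "fst p \<noteq> 0" by (simp add: prod_eq_iff)
  define z where "z = complex_of_real (e / (2 * cmod (fst p))) * cnj (fst p)"
  have "cmod z = e / 2" using \<open>fst p \<noteq> 0\<close> assms by (simp add: z_def norm_mult norm_divide)
  moreover have "fst p * z = complex_of_real (e / (2 * cmod (fst p)) * (cmod (fst p))\<^sup>2)"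
    unfolding z_def using complex_norm_square[of "fst p"] by (simp add: mult_ac)
  then have "tilt p z = e / (2 * cmod (fst p)) * (cmod (fst p))\<^sup>2"
    by (simp only: tilt_def True) simp
  then have "tilt p z > 0" using \<open>fst p \<noteq> 0\<close> assms by simp
  ultimately show ?thesis using assms by (intro exI[of _ z]) auto
next
  case False
  define w where "w = csqrt (cnj (snd p))"
  have w2: "w\<^sup>2 = cnj (snd p)" by (simp add: w_def)
  have "w \<noteq> 0" using w2 False by auto
  define s where "s = e / (2 * cmod w)"
  have "s > 0" using \<open>w \<noteq> 0\<close> assms by (simp add: s_def)
  define u where "u = (if Re (fst p * w) \<ge> 0 then complex_of_real s * w else - (complex_of_real s * w))"
  have "cmod u = s * cmod w" using \<open>s > 0\<close> by (simp add: u_def norm_mult)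
  then have "cmod u = e / 2" using \<open>w \<noteq> 0\<close> by (simp add: s_def)
  have "u\<^sup>2 = complex_of_real (s\<^sup>2) * cnj (snd p)" by (auto simp: u_def power_mult_distrib w2)
  then have "snd p * u\<^sup>2 = complex_of_real (s\<^sup>2 * (cmod (snd p))\<^sup>2)"
    using complex_norm_square[of "snd p"] by (simp add: mult_ac)
  then have "Re (snd p * u\<^sup>2) > 0" using False \<open>s > 0\<close>
    by (simp only: Re_complex_of_real) simp
  moreover have "Re (fst p * u) \<ge> 0"
  proof (cases "Re (fst p * w) \<ge> 0")
    case True
    then have "fst p * u = complex_of_real s * (fst p * w)" by (simp add: u_def)
    then have "Re (fst p * u) = s * Re (fst p * w)" by (simp only: Re_complex_of_real times_complex.simps Im_complex_of_real)
    then show ?thesis using True \<open>s > 0\<close> by (simp only: mult_nonneg_nonneg less_imp_le)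
  next
    case f: False
    then have "fst p * u = - (complex_of_real s * (fst p * w))" by (simp add: u_def)
    then have "Re (fst p * u) = - (s * Re (fst p * w))" by simp
    then show ?thesis using f \<open>s > 0\<close> by (simp add: mult_le_0_iff)
  qed
  ultimately have "tilt p u > 0" unfolding tilt_def by simp
  then show ?thesis using \<open>cmod u = e / 2\<close> assms by (intro exI[of _ u]) auto
qed

text \<open>Measures to be tilted: all integrals are finite because of the bounded support, and no nonzero tilt is
  nonpositive almost everywhere because open sets near the origin are charged.\<close>

locale bounded_planar_measure = finite_measure \<nu> for \<nu> :: "complex measure" +
  fixes R :: real
  assumes sets_eq [measurable_cong, simp]: "sets \<nu> = sets borel"
    and bounded_support: "AE z in \<nu>. cmod z \<le> R"
    and open_pos: "open U \<Longrightarrow> U \<inter> ball 0 1 \<noteq> {} \<Longrightarrow> emeasure \<nu> U > 0"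
begin

lemma space_eq [simp]: "space \<nu> = UNIV"
  using sets_eq_imp_space_eq[OF sets_eq] by simp

lemma integrable_continuous:
  fixes f :: "complex \<Rightarrow> real"
  assumes "continuous_on UNIV f"
  shows "integrable \<nu> f"
proof -
  have "compact (f ` cball 0 R)"
    by (intro compact_continuous_image continuous_on_subset[OF assms]) auto
  then obtain B where B: "\<And>z. cmod z \<le> R \<Longrightarrow> \<bar>f z\<bar> \<le> B"
    using compact_imp_bounded[of "f ` cball 0 R"] by (fastforce simp: bounded_iff)
  show ?thesis
  proof (rule integrable_const_bound)
    show "AE x in \<nu>. norm (f x) \<le> B" using bounded_support by eventually_elim (use B in auto)
    show "f \<in> borel_measurable \<nu>"
      by (simp add: measurable_cong_sets[OF sets_eq refl] borel_measurable_continuous_onI[OF assms])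
  qed
qed

lemma integral_pos_if_somewhere_pos:
  fixes f :: "complex \<Rightarrow> real"
  assumes "continuous_on UNIV f" "\<And>z. f z \<ge> 0" "cmod w < 1" "f w > 0"
  shows "(\<integral>z. f z \<partial>\<nu>) > 0"
proof -
  have op: "open {z. f z > 0}" using open_Collect_less[OF continuous_on_const assms(1), of 0] by simp
  have "emeasure \<nu> {z. f z > 0} > 0"
    by (rule open_pos[OF op]) (use assms in auto)
  have int: "integrable \<nu> f" by (rule integrable_continuous) fact
  have "(\<integral>z. f z \<partial>\<nu>) \<noteq> 0"
  proof
    assume "(\<integral>z. f z \<partial>\<nu>) = 0"
    then have "AE z in \<nu>. f z = 0" using integral_nonneg_eq_0_iff_AE[OF int] assms(2) by simp
    then have "AE z in \<nu>. \<not> (f z > 0)" by eventually_elim auto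
    then have "emeasure \<nu> {z. f z > 0} = 0"
      using op by (subst (asm) AE_iff_measurable[OF _ refl]) auto
    with \<open>emeasure \<nu> {z. f z > 0} > 0\<close> show False by simp
  qed
  moreover have "(\<integral>z. f z \<partial>\<nu>) \<ge> 0" using assms(2) by simp
  ultimately show ?thesis by simp
qed

text \<open>On the bounded support the tilts along a convergent sequence of parameters are uniformly bounded, so
  dominated convergence applies.\<close>

lemma continuous_on_integral_tilt:
  fixes h :: "real \<Rightarrow> real"
  assumes h: "continuous_on UNIV h"
  shows "continuous_on UNIV (\<lambda>p. \<integral>z. h (tilt p z) \<partial>\<nu>)"
proof (rule continuous_at_imp_continuous_on, intro ballI)
  fix p :: "complex \<times> complex"
  show "isCont (\<lambda>p. \<integral>z. h (tilt p z) \<partial>\<nu>) p"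
  proof (subst continuous_at_sequentially, intro allI impI)
    fix q assume q: "q \<longlonglongrightarrow> p"
    then obtain K where K: "\<And>n. norm (q n) \<le> K"
      using convergent_imp_Bseq[OF convergentI, OF q] by (auto elim!: BseqE)
    have "compact (h ` cball 0 (K * (\<bar>R\<bar> + R\<^sup>2)))"
      by (intro compact_continuous_image continuous_on_subset[OF h]) auto
    then obtain B where B: "\<And>t. \<bar>t\<bar> \<le> K * (\<bar>R\<bar> + R\<^sup>2) \<Longrightarrow> \<bar>h t\<bar> \<le> B"
      using compact_imp_bounded[of "h ` cball 0 (K * (\<bar>R\<bar> + R\<^sup>2))"]
      by (fastforce simp: bounded_iff)
    have [measurable]: "h \<in> borel_measurable borel" by (rule borel_measurable_continuous_onI[OF h])
    have "(\<lambda>n. \<integral>z. h (tilt (q n) z) \<partial>\<nu>) \<longlonglongrightarrow> (\<integral>z. h (tilt p z) \<partial>\<nu>)"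
    proof (rule integral_dominated_convergence[where w = "\<lambda>_. B"])
      show "AE z in \<nu>. (\<lambda>n. h (tilt (q n) z)) \<longlonglongrightarrow> h (tilt p z)"
      proof (rule AE_I2)
        fix z
        have "(\<lambda>n. tilt (q n) z) \<longlonglongrightarrow> tilt p z"
          unfolding tilt_def using q by (intro tendsto_intros)
        then show "(\<lambda>n. h (tilt (q n) z)) \<longlonglongrightarrow> h (tilt p z)"
          using h by (intro continuous_on_tendsto_compose[OF h]) auto
      qed
      show "AE z in \<nu>. norm (h (tilt (q n) z)) \<le> B" for n
        using bounded_support
      proof eventually_elim
        case (elim z)
        have "\<bar>tilt (q n) z\<bar> \<le> norm (q n) * (cmod z + (cmod z)\<^sup>2)" by (rule abs_tilt_le)
        also have "\<dots> \<le> K * (\<bar>R\<bar> + R\<^sup>2)"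
          using K[of n] elim order_trans[OF norm_ge_zero K[of n]]
          by (intro mult_mono add_mono power_mono order_trans[OF elim]) auto
        finally show ?case using B by simp
      qed
    qed (auto simp: measurable_cong_sets[OF sets_eq refl])
    then show "((\<lambda>p. \<integral>z. h (tilt p z) \<partial>\<nu>) \<circ> q) \<longlonglongrightarrow> (\<integral>z. h (tilt p z) \<partial>\<nu>)"
      by (simp add: o_def)
  qed
qed

definition tilted_mass :: "complex \<times> complex \<Rightarrow> real" where
  "tilted_mass p = (\<integral>z. exp (2 * tilt p z) \<partial>\<nu>)"

text \<open>Since \<open>exp (2 t) \<ge> max 0 t\<close>, the tilted mass dominates the integral of the positive part of the tilt.
  That integral is positively homogeneous in \<open>p\<close>, and on the compact unit sphere it has a positive minimum.\<close>

lemma coercive: "\<exists>c>0. \<forall>p. c * norm p \<le> tilted_mass p"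
proof -
  define K where "K p = (\<integral>z. max 0 (tilt p z) \<partial>\<nu>)" for p
  have "continuous_on UNIV K"
    unfolding K_def by (rule continuous_on_integral_tilt) (intro continuous_intros)
  have int: "integrable \<nu> (\<lambda>z. max 0 (tilt p z))" for p
    by (intro integrable_continuous continuous_intros)
  have "\<exists>p0\<in>sphere 0 1. \<forall>p\<in>sphere (0::complex\<times>complex) 1. K p0 \<le> K p"
    by (intro continuous_attains_inf continuous_on_subset[OF \<open>continuous_on UNIV K\<close>])
       (auto intro!: exI[of _ "(1, 0) :: complex \<times> complex"] simp: norm_prod_def)
  then obtain p0 :: "complex \<times> complex" where p0: "norm p0 = 1" "\<And>p. norm p = 1 \<Longrightarrow> K p0 \<le> K p"
    by auto
  obtain w where "cmod w < 1" "tilt p0 w > 0"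
    using tilt_positive_somewhere[of p0 1] p0(1) by force
  then have pos: "K p0 > 0" unfolding K_def
    by (intro integral_pos_if_somewhere_pos[where w = w] continuous_intros) auto
  have "K p0 * norm p \<le> tilted_mass p" for p
  proof (cases "p = 0")
    case True
    then show ?thesis by (simp add: tilted_mass_def)
  next
    case False
    define q where "q = p /\<^sub>R norm p"
    have q: "norm q = 1" "p = norm p *\<^sub>R q" using False by (auto simp: q_def)
    have "K p0 * norm p \<le> K q * norm p" using p0(2)[OF q(1)] by (intro mult_right_mono) auto
    also have "\<dots> = (\<integral>z. norm p * max 0 (tilt q z) \<partial>\<nu>)" unfolding K_def by simp
    also have "\<dots> \<le> (\<integral>z. exp (2 * tilt p z) \<partial>\<nu>)"
    proof (rule integral_mono)
      show "integrable \<nu> (\<lambda>z. norm p * max 0 (tilt q z))" using int by simp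
      show "integrable \<nu> (\<lambda>z. exp (2 * tilt p z))" by (intro integrable_continuous continuous_intros)
      fix z
      have "norm p * max 0 (tilt q z) = max 0 (tilt p z)"
        by (subst (2) q(2)) (auto simp: tilt_scaleR max_def zero_le_mult_iff)
      also have "\<dots> \<le> exp (2 * tilt p z)"
        using exp_ge_add_one_self[of "2 * tilt p z"] by (cases "tilt p z \<ge> 0") (simp_all add: max_def del: exp_ge_add_one_self)
      finally show "norm p * max 0 (tilt q z) \<le> exp (2 * tilt p z)" .
    qed
    finally show ?thesis by (simp add: tilted_mass_def)
  qed
  then show ?thesis using pos by auto
qed

lemma minimiser_exists: "\<exists>p. \<forall>q. tilted_mass p \<le> tilted_mass q"
proof -
  obtain c where c: "c > 0" "\<And>p. c * norm p \<le> tilted_mass p" using coercive by auto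
  have cont: "continuous_on UNIV tilted_mass"
    unfolding tilted_mass_def by (rule continuous_on_integral_tilt[of "\<lambda>t. exp (2 * t)"]) (intro continuous_intros)
  have "tilted_mass 0 \<ge> 0" by (simp add: tilted_mass_def)
  have "\<exists>p\<in>cball 0 (tilted_mass 0 / c). \<forall>q\<in>cball 0 (tilted_mass 0 / c). tilted_mass p \<le> tilted_mass q"
    by (intro continuous_attains_inf continuous_on_subset[OF cont])
       (use divide_nonneg_pos[OF \<open>tilted_mass 0 \<ge> 0\<close> c(1)] in auto)
  then obtain p where p: "\<And>q. norm q \<le> tilted_mass 0 / c \<Longrightarrow> tilted_mass p \<le> tilted_mass q"
    by (metis mem_cball_0)
  have "tilted_mass p \<le> tilted_mass q" for q
  proof (cases "norm q \<le> tilted_mass 0 / c")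
    case True
    then show ?thesis by (rule p)
  next
    case False
    then have "tilted_mass 0 \<le> c * norm q" using c(1) by (simp add: field_simps)
    also have "\<dots> \<le> tilted_mass q" by (rule c(2))
    finally show ?thesis using p[of 0] divide_nonneg_pos[OF \<open>tilted_mass 0 \<ge> 0\<close> c(1)] by simp
  qed
  then show ?thesis by blast
qed

text \<open>The first-order condition, without differentiating under the integral: by \<open>exp x \<le> 1 + x + x\<^sup>2\<close> for
  \<open>\<bar>x\<bar> \<le> 1\<close>, the increment from \<open>p\<close> to \<open>p + s q\<close> is at most \<open>s D + s\<^sup>2 Q\<close>, and this can be nonnegative for all
  small \<open>s\<close> of both signs only if \<open>D = 0\<close>.\<close>

lemma stationary_at_minimiser:
  assumes min: "\<And>q. tilted_mass p \<le> tilted_mass q"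
  shows "(\<integral>z. tilt q z * exp (2 * tilt p z) \<partial>\<nu>) = 0"
proof -
  define M where "M = norm q * (\<bar>R\<bar> + R\<^sup>2) + 1"
  have "M \<ge> 1" by (simp add: M_def)
  define D where "D = (\<integral>z. 2 * tilt q z * exp (2 * tilt p z) \<partial>\<nu>)"
  define Q where "Q = (\<integral>z. (2 * tilt q z)\<^sup>2 * exp (2 * tilt p z) \<partial>\<nu>)"
  have ineq: "0 \<le> s * D + s\<^sup>2 * Q" if "\<bar>s\<bar> \<le> 1 / (2 * M)" for s
  proof -
    have "tilted_mass p \<le> tilted_mass (p + s *\<^sub>R q)" by (rule min)
    also have "\<dots> \<le> (\<integral>z. exp (2 * tilt p z) + s * (2 * tilt q z * exp (2 * tilt p z))
                      + s\<^sup>2 * ((2 * tilt q z)\<^sup>2 * exp (2 * tilt p z)) \<partial>\<nu>)"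
      unfolding tilted_mass_def
    proof (rule integral_mono_AE)
      show "AE z in \<nu>. exp (2 * tilt (p + s *\<^sub>R q) z) \<le> exp (2 * tilt p z)
              + s * (2 * tilt q z * exp (2 * tilt p z)) + s\<^sup>2 * ((2 * tilt q z)\<^sup>2 * exp (2 * tilt p z))"
        using bounded_support
      proof eventually_elim
        case (elim z)
        define x where "x = s * (2 * tilt q z)"
        have "\<bar>tilt q z\<bar> \<le> norm q * (cmod z + (cmod z)\<^sup>2)" by (rule abs_tilt_le)
        also have "\<dots> \<le> norm q * (\<bar>R\<bar> + R\<^sup>2)"
          using elim by (intro mult_mono add_mono power_mono order_trans[OF elim]) auto
        finally have "\<bar>tilt q z\<bar> \<le> M" by (simp add: M_def)
        then have "\<bar>x\<bar> \<le> (1 / (2 * M)) * (2 * M)"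
          unfolding x_def abs_mult using that \<open>M \<ge> 1\<close> by (intro mult_mono) auto
        then have "\<bar>x\<bar> \<le> 1" using \<open>M \<ge> 1\<close> by simp
        then have "exp x \<le> 1 + x + x\<^sup>2"
        proof (cases "x \<ge> 0")
          case True
          then show ?thesis using \<open>\<bar>x\<bar> \<le> 1\<close> by (intro exp_bound) auto
        next
          case False
          have "exp x * exp (-x) = 1" by (simp add: exp_minus)
          \<comment> \<open>Negative \<open>x\<close> is reduced to \<open>1 - x \<le> exp (- x)\<close>.\<close>
          have "1 \<le> (1 + x + x\<^sup>2) * (1 - x)"
          proof -
            have "(1 + x + x\<^sup>2) * (1 - x) = 1 - x * x\<^sup>2" by (simp add: algebra_simps power2_eq_square)
            moreover have "x * x\<^sup>2 \<le> 0" using False by (simp add: mult_le_0_iff)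
            ultimately show ?thesis by simp
          qed
          also have "\<dots> \<le> (1 + x + x\<^sup>2) * exp (-x)"
            using exp_ge_add_one_self[of "-x"] \<open>\<bar>x\<bar> \<le> 1\<close> by (intro mult_left_mono) auto
          finally show ?thesis by (simp add: exp_minus field_simps)
        qed
        then have "exp x * exp (2 * tilt p z) \<le> (1 + x + x\<^sup>2) * exp (2 * tilt p z)"
          by (intro mult_right_mono) auto
        moreover have "exp (2 * tilt (p + s *\<^sub>R q) z) = exp x * exp (2 * tilt p z)"
          by (simp add: tilt_add tilt_scaleR x_def algebra_simps flip: exp_add)
        ultimately show ?case by (simp add: x_def algebra_simps power_mult_distrib)
      qed
    qed (intro integrable_continuous continuous_intros)+
    also have "\<dots> = tilted_mass p + s * D + s\<^sup>2 * Q"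
      unfolding tilted_mass_def D_def Q_def
      by (subst Bochner_Integration.integral_add, (intro integrable_continuous continuous_intros)+)+ simp
    finally show ?thesis by simp
  qed
  have "D = 0"
  proof (rule ccontr)
    assume "D \<noteq> 0"
    \<comment> \<open>Small enough for the quadratic term to be at most half of the linear one.\<close>
    define t where "t = min (1 / (2 * M)) (\<bar>D\<bar> / (2 * (\<bar>Q\<bar> + 1)))"
    have "t > 0" using \<open>M \<ge> 1\<close> \<open>D \<noteq> 0\<close> by (simp add: t_def)
    have "0 \<le> (- sgn D * t) * D + (- sgn D * t)\<^sup>2 * Q"
      using \<open>t > 0\<close> by (intro ineq) (auto simp: t_def abs_mult sgn_if)
    also have "\<dots> = t * (t * Q - \<bar>D\<bar>)"
      using \<open>D \<noteq> 0\<close> by (auto simp: sgn_if abs_if algebra_simps power2_eq_square)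
    finally have "\<bar>D\<bar> \<le> t * Q" using \<open>t > 0\<close> by (simp add: zero_le_mult_iff)
    also have "\<dots> \<le> t * (\<bar>Q\<bar> + 1)" using \<open>t > 0\<close> by (intro mult_left_mono) auto
    also have "\<dots> \<le> \<bar>D\<bar> / (2 * (\<bar>Q\<bar> + 1)) * (\<bar>Q\<bar> + 1)"
      by (intro mult_right_mono) (auto simp: t_def)
    also have "\<dots> = \<bar>D\<bar> / 2" by (simp add: field_simps)
    finally show False using \<open>D \<noteq> 0\<close> by simp
  qed
  then show ?thesis by (simp add: D_def mult.assoc)
qed

end

section \<open>Entropy duality for a continuous potential\<close>

text \<open>For \<open>V\<close> the canonical potential this is \<^const>\<open>gauss_energy\<close>; the duality below holds for any continuous \<open>V\<close>.\<close>

definition energy :: "(complex \<Rightarrow> real) \<Rightarrow> complex \<times> complex \<Rightarrow> ennreal" where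
  "energy V p = (\<integral>\<^sup>+z. ennreal (exp (2 * V z + 2 * tilt p z)) \<partial>gauss_measure)"

definition disc_measure :: "(complex \<Rightarrow> real) \<Rightarrow> real \<Rightarrow> complex measure" where
  "disc_measure V R = density gauss_measure (\<lambda>z. ennreal (exp (2 * V z)) * indicator (cball 0 R) z)"

lemma sets_gauss_measure [measurable_cong, simp]: "sets gauss_measure = sets borel"
  by (simp add: gauss_measure_def)

lemma space_gauss_measure [simp]: "space gauss_measure = UNIV"
  by (simp add: gauss_measure_def)

lemma AE_gauss_measure_iff: "(AE z in gauss_measure. P z) \<longleftrightarrow> (AE z in lborel. P z)"
  unfolding gauss_measure_def by (subst AE_density) auto

lemma emeasure_gauss_open_pos:
  assumes "open U" "U \<noteq> {}"
  shows "emeasure gauss_measure U > 0"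
proof -
  have "emeasure gauss_measure U \<noteq> 0"
  proof
    assume "emeasure gauss_measure U = 0"
    then have "AE z in gauss_measure. z \<notin> U"
      using assms by (intro AE_I[of _ _ U]) auto
    then have "AE z in lborel. z \<notin> U" by (simp add: AE_gauss_measure_iff)
    then have "emeasure lborel U = 0"
      using assms by (subst (asm) AE_iff_measurable[OF _ refl]) auto
    then have "U \<in> null_sets lebesgue"
      using assms by (intro null_sets_completionI) (auto simp: null_sets_def)
    then show False using open_not_negligible[OF assms] by (simp add: negligible_iff_null_sets)
  qed
  then show ?thesis by (simp add: zero_less_iff_neq_zero)
qed

lemma emeasure_gauss_cball_finite: "emeasure gauss_measure (cball 0 R) < \<infinity>"
proof -
  have "emeasure gauss_measure (cball 0 R) = (\<integral>\<^sup>+z. ennreal (exp (- (cmod z)\<^sup>2) / pi) * indicator (cball 0 R) z \<partial>lborel)"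
    unfolding gauss_measure_def by (subst emeasure_density) auto
  also have "\<dots> \<le> (\<integral>\<^sup>+z. 1 * indicator (cball (0::complex) R) z \<partial>lborel)"
  proof (rule nn_integral_mono)
    fix z :: complex
    have "exp (- (cmod z)\<^sup>2) / pi \<le> 1 / 1" using pi_ge_two by (intro frac_le) auto
    then show "ennreal (exp (- (cmod z)\<^sup>2) / pi) * indicator (cball 0 R) z \<le> 1 * indicator (cball 0 R) z"
      by (intro mult_right_mono) (simp_all add: ennreal_le_1)
  qed
  also have "\<dots> < \<infinity>" using emeasure_lborel_cball_finite[of "0::complex" R] by simp
  finally show ?thesis .
qed

interpretation gauss: sigma_finite_measure gauss_measure
proof
  show "\<exists>A. countable A \<and> A \<subseteq> sets gauss_measure \<and> \<Union> A = space gauss_measure \<and> (\<forall>a\<in>A. emeasure gauss_measure a \<noteq> \<infinity>)"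
  proof (intro exI[of _ "range (\<lambda>n::nat. cball 0 (real n))"] conjI)
    show "\<Union> (range (\<lambda>n::nat. cball 0 (real n))) = space gauss_measure"
      by (auto simp: real_arch_simple)
    show "\<forall>a\<in>range (\<lambda>n::nat. cball 0 (real n)). emeasure gauss_measure a \<noteq> \<infinity>"
      using emeasure_gauss_cball_finite by (metis imageE less_irrefl)
  qed auto
qed

lemma bounded_planar_measure_disc:
  assumes V: "continuous_on UNIV V" and R: "R \<ge> 1"
  shows "bounded_planar_measure (disc_measure V R) R"
proof -
  have [measurable]: "V \<in> borel_measurable borel" by (rule borel_measurable_continuous_onI[OF V])
  have [measurable]: "Measurable.pred borel (\<lambda>z::complex. z \<in> cball 0 R)" by (simp add: pred_def)
  have dm [measurable]: "(\<lambda>z. ennreal (exp (2 * V z)) * indicator (cball 0 R) z) \<in> borel_measurable gauss_measure"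
    by measurable
  have "compact (V ` cball 0 R)"
    by (intro compact_continuous_image continuous_on_subset[OF V]) auto
  then obtain B where B: "\<And>z. cmod z \<le> R \<Longrightarrow> V z \<le> B"
    using compact_imp_bounded[of "V ` cball 0 R"] unfolding bounded_iff
    by (metis abs_le_D1 imageI mem_cball_0 real_norm_def)
  have "emeasure (disc_measure V R) (space (disc_measure V R)) = (\<integral>\<^sup>+z. ennreal (exp (2 * V z)) * indicator (cball 0 R) z \<partial>gauss_measure)"
    unfolding disc_measure_def by (subst emeasure_density) auto
  also have "\<dots> \<le> (\<integral>\<^sup>+z. ennreal (exp (2 * B)) * indicator (cball 0 R) z \<partial>gauss_measure)"
    by (intro nn_integral_mono) (auto simp: indicator_def intro!: ennreal_leI B)
  also have "\<dots> < \<infinity>" using emeasure_gauss_cball_finite[of R]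
    by (subst nn_integral_cmult_indicator) (auto simp: ennreal_mult_less_top)
  finally have fin: "emeasure (disc_measure V R) (space (disc_measure V R)) < \<infinity>" .
  show ?thesis
  proof (intro bounded_planar_measure.intro bounded_planar_measure_axioms.intro finite_measureI)
    show "emeasure (disc_measure V R) (space (disc_measure V R)) \<noteq> \<infinity>" using fin by simp
    show "sets (disc_measure V R) = sets borel" by (simp add: disc_measure_def)
    show "AE z in disc_measure V R. cmod z \<le> R"
      unfolding disc_measure_def by (subst AE_density[OF dm]) (auto simp: indicator_def)
    fix U :: "complex set" assume U: "open U" "U \<inter> ball 0 1 \<noteq> {}"
    have [measurable]: "U \<in> sets borel" using U by auto
    have "emeasure (disc_measure V R) U \<noteq> 0"
    proof
      assume 0: "emeasure (disc_measure V R) U = 0"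
      have "(\<integral>\<^sup>+z. ennreal (exp (2 * V z)) * indicator (cball 0 R) z * indicator U z \<partial>gauss_measure) = 0"
        using 0 U unfolding disc_measure_def by (subst (asm) emeasure_density) auto
      then have "AE z in gauss_measure. ennreal (exp (2 * V z)) * indicator (cball 0 R) z * indicator U z = 0"
        using U by (subst (asm) nn_integral_0_iff_AE) auto
      then have "AE z in gauss_measure. z \<notin> U \<inter> ball 0 1"
        by eventually_elim (use R in \<open>auto simp: indicator_def ennreal_zero_less_mult_iff split: if_splits\<close>)
      then have "emeasure gauss_measure (U \<inter> ball 0 1) = 0"
        using U by (subst (asm) AE_iff_measurable[where N = "U \<inter> ball 0 1"]) auto
      with emeasure_gauss_open_pos[of "U \<inter> ball 0 1"] U show False by auto
    qed
    then show "emeasure (disc_measure V R) U > 0" by (simp add: zero_less_iff_neq_zero)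
  qed
qed

abbreviation disc_energy :: "(complex \<Rightarrow> real) \<Rightarrow> real \<Rightarrow> complex \<times> complex \<Rightarrow> real" where
  "disc_energy V R \<equiv> bounded_planar_measure.tilted_mass (disc_measure V R)"

lemma ennreal_disc_energy:
  assumes V: "continuous_on UNIV V" and R: "R \<ge> 1"
  shows "ennreal (disc_energy V R p) = (\<integral>\<^sup>+z\<in>cball 0 R. ennreal (exp (2 * V z + 2 * tilt p z)) \<partial>gauss_measure)"
proof -
  interpret bounded_planar_measure "disc_measure V R" R by (rule bounded_planar_measure_disc) fact+
  have [measurable]: "V \<in> borel_measurable borel" by (rule borel_measurable_continuous_onI[OF V])
  have [measurable]: "Measurable.pred borel (\<lambda>z::complex. z \<in> cball 0 R)" by (simp add: pred_def)
  have "ennreal (disc_energy V R p) = (\<integral>\<^sup>+z. ennreal (exp (2 * tilt p z)) \<partial>disc_measure V R)"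
    unfolding tilted_mass_def
    by (rule nn_integral_eq_integral[symmetric]) (auto intro!: integrable_continuous continuous_intros)
  also have "\<dots> = (\<integral>\<^sup>+z\<in>cball 0 R. ennreal (exp (2 * V z + 2 * tilt p z)) \<partial>gauss_measure)"
    unfolding disc_measure_def
    by (subst nn_integral_density) (auto intro!: nn_integral_cong simp: exp_add ennreal_mult mult_ac)
  finally show ?thesis .
qed

lemma disc_energy_pos:
  assumes V: "continuous_on UNIV V" and R: "R \<ge> 1"
  shows "disc_energy V R p > 0"
proof -
  interpret bounded_planar_measure "disc_measure V R" R by (rule bounded_planar_measure_disc) fact+
  show ?thesis unfolding tilted_mass_def
    by (rule integral_pos_if_somewhere_pos[where w = 0]) (auto intro!: continuous_intros)
qed

lemma disc_energy_le_energy: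
  assumes V: "continuous_on UNIV V" and R: "R \<ge> 1"
  shows "ennreal (disc_energy V R p) \<le> energy V p"
  unfolding ennreal_disc_energy[OF assms] energy_def
  by (intro nn_integral_mono) (auto simp: indicator_def)

lemma disc_energy_mono:
  assumes V: "continuous_on UNIV V" and R: "1 \<le> R" "R \<le> S"
  shows "disc_energy V R p \<le> disc_energy V S p"
proof -
  have "ennreal (disc_energy V R p) \<le> ennreal (disc_energy V S p)"
    unfolding ennreal_disc_energy[OF V R(1)] ennreal_disc_energy[OF V order_trans[OF R]]
    using R by (intro nn_integral_mono) (auto simp: indicator_def)
  then show ?thesis
    using disc_energy_pos[OF V order_trans[OF R], of p] by (simp add: ennreal_le_iff)
qed

lemma energy_le_if_disc_energy_le:
  assumes V: "continuous_on UNIV V" and le: "\<And>n. 1 \<le> n \<Longrightarrow> disc_energy V (real n) p \<le> B"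
  shows "energy V p \<le> ennreal B"
proof -
  have [measurable]: "V \<in> borel_measurable borel" by (rule borel_measurable_continuous_onI[OF V])
  have [measurable]: "Measurable.pred borel (\<lambda>z::complex. z \<in> cball 0 R)" for R by (simp add: pred_def)
  define g where "g n z = ennreal (exp (2 * V z + 2 * tilt p z)) * indicator (cball 0 (real (Suc n))) z" for n z
  have "(\<Squnion>n. g n z) = ennreal (exp (2 * V z + 2 * tilt p z))" for z
  proof (rule antisym)
    show "(\<Squnion>n. g n z) \<le> ennreal (exp (2 * V z + 2 * tilt p z))"
      by (rule SUP_least) (auto simp: g_def indicator_def)
    obtain n :: nat where "cmod z \<le> real n" using real_arch_simple by blast
    then have "g n z = ennreal (exp (2 * V z + 2 * tilt p z))" by (simp add: g_def)
    then show "ennreal (exp (2 * V z + 2 * tilt p z)) \<le> (\<Squnion>n. g n z)" by (metis SUP_upper UNIV_I)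
  qed
  then have "energy V p = (\<integral>\<^sup>+z. (\<Squnion>n. g n z) \<partial>gauss_measure)" by (simp add: energy_def)
  also have "\<dots> = (\<Squnion>n. \<integral>\<^sup>+z. g n z \<partial>gauss_measure)"
  proof (rule nn_integral_monotone_convergence_SUP)
    show "incseq g" by (auto simp: incseq_def le_fun_def g_def indicator_def)
    show "g i \<in> borel_measurable gauss_measure" for i
      unfolding g_def[abs_def] by measurable
  qed
  also have "\<dots> \<le> ennreal B"
  proof (rule SUP_least)
    fix n
    have "(\<integral>\<^sup>+z. g n z \<partial>gauss_measure) = ennreal (disc_energy V (Suc n) p)"
      unfolding g_def by (subst ennreal_disc_energy[OF V]) auto
    also have "\<dots> \<le> ennreal B" using le[of "Suc n"] by (intro ennreal_leI) auto
    finally show "(\<integral>\<^sup>+z. g n z \<partial>gauss_measure) \<le> ennreal B" .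
  qed
  finally show ?thesis .
qed

lemma energy_pos:
  assumes V: "continuous_on UNIV V"
  shows "energy V p > 0"
  using disc_energy_le_energy[OF V, of 1 p] disc_energy_pos[OF V, of 1 p]
  by (metis ennreal_eq_0_iff leD order.refl zero_less_iff_neq_zero)

text \<open>On \<^const>\<open>test_measures\<close> the relative entropy is finite, so the supremum defining
  \<^const>\<open>entropy_functional\<close> is a supremum of these real numbers.\<close>

definition free_energy :: "(complex \<Rightarrow> real) \<Rightarrow> complex measure \<Rightarrow> real" where
  "free_energy V \<mu> = 2 * (\<integral>z. V z \<partial>\<mu>) - KL_divergence (exp 1) gauss_measure \<mu>"

text \<open>The normalised tilted density over the disc has vanishing moments by the first-order condition, so it
  is a test measure. Its log-density is \<open>2 V + 2 tilt p - ln E\<close>; the mean of the tilt being zero, the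
  functional takes the value \<open>ln E\<close> there.\<close>

lemma disc_gibbs_measure:
  assumes V: "continuous_on UNIV V" and R: "R \<ge> 1"
    and min: "\<And>q. disc_energy V R p \<le> disc_energy V R q"
  shows "\<exists>\<mu>\<in>test_measures. exp (free_energy V \<mu>) = disc_energy V R p"
proof -
  interpret bounded_planar_measure "disc_measure V R" R by (rule bounded_planar_measure_disc) fact+
  have [measurable]: "V \<in> borel_measurable borel" by (rule borel_measurable_continuous_onI[OF V])
  have [measurable]: "Measurable.pred borel (\<lambda>z::complex. z \<in> cball 0 R)" by (simp add: pred_def)
  define E where "E = disc_energy V R p"
  have "E > 0" unfolding E_def by (rule disc_energy_pos[OF V R])
  define f where "f z = exp (2 * V z + 2 * tilt p z) / E * indicator (cball 0 R) z" for z
  have f_nonneg: "f z \<ge> 0" for z using \<open>E > 0\<close> by (auto simp: f_def)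
  have [measurable]: "f \<in> borel_measurable borel" unfolding f_def[abs_def] by measurable
  define \<mu> where "\<mu> = density gauss_measure (\<lambda>z. ennreal (f z))"
  have sets_\<mu> [measurable_cong, simp]: "sets \<mu> = sets borel" by (simp add: \<mu>_def)
  have space_\<mu> [simp]: "space \<mu> = UNIV" by (simp add: \<mu>_def)
  have \<mu>_disc: "\<mu> = density (disc_measure V R) (\<lambda>z. ennreal (exp (2 * tilt p z) / E))"
    unfolding \<mu>_def disc_measure_def
    by (subst density_density_eq)
       (auto intro!: density_cong AE_I2 simp: f_def exp_add indicator_def ennreal_mult'' [symmetric] \<open>E > 0\<close> less_imp_le)
  have "emeasure \<mu> (space \<mu>) = (\<integral>\<^sup>+z. ennreal (exp (2 * tilt p z) / E) \<partial>disc_measure V R)"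
    unfolding \<mu>_disc by (subst emeasure_density) auto
  also have "\<dots> = ennreal (\<integral>z. exp (2 * tilt p z) / E \<partial>disc_measure V R)"
    using \<open>E > 0\<close> by (intro nn_integral_eq_integral integrable_continuous continuous_intros AE_I2) auto
  also have "(\<integral>z. exp (2 * tilt p z) / E \<partial>disc_measure V R) = 1"
    using \<open>E > 0\<close> by (simp add: E_def tilted_mass_def)
  finally have "emeasure \<mu> (space \<mu>) = 1" by simp
  then interpret \<mu>: prob_space \<mu> by (rule prob_spaceI)
  have ac: "absolutely_continuous gauss_measure \<mu>"
    unfolding \<mu>_def by (rule absolutely_continuousI_density) simp
  have supp: "emeasure \<mu> (- cball 0 R) = 0"
  proof -
    have "emeasure \<mu> (- cball 0 R) = (\<integral>\<^sup>+z. ennreal (f z) * indicator (- cball 0 R) z \<partial>gauss_measure)"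
      unfolding \<mu>_def by (subst emeasure_density) auto
    also have "\<dots> = (\<integral>\<^sup>+z. 0 \<partial>gauss_measure)"
      by (intro nn_integral_cong) (auto simp: f_def indicator_def)
    finally show ?thesis by simp
  qed
  then have AE_supp: "AE z in \<mu>. cmod z \<le> R"
    by (intro AE_I[of _ _ "- cball 0 R"]) auto
  interpret \<mu>': bounded_planar_measure \<mu> R
  proof
    show "AE z in \<mu>. cmod z \<le> R" by fact
    fix U :: "complex set" assume U: "open U" "U \<inter> ball 0 1 \<noteq> {}"
    have [measurable]: "U \<in> sets borel" using U by auto
    have "emeasure \<mu> U \<noteq> 0"
    proof
      assume "emeasure \<mu> U = 0"
      then have "AE z in disc_measure V R. ennreal (exp (2 * tilt p z) / E) * indicator U z = 0"
        using U unfolding \<mu>_disc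
        by (subst (asm) emeasure_density; (subst (asm) nn_integral_0_iff_AE)?) auto
      then have "AE z in disc_measure V R. z \<notin> U"
        by eventually_elim (use \<open>E > 0\<close> in \<open>auto simp: indicator_def split: if_splits\<close>)
      then have "emeasure (disc_measure V R) U = 0"
        using U by (subst (asm) AE_iff_measurable[OF _ refl]) auto
      with open_pos[OF U] show False by simp
    qed
    then show "emeasure \<mu> U > 0" by (simp add: zero_less_iff_neq_zero)
  qed simp
  have tilt_mean: "(\<integral>z. tilt q z \<partial>\<mu>) = 0" for q
  proof -
    have "(\<integral>z. tilt q z \<partial>\<mu>) = (\<integral>z. exp (2 * tilt p z) / E * tilt q z \<partial>disc_measure V R)"
      unfolding \<mu>_disc using \<open>E > 0\<close> by (subst integral_density) (auto intro!: AE_I2)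
    also have "\<dots> = (\<integral>z. tilt q z * exp (2 * tilt p z) \<partial>disc_measure V R) / E"
      by (simp add: mult.commute)
    finally show ?thesis using stationary_at_minimiser[OF min] by simp
  qed
  have int_c: "integrable \<mu> g" if "continuous_on UNIV g" for g :: "complex \<Rightarrow> complex"
  proof -
    have "integrable \<mu> (\<lambda>z. Re (g z))" "integrable \<mu> (\<lambda>z. Im (g z))"
      using that by (auto intro!: \<mu>'.integrable_continuous continuous_intros)
    then have "integrable \<mu> (\<lambda>z. of_real (Re (g z)) + \<i> * of_real (Im (g z)))"
      by (intro Bochner_Integration.integrable_add integrable_mult_right integrable_of_real)
    then show ?thesis by (simp flip: complex_eq)
  qed
  have mom: "(\<integral>z. g z \<partial>\<mu>) = 0" if g: "continuous_on UNIV g"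
    and re: "(\<integral>z. Re (g z) \<partial>\<mu>) = 0" and im: "(\<integral>z. Im (g z) \<partial>\<mu>) = 0" for g :: "complex \<Rightarrow> complex"
    using integral_Re[OF int_c[OF g]] integral_Im[OF int_c[OF g]] re im by (simp add: complex_eq_iff)
  have m1: "(\<integral>z. z \<partial>\<mu>) = 0"
    using tilt_mean[of "(1, 0)"] tilt_mean[of "(- \<i>, 0)"]
    by (intro mom) (auto simp: tilt_def intro!: continuous_intros)
  have m2: "(\<integral>z. z\<^sup>2 \<partial>\<mu>) = 0"
    using tilt_mean[of "(0, 1)"] tilt_mean[of "(0, - \<i>)"]
    by (intro mom) (auto simp: tilt_def intro!: continuous_intros)
  have "AE z in gauss_measure. ennreal (f z) = RN_deriv gauss_measure \<mu> z"
    by (rule gauss.RN_deriv_unique) (auto simp: \<mu>_def)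
  then have "AE z in \<mu>. ennreal (f z) = RN_deriv gauss_measure \<mu> z"
    using absolutely_continuous_AE[OF _ ac] by simp
  with AE_supp have dens: "AE z in \<mu>. entropy_density (exp 1) gauss_measure \<mu> z = 2 * V z + 2 * tilt p z - ln E"
  proof eventually_elim
    case (elim z)
    have "entropy_density (exp 1) gauss_measure \<mu> z = ln (f z)"
      using elim f_nonneg[of z] by (simp add: entropy_density_def log_def flip: elim(2))
    also have "f z = exp (2 * V z + 2 * tilt p z) / E" using elim by (simp add: f_def)
    also have "ln \<dots> = 2 * V z + 2 * tilt p z - ln E" using \<open>E > 0\<close> by (simp add: ln_div)
    finally show ?case .
  qed
  have [measurable]: "entropy_density (exp 1) gauss_measure \<mu> \<in> borel_measurable \<mu>"
    using measurable_entropy_density[of "exp 1" gauss_measure \<mu>] by (simp add: measurable_def)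
  have int_h: "integrable \<mu> (\<lambda>z. 2 * V z + 2 * tilt p z - ln E)"
    by (intro \<mu>'.integrable_continuous continuous_intros V)
  have int_ent: "integrable \<mu> (entropy_density (exp 1) gauss_measure \<mu>)"
    by (subst integrable_cong_AE[OF _ _ dens]) (auto intro: int_h)
  have "KL_divergence (exp 1) gauss_measure \<mu> = (\<integral>z. 2 * V z + 2 * tilt p z - ln E \<partial>\<mu>)"
    unfolding KL_divergence_def by (rule integral_cong_AE) (use dens in auto)
  also have "\<dots> = 2 * (\<integral>z. V z \<partial>\<mu>) + 2 * (\<integral>z. tilt p z \<partial>\<mu>) - ln E"
  proof -
    have "integrable \<mu> V" "integrable \<mu> (tilt p)"
      by (intro \<mu>'.integrable_continuous continuous_intros V)+
    moreover have "measure \<mu> UNIV = 1" using \<mu>.prob_space by simp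
    ultimately show ?thesis by simp
  qed
  finally have "free_energy V \<mu> = ln E" by (simp add: free_energy_def tilt_mean)
  then have "exp (free_energy V \<mu>) = E" using \<open>E > 0\<close> by simp
  moreover have "\<mu> \<in> test_measures"
    unfolding test_measures_def
    using ac supp m1 m2 int_ent \<mu>.prob_space_axioms
    by (auto simp: rel_entropy_def intro!: exI[of _ "cball 0 R"])
  ultimately show ?thesis unfolding E_def by blast
qed

lemma test_measure_integrable:
  fixes g :: "complex \<Rightarrow> 'b::{banach, second_countable_topology}"
  assumes \<mu>: "\<mu> \<in> test_measures" and g: "continuous_on UNIV g"
  shows "integrable \<mu> g"
proof -
  from \<mu> obtain K where K: "compact K" "emeasure \<mu> (- K) = 0" and s: "sets \<mu> = sets borel"
    and p: "prob_space \<mu>"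
    by (auto simp: test_measures_def)
  interpret prob_space \<mu> by fact
  have "compact (g ` K)"
    by (intro compact_continuous_image continuous_on_subset[OF g] K) auto
  then obtain B where B: "\<And>z. z \<in> K \<Longrightarrow> norm (g z) \<le> B"
    using compact_imp_bounded[of "g ` K"] by (fastforce simp: bounded_iff)
  have "AE z in \<mu>. z \<in> K"
  proof (rule AE_I[where N = "- K"])
    show "- K \<in> sets \<mu>" unfolding s by (intro borel_comp borel_closed compact_imp_closed K)
  qed (use K in auto)
  then show ?thesis
  proof (rule integrable_const_bound[OF eventually_mono])
    show "g \<in> borel_measurable \<mu>"
      unfolding measurable_cong_sets[OF s refl] by (rule borel_measurable_continuous_onI[OF g])
  qed (rule B)
qed

lemma test_measure_tilt_mean:
  assumes \<mu>: "\<mu> \<in> test_measures"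
  shows "(\<integral>z. tilt p z \<partial>\<mu>) = 0"
proof -
  have i: "integrable \<mu> (\<lambda>z. fst p * z)" "integrable \<mu> (\<lambda>z. snd p * z\<^sup>2)"
    by (intro test_measure_integrable \<mu> continuous_intros)+
  have "(\<integral>z. tilt p z \<partial>\<mu>) = Re (\<integral>z. fst p * z + snd p * z\<^sup>2 \<partial>\<mu>)"
    unfolding tilt_def by (rule integral_Re) (intro Bochner_Integration.integrable_add i)
  also have "(\<integral>z. fst p * z + snd p * z\<^sup>2 \<partial>\<mu>) = fst p * (\<integral>z. z \<partial>\<mu>) + snd p * (\<integral>z. z\<^sup>2 \<partial>\<mu>)"
    using i by simp
  also have "\<dots> = 0" using \<mu> by (simp add: test_measures_def)
  finally show ?thesis by simp
qed

lemma test_measure_entropy: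
  assumes \<mu>: "\<mu> \<in> test_measures"
  shows "integrable \<mu> (entropy_density (exp 1) gauss_measure \<mu>)"
    and "rel_entropy \<mu> gauss_measure = ereal (KL_divergence (exp 1) gauss_measure \<mu>)"
  using \<mu> by (auto simp: test_measures_def rel_entropy_def split: if_splits)

text \<open>Integrate \<open>ln x \<le> x - 1\<close> against \<open>\<mu>\<close>, where \<open>x\<close> is the Gibbs density \<open>exp (2 V + 2 tilt p) / E\<close> divided by the
  density of \<open>\<mu>\<close>. The tilt disappears from the left-hand side because the moments of \<open>\<mu>\<close> vanish, so one
  measure is compared with all \<open>p\<close> at once.\<close>

lemma gibbs_inequality:
  assumes V: "continuous_on UNIV V" and \<mu>: "\<mu> \<in> test_measures"
  shows "ennreal (exp (free_energy V \<mu>)) \<le> energy V p"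
proof (cases "energy V p = \<infinity>")
  case True
  then show ?thesis by simp
next
  case False
  have [measurable]: "V \<in> borel_measurable borel" by (rule borel_measurable_continuous_onI[OF V])
  from \<mu> have s [measurable_cong]: "sets \<mu> = sets borel" and ac: "absolutely_continuous gauss_measure \<mu>"
    and "prob_space \<mu>"
    by (auto simp: test_measures_def)
  interpret prob_space \<mu> by fact
  define E where "E = enn2real (energy V p)"
  have E: "energy V p = ennreal E" and "E > 0"
    using False energy_pos[OF V, of p] by (auto simp: E_def enn2real_positive_iff top.not_eq_extremum)
  define \<rho> where "\<rho> = RN_deriv gauss_measure \<mu>"
  have [measurable]: "\<rho> \<in> borel_measurable borel"
    using borel_measurable_RN_deriv[of gauss_measure \<mu>] by (simp add: \<rho>_def measurable_cong_sets[OF sets_gauss_measure refl])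
  define f where "f z = enn2real (\<rho> z)" for z
  define h where "h z = 2 * V z + 2 * tilt p z" for z
  have [measurable]: "f \<in> borel_measurable borel" "h \<in> borel_measurable borel"
    unfolding f_def[abs_def] h_def[abs_def] by measurable
  have dens: "density gauss_measure \<rho> = \<mu>"
    unfolding \<rho>_def by (rule gauss.density_RN_deriv[OF ac]) (simp add: s)
  have "AE z in \<mu>. \<rho> z \<noteq> 0"
    unfolding dens[symmetric] by (subst AE_density) auto
  moreover have "AE z in \<mu>. \<rho> z \<noteq> \<infinity>"
    using gauss.RN_deriv_finite[OF sigma_finite_measure_axioms ac] s
    by (intro absolutely_continuous_AE[OF _ ac]) (auto simp: \<rho>_def)
  ultimately have f_pos: "AE z in \<mu>. f z > 0"
    by eventually_elim (auto simp: f_def enn2real_positive_iff less_top zero_less_iff_neq_zero)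
  define g where "g z = exp (h z) / (f z * E)" for z
  have [measurable]: "g \<in> borel_measurable borel" unfolding g_def[abs_def] by measurable
  have g_nonneg: "g z \<ge> 0" for z using \<open>E > 0\<close> by (simp add: g_def f_def)
  have "(\<integral>\<^sup>+z. ennreal (g z) \<partial>\<mu>) = (\<integral>\<^sup>+z. \<rho> z * ennreal (g z) \<partial>gauss_measure)"
    by (subst dens[symmetric], subst nn_integral_density) auto
  also have "\<dots> \<le> (\<integral>\<^sup>+z. ennreal (1 / E) * ennreal (exp (h z)) \<partial>gauss_measure)"
  proof (rule nn_integral_mono)
    fix z
    \<comment> \<open>Where the density is 0 or infinite, \<open>f z = 0\<close> and hence \<open>g z = 0\<close> by division by zero.\<close>
    show "\<rho> z * ennreal (g z) \<le> ennreal (1 / E) * ennreal (exp (h z))"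
    proof (cases "f z = 0")
      case True
      then show ?thesis by (simp add: g_def)
    next
      case False
      then have "\<rho> z = ennreal (f z)" "f z > 0"
        unfolding f_def by (auto simp: enn2real_eq_0_iff zero_less_iff_neq_zero enn2real_positive_iff less_top)
      then show ?thesis using \<open>E > 0\<close> by (simp add: g_def flip: ennreal_mult)
    qed
  qed
  also have "\<dots> = ennreal (1 / E) * energy V p"
    unfolding energy_def h_def by (rule nn_integral_cmult) measurable
  also have "\<dots> = 1" using \<open>E > 0\<close> by (simp add: E flip: ennreal_mult)
  finally have g1: "(\<integral>\<^sup>+z. ennreal (g z) \<partial>\<mu>) \<le> 1" .
  have int_g: "integrable \<mu> g"
    using g1 g_nonneg by (intro integrableI_bounded) (auto simp: order_le_less_trans)
  have "(\<integral>z. g z \<partial>\<mu>) \<le> 1"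
    using g1 nn_integral_eq_integral[OF int_g] g_nonneg by (simp add: ennreal_le_1)
  have int_h: "integrable \<mu> h"
    unfolding h_def[abs_def] by (intro test_measure_integrable \<mu> continuous_intros V)
  note int_e = test_measure_entropy(1)[OF \<mu>]
  have "(\<integral>z. h z - entropy_density (exp 1) gauss_measure \<mu> z - ln E \<partial>\<mu>) \<le> (\<integral>z. g z - 1 \<partial>\<mu>)"
  proof (rule integral_mono_AE)
    show "AE z in \<mu>. h z - entropy_density (exp 1) gauss_measure \<mu> z - ln E \<le> g z - 1"
      using f_pos
    proof eventually_elim
      case (elim z)
      have "entropy_density (exp 1) gauss_measure \<mu> z = ln (f z)"
        by (simp add: entropy_density_def log_def f_def \<rho>_def)
      then have "h z - entropy_density (exp 1) gauss_measure \<mu> z - ln E = ln (g z)"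
        using elim \<open>E > 0\<close> by (simp add: g_def ln_div ln_mult)
      also have "\<dots> \<le> g z - 1" using elim \<open>E > 0\<close> by (intro ln_le_minus_one) (simp add: g_def)
      finally show ?case .
    qed
  qed (use int_h int_e int_g in auto)
  also have "(\<integral>z. g z - 1 \<partial>\<mu>) = (\<integral>z. g z \<partial>\<mu>) - 1" using int_g by (simp add: prob_space)
  also have "\<dots> \<le> 0" using \<open>(\<integral>z. g z \<partial>\<mu>) \<le> 1\<close> by simp
  also have "(\<integral>z. h z - entropy_density (exp 1) gauss_measure \<mu> z - ln E \<partial>\<mu>)
      = (\<integral>z. h z \<partial>\<mu>) - KL_divergence (exp 1) gauss_measure \<mu> - ln E"
    using int_h int_e by (simp add: prob_space KL_divergence_def)
  also have "(\<integral>z. h z \<partial>\<mu>) = 2 * (\<integral>z. V z \<partial>\<mu>) + 2 * (\<integral>z. tilt p z \<partial>\<mu>)"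
  proof -
    have "integrable \<mu> V" "integrable \<mu> (tilt p)"
      by (intro test_measure_integrable \<mu> continuous_intros V)+
    then show ?thesis unfolding h_def[abs_def] by simp
  qed
  finally have "free_energy V \<mu> \<le> ln E"
    by (simp add: free_energy_def test_measure_tilt_mean[OF \<mu>])
  then have "exp (free_energy V \<mu>) \<le> E" using \<open>E > 0\<close> by (simp add: ln_ge_iff)
  then show ?thesis by (simp add: E ennreal_leI)
qed

text \<open>With \<open>a = exp (V + tilt p)\<close> and \<open>b = exp (V + tilt q)\<close>, the energies at \<open>p\<close>, \<open>q\<close> and the midpoint are the
  integrals of \<open>a\<^sup>2\<close>, \<open>b\<^sup>2\<close> and \<open>a b\<close>, and \<open>a\<^sup>2 + b\<^sup>2 = 2 a b + (a - b)\<^sup>2\<close>. The last square vanishes almost everywhere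
  only if the two tilts coincide.\<close>

lemma energy_midpoint_less:
  assumes V: "continuous_on UNIV V" and "p \<noteq> q"
    and p: "energy V p = ennreal M" and q: "energy V q = ennreal M"
  shows "energy V ((1/2) *\<^sub>R (p + q)) < ennreal M"
proof -
  have [measurable]: "V \<in> borel_measurable borel" by (rule borel_measurable_continuous_onI[OF V])
  define a where "a z = exp (V z + tilt p z)" for z
  define b where "b z = exp (V z + tilt q z)" for z
  have ca: "continuous_on UNIV a" and cb: "continuous_on UNIV b"
    unfolding a_def[abs_def] b_def[abs_def] by (intro continuous_intros V)+
  have [measurable]: "a \<in> borel_measurable borel" "b \<in> borel_measurable borel"
    by (rule borel_measurable_continuous_onI, fact)+
  define r where "r = (1/2) *\<^sub>R (p + q)"
  have sq: "exp (2 * V z + 2 * tilt p z) = (a z)\<^sup>2" "exp (2 * V z + 2 * tilt q z) = (b z)\<^sup>2"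
    "exp (2 * V z + 2 * tilt r z) = a z * b z" for z
    unfolding a_def b_def r_def tilt_scaleR tilt_add
    by (simp_all add: power2_eq_square algebra_simps flip: exp_add)
  have E: "energy V p = (\<integral>\<^sup>+z. ennreal ((a z)\<^sup>2) \<partial>gauss_measure)"
     "energy V q = (\<integral>\<^sup>+z. ennreal ((b z)\<^sup>2) \<partial>gauss_measure)"
     "energy V r = (\<integral>\<^sup>+z. ennreal (a z * b z) \<partial>gauss_measure)"
    unfolding energy_def sq by simp_all
  define D where "D = (\<integral>\<^sup>+z. ennreal ((a z - b z)\<^sup>2) \<partial>gauss_measure)"
  have "2 * energy V r + D = (\<integral>\<^sup>+z. 2 * ennreal (a z * b z) + ennreal ((a z - b z)\<^sup>2) \<partial>gauss_measure)"
    unfolding E(3) D_def by (subst nn_integral_add) (auto simp: nn_integral_cmult)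
  also have "\<dots> = (\<integral>\<^sup>+z. ennreal ((a z)\<^sup>2) + ennreal ((b z)\<^sup>2) \<partial>gauss_measure)"
  proof (rule nn_integral_cong)
    fix z
    have "2 * ennreal (a z * b z) + ennreal ((a z - b z)\<^sup>2) = ennreal (2 * (a z * b z) + (a z - b z)\<^sup>2)"
      by (subst ennreal_plus) (auto simp: a_def b_def ennreal_mult)
    also have "2 * (a z * b z) + (a z - b z)\<^sup>2 = (a z)\<^sup>2 + (b z)\<^sup>2"
      by (simp add: power2_eq_square algebra_simps)
    finally show "2 * ennreal (a z * b z) + ennreal ((a z - b z)\<^sup>2) = ennreal ((a z)\<^sup>2) + ennreal ((b z)\<^sup>2)"
      by (simp add: ennreal_plus)
  qed
  also have "\<dots> = ennreal M + ennreal M"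
    using p q unfolding E by (subst nn_integral_add) auto
  finally have sum: "2 * energy V r + D = ennreal M + ennreal M" .
  have "D \<noteq> 0"
  proof
    assume "D = 0"
    then have "AE z in gauss_measure. a z = b z"
      unfolding D_def by (subst (asm) nn_integral_0_iff_AE) auto
    moreover obtain w where "tilt (p - q) w > 0"
      using tilt_positive_somewhere[of "p - q" 1] \<open>p \<noteq> q\<close> by auto
    then have w: "a w \<noteq> b w" by (auto simp: a_def b_def tilt_diff)
    moreover have op: "open {z. a z \<noteq> b z}" using ca cb by (intro open_Collect_neq) auto
    ultimately have "emeasure gauss_measure {z. a z \<noteq> b z} = 0"
      by (subst (asm) AE_iff_measurable[where N = "{z. a z \<noteq> b z}"]) auto
    with emeasure_gauss_open_pos[OF op] w show False by auto
  qed
  then have "D > 0" by (simp add: zero_less_iff_neq_zero)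
  obtain e where e: "energy V r = ennreal e" "e \<ge> 0"
  proof (cases "energy V r")
    case top
    then have "ennreal M + ennreal M = \<infinity>" using sum by (simp add: ennreal_mult_eq_top_iff)
    then show ?thesis by simp
  qed
  obtain d where d: "D = ennreal d" "d \<ge> 0"
  proof (cases D)
    case top
    then have "ennreal M + ennreal M = \<infinity>" using sum by simp
    then show ?thesis by simp
  qed
  have "d > 0" using \<open>D > 0\<close> d by simp
  have "M > 0" using energy_pos[OF V, of p] p by simp
  have "2 * energy V r = ennreal (2 * e)" using e by (simp add: ennreal_mult)
  moreover have "ennreal (2 * e + d) = ennreal (2 * e) + ennreal d" "ennreal (M + M) = ennreal M + ennreal M"
    using e d \<open>M > 0\<close> by (intro ennreal_plus; simp)+
  ultimately have "ennreal (2 * e + d) = ennreal (M + M)"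
    using sum d by simp
  then have "2 * e + d = M + M"
    using e d \<open>M > 0\<close> by (subst (asm) ennreal_inj) auto
  then have "e < M" using \<open>d > 0\<close> by simp
  then show ?thesis using e by (simp add: r_def[symmetric] ennreal_lessI \<open>M > 0\<close>)
qed

lemma exp_ereal_le_iff:
  "exp_ereal x \<le> exp_ereal y \<longleftrightarrow> x \<le> y"
  by (cases x; cases y) (auto simp: exp_ereal_def ennreal_le_iff top_unique)

lemma exp_ereal_ereal [simp]: "exp_ereal (ereal x) = ennreal (exp x)"
  by (simp add: exp_ereal_def)

lemma exp_ereal_surj: "\<exists>x. exp_ereal x = y"
proof (cases y)
  case (real r)
  show ?thesis
  proof (cases "r = 0")
    case True
    then show ?thesis using real by (intro exI[of _ "- \<infinity>"]) (simp add: exp_ereal_def)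
  next
    case False
    then show ?thesis using real by (intro exI[of _ "ereal (ln r)"]) simp
  qed
next
  case top
  then show ?thesis by (intro exI[of _ \<infinity>]) (simp add: exp_ereal_def)
qed

text \<open>If the supremum is finite, its exponential bounds the minimal energy of every disc. By coercivity over the
  unit disc the corresponding minimisers lie in a compact set; since energies increase with the disc,
  a limit point has energy at most that bound over every disc, hence over the plane. This proves the nontrivial
  inequality and that the infimum is attained.\<close>

theorem entropy_duality:
  assumes V: "continuous_on UNIV V"
  shows "exp_ereal (SUP \<mu>\<in>test_measures. ereal (free_energy V \<mu>)) = (INF p. energy V p)"
    and "(INF p. energy V p) < \<infinity> \<Longrightarrow> \<exists>p. energy V p = (INF p. energy V p)"
proof -
  define S where "S = (SUP \<mu>\<in>test_measures. ereal (free_energy V \<mu>))"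
  have upper: "exp_ereal S \<le> energy V p" for p
  proof -
    obtain x where x: "exp_ereal x = energy V p" using exp_ereal_surj by blast
    have "ereal (free_energy V \<mu>) \<le> x" if "\<mu> \<in> test_measures" for \<mu>
      using gibbs_inequality[OF V that, of p] unfolding x[symmetric]
      by (simp flip: exp_ereal_ereal add: exp_ereal_le_iff del: exp_ereal_ereal)
    then have "S \<le> x" unfolding S_def by (rule SUP_least)
    then show ?thesis by (simp add: exp_ereal_le_iff flip: x)
  qed
  then have le: "exp_ereal S \<le> (INF p. energy V p)" by (intro INF_greatest)
  have ex: "\<exists>p. energy V p \<le> exp_ereal S" if fin: "exp_ereal S < \<infinity>"
  proof -
    define B where "B = enn2real (exp_ereal S)"
    have B: "exp_ereal S = ennreal B" "B \<ge> 0" using fin by (auto simp: B_def)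
    have "\<exists>p. disc_energy V (real (Suc n)) p \<le> B" for n
    proof -
      interpret bounded_planar_measure "disc_measure V (Suc n)" "Suc n"
        by (rule bounded_planar_measure_disc[OF V]) auto
      obtain p where p: "\<And>q. tilted_mass p \<le> tilted_mass q" using minimiser_exists by blast
      obtain \<mu> where \<mu>: "\<mu> \<in> test_measures" "exp (free_energy V \<mu>) = tilted_mass p"
        using disc_gibbs_measure[OF V _ p] by auto
      have "ereal (free_energy V \<mu>) \<le> S" unfolding S_def using \<mu>(1) by (rule SUP_upper)
      then have "ennreal (exp (free_energy V \<mu>)) \<le> ennreal B"
        unfolding B(1)[symmetric] by (simp flip: exp_ereal_ereal add: exp_ereal_le_iff del: exp_ereal_ereal)
      then have "disc_energy V (real (Suc n)) p \<le> B" using \<mu>(2) B(2) by (simp add: ennreal_le_iff)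
      then show ?thesis by blast
    qed
    then obtain p where p: "\<And>n. disc_energy V (real (Suc n)) (p n) \<le> B" by metis
    have mono: "disc_energy V (real k) (p n) \<le> B" if "1 \<le> k" "k \<le> Suc n" for k n
      using disc_energy_mono[OF V, of "real k" "real (Suc n)" "p n"] p[of n] that by simp
    \<comment> \<open>Coercivity over the unit disc alone confines the minimisers for all larger discs.\<close>
    obtain c where c: "c > 0" "\<And>p. c * norm p \<le> disc_energy V 1 p"
      using bounded_planar_measure.coercive[OF bounded_planar_measure_disc[OF V order.refl]] by auto
    have "p n \<in> cball 0 (B / c)" for n
    proof -
      have "c * norm (p n) \<le> B" using c(2)[of "p n"] mono[of 1 n] by simp
      then show ?thesis using c(1) by (simp add: field_simps)
    qed
    then obtain l r where r: "strict_mono r" "(p \<circ> r) \<longlonglongrightarrow> l"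
      using compact_imp_seq_compact[OF compact_cball, of "0 :: complex \<times> complex" "B / c"]
      unfolding seq_compact_def by blast
    have "disc_energy V (real k) l \<le> B" if k: "k \<ge> 1" for k :: nat
    proof -
      interpret bounded_planar_measure "disc_measure V k" k
        using k by (intro bounded_planar_measure_disc[OF V]) auto
      have "continuous_on UNIV tilted_mass"
        unfolding tilted_mass_def by (rule continuous_on_integral_tilt[of "\<lambda>t. exp (2 * t)"]) (intro continuous_intros)
      then have "(\<lambda>n. tilted_mass ((p \<circ> r) n)) \<longlonglongrightarrow> tilted_mass l"
        by (rule continuous_on_tendsto_compose[OF _ r(2)]) auto
      moreover have "\<forall>\<^sub>F n in sequentially. tilted_mass ((p \<circ> r) n) \<le> B"
        using eventually_ge_at_top[of k]
      proof eventually_elim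
        case (elim n)
        have "n \<le> r n" using r(1) by (rule seq_suble)
        with elim show ?case using mono[of k "r n"] k by simp
      qed
      ultimately show ?thesis by (intro tendsto_upperbound) auto
    qed
    then have "energy V l \<le> ennreal B" by (intro energy_le_if_disc_energy_le[OF V])
    then show ?thesis using B(1) by metis
  qed
  have ge: "(INF p. energy V p) \<le> exp_ereal S"
  proof (cases "exp_ereal S < \<infinity>")
    case True
    from ex[OF this] obtain p where "energy V p \<le> exp_ereal S" by blast
    then show ?thesis by (meson INF_lower2 UNIV_I)
  next
    case False
    then show ?thesis by (metis top.not_eq_extremum infinity_ennreal_def top_greatest)
  qed
  from le ge show 1: "exp_ereal (SUP \<mu>\<in>test_measures. ereal (free_energy V \<mu>)) = (INF p. energy V p)"
    unfolding S_def[symmetric] by (rule antisym)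
  assume "(INF p. energy V p) < \<infinity>"
  with 1 have "exp_ereal S < \<infinity>" by (simp add: S_def)
  from ex[OF this] obtain p where "energy V p \<le> exp_ereal S" by blast
  then have "energy V p \<le> (INF p. energy V p)" using 1 by (simp add: S_def)
  then show "\<exists>p. energy V p = (INF p. energy V p)"
    by (intro exI[of _ p] antisym INF_lower) auto
qed

lemma energy_minimiser_unique:
  assumes V: "continuous_on UNIV V" and fin: "(INF p. energy V p) < \<infinity>"
    and p: "energy V p = (INF p. energy V p)" and q: "energy V q = (INF p. energy V p)"
  shows "p = q"
proof (rule ccontr)
  assume "p \<noteq> q"
  define M where "M = enn2real (INF p. energy V p)"
  have M: "(INF p. energy V p) = ennreal M" using fin by (simp add: M_def)
  have "energy V ((1/2) *\<^sub>R (p + q)) < (INF p. energy V p)"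
    using energy_midpoint_less[OF V \<open>p \<noteq> q\<close>, of M] p q M by simp
  moreover have "(INF p. energy V p) \<le> energy V ((1/2) *\<^sub>R (p + q))" by (rule INF_lower) simp
  ultimately show False by simp
qed

section \<open>Mean values of entire functions\<close>

lemma nn_integral_complex_iterated:
  fixes f :: "complex \<Rightarrow> ennreal"
  assumes [measurable]: "f \<in> borel_measurable borel"
  shows "(\<integral>\<^sup>+z. f z \<partial>lborel) = (\<integral>\<^sup>+x. (\<integral>\<^sup>+y. f (Complex x y) \<partial>lborel) \<partial>lborel)"
    and "(\<integral>\<^sup>+z. f z \<partial>lborel) = (\<integral>\<^sup>+y. (\<integral>\<^sup>+x. f (Complex x y) \<partial>lborel) \<partial>lborel)"
proof -
  have C[measurable]: "(\<lambda>(x, y). Complex x y) \<in> borel_measurable (borel \<Otimes>\<^sub>M borel)"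
    unfolding borel_prod
    by (intro borel_measurable_continuous_onI)
       (auto simp: Complex_eq case_prod_unfold intro!: continuous_intros)
  have *: "lborel = distr (lborel \<Otimes>\<^sub>M lborel) borel (\<lambda>(x, y). Complex x y)"
  proof (rule lborel_eqI)
    fix l u :: complex
    assume le: "\<And>b. b \<in> Basis \<Longrightarrow> l \<bullet> b \<le> u \<bullet> b"
    then have le': "Re l \<le> Re u" "Im l \<le> Im u" using le[of 1] le[of \<i>] by (auto simp: Basis_complex_def inner_complex_def)
    have "emeasure (distr (lborel \<Otimes>\<^sub>M lborel) borel (\<lambda>(x, y). Complex x y)) (box l u)
       = emeasure (lborel \<Otimes>\<^sub>M lborel) ((\<lambda>(x, y). Complex x y) -` box l u \<inter> space (lborel \<Otimes>\<^sub>M lborel))"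
      by (rule emeasure_distr) auto
    also have "(\<lambda>(x, y). Complex x y) -` box l u \<inter> space (lborel \<Otimes>\<^sub>M lborel) = {Re l<..<Re u} \<times> {Im l<..<Im u}"
      by (auto simp: box_def Basis_complex_def inner_complex_def space_pair_measure)
    also have "emeasure (lborel \<Otimes>\<^sub>M lborel) \<dots> = ennreal (Re u - Re l) * ennreal (Im u - Im l)"
      using le' by (simp add: lborel.emeasure_pair_measure_Times)
    also have "\<dots> = (\<Prod>b\<in>Basis. (u - l) \<bullet> b)"
      using le' by (simp add: Basis_complex_def inner_complex_def ennreal_mult)
    finally show "emeasure (distr (lborel \<Otimes>\<^sub>M lborel) borel (\<lambda>(x, y). Complex x y)) (box l u)
        = ennreal (\<Prod>b\<in>Basis. (u - l) \<bullet> b)" .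
  qed simp
  have "(\<integral>\<^sup>+z. f z \<partial>lborel) = (\<integral>\<^sup>+p. f (case p of (x, y) \<Rightarrow> Complex x y) \<partial>(lborel \<Otimes>\<^sub>M lborel))"
    by (subst *, subst nn_integral_distr) auto
  then show 1: "(\<integral>\<^sup>+z. f z \<partial>lborel) = (\<integral>\<^sup>+x. (\<integral>\<^sup>+y. f (Complex x y) \<partial>lborel) \<partial>lborel)"
    using lborel.nn_integral_fst[of "\<lambda>p. f (case p of (x, y) \<Rightarrow> Complex x y)" lborel] by simp
  have "(\<integral>\<^sup>+x. (\<integral>\<^sup>+y. f (Complex x y) \<partial>lborel) \<partial>lborel) = (\<integral>\<^sup>+y. (\<integral>\<^sup>+x. f (Complex x y) \<partial>lborel) \<partial>lborel)"
    by (rule lborel_pair.Fubini') (auto simp: measurable_split_conv)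
  with 1 show "(\<integral>\<^sup>+z. f z \<partial>lborel) = (\<integral>\<^sup>+y. (\<integral>\<^sup>+x. f (Complex x y) \<partial>lborel) \<partial>lborel)" by simp
qed

lemma nn_integral_lborel_translate:
  fixes f :: "'a::euclidean_space \<Rightarrow> ennreal"
  assumes [measurable]: "f \<in> borel_measurable borel"
  shows "(\<integral>\<^sup>+x. f (c + x) \<partial>lborel) = (\<integral>\<^sup>+x. f x \<partial>lborel)"
  by (subst (2) lborel_distr_plus[of c, symmetric], subst nn_integral_distr) auto

text \<open>On each line parallel to the axis a shear is a translation.\<close>

lemma nn_integral_shear:
  fixes f :: "complex \<Rightarrow> ennreal"
  assumes [measurable]: "f \<in> borel_measurable borel"
  shows "(\<integral>\<^sup>+z. f (z + complex_of_real (t * Im z)) \<partial>lborel) = (\<integral>\<^sup>+z. f z \<partial>lborel)"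
    and "(\<integral>\<^sup>+z. f (z + \<i> * complex_of_real (t * Re z)) \<partial>lborel) = (\<integral>\<^sup>+z. f z \<partial>lborel)"
proof -
  have [measurable]: "Complex x \<in> borel_measurable borel" "(\<lambda>x. Complex x y) \<in> borel_measurable borel" for x y
    by (intro borel_measurable_continuous_onI; auto simp: Complex_eq intro!: continuous_intros)+
  have [measurable]: "(\<lambda>z. f (z + complex_of_real (t * Im z))) \<in> borel_measurable borel"
     "(\<lambda>z. f (z + \<i> * complex_of_real (t * Re z))) \<in> borel_measurable borel"
    by (rule measurable_compose[OF _ assms], intro borel_measurable_continuous_onI continuous_intros)+
  have "(\<integral>\<^sup>+z. f (z + complex_of_real (t * Im z)) \<partial>lborel)
     = (\<integral>\<^sup>+y. (\<integral>\<^sup>+x. f (Complex x y + complex_of_real (t * y)) \<partial>lborel) \<partial>lborel)"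
    by (subst nn_integral_complex_iterated(2)) auto
  also have "(\<lambda>y. \<integral>\<^sup>+x. f (Complex x y + complex_of_real (t * y)) \<partial>lborel) = (\<lambda>y. \<integral>\<^sup>+x. f (Complex (t * y + x) y) \<partial>lborel)"
    by (intro ext nn_integral_cong arg_cong[where f = f]) (simp add: complex_eq_iff)
  also have "\<dots> = (\<lambda>y. \<integral>\<^sup>+x. f (Complex x y) \<partial>lborel)"
    by (subst nn_integral_lborel_translate[where f = "\<lambda>x. f (Complex x _)"]) auto
  also have "(\<integral>\<^sup>+y. (\<integral>\<^sup>+x. f (Complex x y) \<partial>lborel) \<partial>lborel) = (\<integral>\<^sup>+z. f z \<partial>lborel)"
    by (rule nn_integral_complex_iterated(2)[symmetric]) auto
  finally show "(\<integral>\<^sup>+z. f (z + complex_of_real (t * Im z)) \<partial>lborel) = (\<integral>\<^sup>+z. f z \<partial>lborel)" .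
  have "(\<integral>\<^sup>+z. f (z + \<i> * complex_of_real (t * Re z)) \<partial>lborel)
     = (\<integral>\<^sup>+x. (\<integral>\<^sup>+y. f (Complex x y + \<i> * complex_of_real (t * x)) \<partial>lborel) \<partial>lborel)"
    by (subst nn_integral_complex_iterated(1)) auto
  also have "(\<lambda>x. \<integral>\<^sup>+y. f (Complex x y + \<i> * complex_of_real (t * x)) \<partial>lborel) = (\<lambda>x. \<integral>\<^sup>+y. f (Complex x (t * x + y)) \<partial>lborel)"
    by (intro ext nn_integral_cong arg_cong[where f = f]) (simp add: complex_eq_iff)
  also have "\<dots> = (\<lambda>x. \<integral>\<^sup>+y. f (Complex x y) \<partial>lborel)"
    by (subst nn_integral_lborel_translate[where f = "\<lambda>y. f (Complex _ y)"]) auto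
  also have "(\<integral>\<^sup>+x. (\<integral>\<^sup>+y. f (Complex x y) \<partial>lborel) \<partial>lborel) = (\<integral>\<^sup>+z. f z \<partial>lborel)"
    by (rule nn_integral_complex_iterated(1)[symmetric]) auto
  finally show "(\<integral>\<^sup>+z. f (z + \<i> * complex_of_real (t * Re z)) \<partial>lborel) = (\<integral>\<^sup>+z. f z \<partial>lborel)" .
qed

text \<open>A rotation by an angle \<open>\<theta> \<noteq> \<pi>\<close> is a product of three shears, with parameters \<open>- tan (\<theta> / 2)\<close>,
  \<open>sin \<theta>\<close>, \<open>- tan (\<theta> / 2)\<close>; the half-turn is the square of a quarter-turn.\<close>

lemma nn_integral_rotate:
  fixes f :: "complex \<Rightarrow> ennreal"
  assumes f: "f \<in> borel_measurable borel" and u: "cmod u = 1"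
  shows "(\<integral>\<^sup>+z. f (u * z) \<partial>lborel) = (\<integral>\<^sup>+z. f z \<partial>lborel)"
proof -
  have main: "(\<integral>\<^sup>+z. f (v * z) \<partial>lborel) = (\<integral>\<^sup>+z. f z \<partial>lborel)" if v: "cmod v = 1" "v \<noteq> -1"
    and f [measurable]: "f \<in> borel_measurable borel" for v and f :: "complex \<Rightarrow> ennreal"
  proof -
    \<comment> \<open>Minus the tangent of half the angle of \<open>v\<close>; this is where \<open>v \<noteq> -1\<close> enters.\<close>
    define a where "a = - Im v / (1 + Re v)"
    define b where "b = Im v"
    have sq: "(Re v)\<^sup>2 + (Im v)\<^sup>2 = 1" using v(1) by (simp add: cmod_def)
    have ne: "1 + Re v \<noteq> 0"
    proof
      assume "1 + Re v = 0"
      then have "Re v = -1" by simp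
      with sq have "Im v = 0" by simp
      with \<open>Re v = -1\<close> have "v = -1" by (simp add: complex_eq_iff)
      with v show False by simp
    qed
    define S where "S = (\<lambda>t z. z + complex_of_real (t * Im z))"
    define T where "T = (\<lambda>t z. z + \<i> * complex_of_real (t * Re z))"
    have [measurable]: "S t \<in> borel_measurable borel" "T t \<in> borel_measurable borel" for t
      unfolding S_def T_def by (intro borel_measurable_continuous_onI continuous_intros)+
    have shS: "(\<integral>\<^sup>+z. g (S t z) \<partial>lborel) = (\<integral>\<^sup>+z. g z \<partial>lborel)"
      and shT: "(\<integral>\<^sup>+z. g (T t z) \<partial>lborel) = (\<integral>\<^sup>+z. g z \<partial>lborel)"
      if "g \<in> borel_measurable borel" for t and g :: "complex \<Rightarrow> ennreal"
      unfolding S_def T_def by (rule nn_integral_shear[OF that])+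
    have ab: "1 + a * b = Re v" "a * (2 + a * b) = - Im v"
    proof -
      show 1: "1 + a * b = Re v" using sq ne
        by (simp add: a_def b_def field_simps power2_eq_square)
      then have "a * (2 + a * b) = a * (1 + Re v)" by simp
      then show "a * (2 + a * b) = - Im v" using ne by (simp add: a_def)
    qed
    have eq: "S a (T b (S a z)) = v * z" for z
    proof -
      have "Re (S a (T b (S a z))) = (1 + a * b) * Re z + a * (2 + a * b) * Im z"
        "Im (S a (T b (S a z))) = b * Re z + (1 + a * b) * Im z"
        by (simp_all add: S_def T_def algebra_simps)
      then show ?thesis unfolding ab by (simp add: complex_eq_iff b_def)
    qed
    have "(\<integral>\<^sup>+z. f (v * z) \<partial>lborel) = (\<integral>\<^sup>+z. f (S a (T b (S a z))) \<partial>lborel)" by (simp add: eq)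
    also have "\<dots> = (\<integral>\<^sup>+z. f (S a (T b z)) \<partial>lborel)"
      by (rule shS[of "\<lambda>w. f (S a (T b w))"]) measurable
    also have "\<dots> = (\<integral>\<^sup>+z. f (S a z) \<partial>lborel)"
      by (rule shT[of "\<lambda>w. f (S a w)"]) measurable
    also have "\<dots> = (\<integral>\<^sup>+z. f z \<partial>lborel)"
      by (rule shS) measurable
    finally show ?thesis .
  qed
  show ?thesis
  proof (cases "u = -1")
    case False
    then show ?thesis using main f u by blast
  next
    case True
    have i: "cmod \<i> = 1" "\<i> \<noteq> -1" by (auto simp: complex_eq_iff)
    have m: "(\<lambda>w. f (\<i> * w)) \<in> borel_measurable borel"
      by (rule measurable_compose[OF _ f]) measurable
    have "(\<integral>\<^sup>+z. f (u * z) \<partial>lborel) = (\<integral>\<^sup>+z. f (\<i> * (\<i> * z)) \<partial>lborel)"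
      by (simp add: True flip: mult.assoc)
    also have "\<dots> = (\<integral>\<^sup>+z. f z \<partial>lborel)"
      using main[OF i m] main[OF i f] by simp
    finally show ?thesis .
  qed
qed

text \<open>Cauchy's formula for the entire function \<open>h\<^sup>2\<close>.\<close>

lemma circle_submean:
  assumes h: "h holomorphic_on UNIV" and "r > 0"
  shows "ennreal ((cmod (h z))\<^sup>2) \<le> (\<integral>\<^sup>+t\<in>{0..1}. ennreal ((cmod (h (z + of_real r * cis (2 * pi * t))))\<^sup>2) \<partial>lborel)"
proof -
  define g where "g = (\<lambda>w. (h w)\<^sup>2)"
  have g: "g holomorphic_on UNIV" unfolding g_def by (intro holomorphic_intros h)
  have cp: "circlepath z r t = z + of_real r * cis (2 * pi * t)" for t
    by (simp add: circlepath_def linepath_def part_circlepath_def cis_conv_exp mult_ac)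
  have "((\<lambda>u. g u / (u - z)) has_contour_integral (2 * of_real pi * \<i> * g z)) (circlepath z r)"
    by (rule Cauchy_integral_circlepath_simple) (use g \<open>r > 0\<close> in \<open>auto intro: holomorphic_on_subset\<close>)
  then have "((\<lambda>t. g (circlepath z r t) / (circlepath z r t - z) * vector_derivative (circlepath z r) (at t within {0..1}))
      has_integral (2 * of_real pi * \<i> * g z)) {0..1}"
    unfolding has_contour_integral_def .
  then have hc: "((\<lambda>t. (2 * of_real pi * \<i>) * g (circlepath z r t)) has_integral (2 * of_real pi * \<i> * g z)) {0..1}"
  proof (rule has_integral_eq[rotated])
    fix t :: real assume t: "t \<in> {0..1}"
    have "vector_derivative (circlepath z r) (at t within {0..1}) = 2 * pi * \<i> * r * exp (2 * of_real pi * \<i> * t)"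
      using t by (intro vector_derivative_circlepath01) auto
    moreover have "circlepath z r t - z = r * exp (2 * of_real pi * \<i> * t)"
      by (simp add: cp cis_conv_exp mult_ac)
    ultimately show "g (circlepath z r t) / (circlepath z r t - z) * vector_derivative (circlepath z r) (at t within {0..1})
        = (2 * of_real pi * \<i>) * g (circlepath z r t)"
      using \<open>r > 0\<close> by (simp add: field_simps)
  qed
  define c where "c = 2 * of_real pi * \<i>"
  have "((\<lambda>t. c * g (circlepath z r t)) has_integral (c * g z)) {0..1}"
    using hc unfolding c_def .
  from has_integral_mult_right[OF this, of "inverse c"]
  have hi': "((\<lambda>t. inverse c * (c * g (circlepath z r t))) has_integral (inverse c * (c * g z))) {0..1}" .
  have cancel: "inverse c * (c * x) = x" for x
  proof -
    have "c \<noteq> 0" by (simp add: c_def)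
    then show ?thesis by simp
  qed
  have hi: "((\<lambda>t. g (circlepath z r t)) has_integral g z) {0..1}"
    using hi' unfolding cancel .
  have cont: "continuous_on {0..1} (\<lambda>t. cmod (g (circlepath z r t)))"
    by (intro continuous_on_norm continuous_on_compose2[OF holomorphic_on_imp_continuous_on[OF g]])
       (auto simp: cp cis_conv_exp intro!: continuous_intros)
  have "cmod (g z) = cmod (integral {0..1} (\<lambda>t. g (circlepath z r t)))"
    using hi by (simp add: integral_unique)
  also have "\<dots> \<le> integral {0..1} (\<lambda>t. cmod (g (circlepath z r t)))"
    by (rule integral_norm_bound_integral)
       (use hi cont in \<open>auto intro: integrable_continuous_real\<close>)
  finally have le: "cmod (g z) \<le> integral {0..1} (\<lambda>t. cmod (g (circlepath z r t)))" .
  have "((\<lambda>t. cmod (g (circlepath z r t))) has_integral integral {0..1} (\<lambda>t. cmod (g (circlepath z r t)))) {0..1}"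
    by (intro integrable_integral integrable_continuous_real cont)
  then have "(\<integral>\<^sup>+t\<in>{0..1}. ennreal (cmod (g (circlepath z r t))) \<partial>lborel)
      = ennreal (integral {0..1} (\<lambda>t. cmod (g (circlepath z r t))))"
    by (intro nn_integral_has_integral_lebesgue') auto
  then show ?thesis using le unfolding cp g_def norm_power by (metis ennreal_leI)
qed

corollary circle_submean_affine:
  assumes h: "h holomorphic_on UNIV"
  shows "ennreal ((cmod (h z))\<^sup>2) \<le> (\<integral>\<^sup>+t\<in>{0..1}. ennreal ((cmod (h (z + w * cis (2 * pi * t))))\<^sup>2) \<partial>lborel)"
proof -
  have "(\<lambda>u. h (z + w * u)) holomorphic_on UNIV"
    by (rule holomorphic_on_compose_gen[OF _ h, unfolded o_def]) (auto intro!: holomorphic_intros)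
  from circle_submean[OF this zero_less_one, of 0] show ?thesis
    unfolding of_real_1 mult_1 add_0 mult_zero_right add_0_right .
qed

text \<open>Averaging over rotations, which preserve area, replaces polar coordinates: the mean over the circle
  through each point of the disc is bounded below by \<open>c\<close>.\<close>

lemma nn_integral_rotation_mean:
  fixes \<phi> :: "complex \<Rightarrow> ennreal"
  assumes [measurable]: "\<phi> \<in> borel_measurable borel"
    and submean: "\<And>w. c \<le> (\<integral>\<^sup>+t\<in>{0..1}. \<phi> (w * cis (2 * pi * t)) \<partial>lborel)"
  shows "c * emeasure lborel (ball (0::complex) 1) \<le> (\<integral>\<^sup>+z\<in>ball 0 1. \<phi> z \<partial>lborel)"
proof -
  have [measurable]: "cis \<in> borel_measurable borel"
    by (rule borel_measurable_continuous_onI) (auto simp: cis_conv_exp intro!: continuous_intros)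
  define \<psi> where "\<psi> z = \<phi> z * indicator (ball 0 1) z" for z
  have [measurable]: "Measurable.pred borel (\<lambda>z::complex. z \<in> ball 0 1)"
    by (simp add: pred_def)
  have [measurable]: "\<psi> \<in> borel_measurable borel" unfolding \<psi>_def by measurable
  have rot: "\<psi> (cis s * z) = \<phi> (z * cis s) * indicator (ball 0 1) z" for s z
    by (simp add: \<psi>_def indicator_def norm_mult mult.commute)
  have "c * emeasure lborel (ball (0::complex) 1) = (\<integral>\<^sup>+z. c * indicator (ball (0::complex) 1) z \<partial>lborel)"
    by (simp add: nn_integral_cmult_indicator)
  also have "\<dots> \<le> (\<integral>\<^sup>+z. (\<integral>\<^sup>+t. \<psi> (cis (2 * pi * t) * z) * indicator {0..1} t \<partial>lborel) \<partial>lborel)"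
  proof (rule nn_integral_mono)
    fix z :: complex
    have "c * indicator (ball 0 1) z \<le> (\<integral>\<^sup>+t\<in>{0..1}. \<phi> (z * cis (2 * pi * t)) \<partial>lborel) * indicator (ball 0 1) z"
      by (intro mult_right_mono submean) auto
    also have "\<dots> = (\<integral>\<^sup>+t. \<psi> (cis (2 * pi * t) * z) * indicator {0..1} t \<partial>lborel)"
      unfolding rot by (subst nn_integral_multc[symmetric]) (auto simp: mult_ac)
    finally show "c * indicator (ball 0 1) z \<le> (\<integral>\<^sup>+t. \<psi> (cis (2 * pi * t) * z) * indicator {0..1} t \<partial>lborel)" .
  qed
  also have "\<dots> = (\<integral>\<^sup>+t. (\<integral>\<^sup>+z. \<psi> (cis (2 * pi * t) * z) * indicator {0..1} t \<partial>lborel) \<partial>lborel)"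
    by (rule lborel_pair.Fubini') measurable
  also have "\<dots> = (\<integral>\<^sup>+t. (\<integral>\<^sup>+z. \<psi> z \<partial>lborel) * indicator {0..1::real} t \<partial>lborel)"
  proof (rule nn_integral_cong)
    fix t :: real
    have "(\<integral>\<^sup>+z. \<psi> (cis (2 * pi * t) * z) * indicator {0..1} t \<partial>lborel)
        = (\<integral>\<^sup>+z. \<psi> (cis (2 * pi * t) * z) \<partial>lborel) * indicator {0..1} t"
      by (rule nn_integral_multc) measurable
    then show "(\<integral>\<^sup>+z. \<psi> (cis (2 * pi * t) * z) * indicator {0..1} t \<partial>lborel)
        = (\<integral>\<^sup>+z. \<psi> z \<partial>lborel) * indicator {0..1::real} t"
      by (subst (asm) nn_integral_rotate) auto
  qed
  also have "\<dots> = (\<integral>\<^sup>+z. \<psi> z \<partial>lborel)"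
    by (subst nn_integral_cmult_indicator) auto
  finally show ?thesis by (simp add: \<psi>_def)
qed

lemma entire_ball_submean:
  assumes h: "h holomorphic_on UNIV"
  shows "ennreal ((cmod (h z))\<^sup>2) * emeasure lborel (ball (0::complex) 1)
     \<le> (\<integral>\<^sup>+w\<in>ball 0 1. ennreal ((cmod (h (z + w)))\<^sup>2) \<partial>lborel)"
proof (rule nn_integral_rotation_mean)
  have "continuous_on UNIV (\<lambda>w. (cmod (h (z + w)))\<^sup>2)"
    by (intro continuous_intros continuous_on_compose2[OF holomorphic_on_imp_continuous_on[OF h]]) auto
  then have "(\<lambda>w. (cmod (h (z + w)))\<^sup>2) \<in> borel_measurable borel" by (rule borel_measurable_continuous_onI)
  then show "(\<lambda>w. ennreal ((cmod (h (z + w)))\<^sup>2)) \<in> borel_measurable borel" by measurable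
qed (rule circle_submean_affine[OF h])

lemma nn_integral_gauss_measure:
  assumes [measurable]: "f \<in> borel_measurable borel"
  shows "(\<integral>\<^sup>+z. f z \<partial>gauss_measure) = (\<integral>\<^sup>+z. ennreal (exp (- (cmod z)\<^sup>2) / pi) * f z \<partial>lborel)"
  unfolding gauss_measure_def by (rule nn_integral_density) auto

text \<open>On the unit disc around \<open>z\<close> the Gaussian weight is at least \<open>exp (- (\<bar>z\<bar> + 1)\<^sup>2)\<close> up to a constant, so the area
  mean of \<open>\<bar>f\<bar>\<^sup>2\<close> there is controlled by the Fock norm.\<close>

lemma fock_space_growth:
  assumes "f \<in> fock_space"
  shows "\<exists>C>0. \<forall>z. cmod (f z) \<le> C * exp ((cmod z + 1)\<^sup>2 / 2)"
proof -
  from assms have h: "f holomorphic_on UNIV"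
    and fin: "(\<integral>\<^sup>+z. ennreal ((cmod (f z))\<^sup>2) \<partial>gauss_measure) < \<infinity>"
    by (auto simp: fock_space_def)
  have "continuous_on UNIV (\<lambda>w. (cmod (f w))\<^sup>2)"
    by (intro continuous_intros holomorphic_on_imp_continuous_on[OF h])
  then have [measurable]: "(\<lambda>w. (cmod (f w))\<^sup>2) \<in> borel_measurable borel" by (rule borel_measurable_continuous_onI)
  define I where "I = enn2real (\<integral>\<^sup>+z. ennreal ((cmod (f z))\<^sup>2) \<partial>gauss_measure)"
  have I: "(\<integral>\<^sup>+z. ennreal ((cmod (f z))\<^sup>2) \<partial>gauss_measure) = ennreal I" "I \<ge> 0"
    using fin by (auto simp: I_def)
  define v where "v = measure lborel (ball (0::complex) 1)"
  have v: "emeasure lborel (ball (0::complex) 1) = ennreal v"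
    unfolding v_def by (rule emeasure_eq_ennreal_measure) (use emeasure_lborel_ball_finite[of "0::complex" 1] in auto)
  have "v > 0"
    unfolding v_def by (rule content_ball_pos) simp
  define C where "C = sqrt (pi * I / v) + 1"
  have "C > 0" unfolding C_def using I(2) \<open>v > 0\<close> by (intro add_nonneg_pos) auto
  have "cmod (f z) \<le> C * exp ((cmod z + 1)\<^sup>2 / 2)" for z
  proof -
    have "ennreal ((cmod (f z))\<^sup>2) * ennreal v \<le> (\<integral>\<^sup>+w\<in>ball 0 1. ennreal ((cmod (f (z + w)))\<^sup>2) \<partial>lborel)"
      using entire_ball_submean[OF h, of z] v by simp
    also have "\<dots> \<le> (\<integral>\<^sup>+w. ennreal (pi * exp ((cmod z + 1)\<^sup>2)) *
          (ennreal (exp (- (cmod (z + w))\<^sup>2) / pi) * ennreal ((cmod (f (z + w)))\<^sup>2)) \<partial>lborel)"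
    proof (rule nn_integral_mono)
      fix w :: complex
      show "ennreal ((cmod (f (z + w)))\<^sup>2) * indicator (ball 0 1) w \<le> ennreal (pi * exp ((cmod z + 1)\<^sup>2)) *
          (ennreal (exp (- (cmod (z + w))\<^sup>2) / pi) * ennreal ((cmod (f (z + w)))\<^sup>2))"
      proof (cases "w \<in> ball 0 1")
        case True
        then have "cmod (z + w) \<le> cmod z + 1" using norm_triangle_ineq[of z w] by simp
        then have "(cmod (z + w))\<^sup>2 \<le> (cmod z + 1)\<^sup>2" by (intro power_mono) auto
        then have "1 \<le> exp ((cmod z + 1)\<^sup>2) * exp (- (cmod (z + w))\<^sup>2)"
          by (simp flip: exp_add)
        then have "(cmod (f (z + w)))\<^sup>2 \<le> (cmod (f (z + w)))\<^sup>2 * (exp ((cmod z + 1)\<^sup>2) * exp (- (cmod (z + w))\<^sup>2))"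
          by (metis mult_left_mono mult.right_neutral zero_le_power2)
        then show ?thesis using True
          by (simp add: mult_ac flip: ennreal_mult)
      qed simp
    qed
    also have "\<dots> = ennreal (pi * exp ((cmod z + 1)\<^sup>2)) *
          (\<integral>\<^sup>+w. ennreal (exp (- (cmod (z + w))\<^sup>2) / pi) * ennreal ((cmod (f (z + w)))\<^sup>2) \<partial>lborel)"
    proof (rule nn_integral_cmult)
      have "continuous_on UNIV (\<lambda>w. (cmod (f (z + w)))\<^sup>2)"
        by (intro continuous_intros continuous_on_compose2[OF holomorphic_on_imp_continuous_on[OF h]]) auto
      then have [measurable]: "(\<lambda>w. (cmod (f (z + w)))\<^sup>2) \<in> borel_measurable borel" by (rule borel_measurable_continuous_onI)
      show "(\<lambda>w. ennreal (exp (- (cmod (z + w))\<^sup>2) / pi) * ennreal ((cmod (f (z + w)))\<^sup>2)) \<in> borel_measurable lborel"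
        by measurable
    qed
    also have "(\<integral>\<^sup>+w. ennreal (exp (- (cmod (z + w))\<^sup>2) / pi) * ennreal ((cmod (f (z + w)))\<^sup>2) \<partial>lborel)
       = (\<integral>\<^sup>+w. ennreal (exp (- (cmod w)\<^sup>2) / pi) * ennreal ((cmod (f w))\<^sup>2) \<partial>lborel)"
      by (rule nn_integral_lborel_translate[where f = "\<lambda>w. ennreal (exp (- (cmod w)\<^sup>2) / pi) * ennreal ((cmod (f w))\<^sup>2)"]) measurable
    also have "\<dots> = ennreal I"
      using I(1) by (subst (asm) nn_integral_gauss_measure) auto
    finally have "(cmod (f z))\<^sup>2 * v \<le> pi * exp ((cmod z + 1)\<^sup>2) * I"
      using I(2) \<open>v > 0\<close> by (simp flip: ennreal_mult)
    then have "(cmod (f z))\<^sup>2 \<le> (pi * I / v) * exp ((cmod z + 1)\<^sup>2)"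
      using \<open>v > 0\<close> by (simp add: field_simps)
    also have "\<dots> \<le> C\<^sup>2 * exp ((cmod z + 1)\<^sup>2)"
    proof (intro mult_right_mono)
      have "pi * I / v = (sqrt (pi * I / v))\<^sup>2" using I(2) \<open>v > 0\<close> by simp
      also have "\<dots> \<le> C\<^sup>2" unfolding C_def using I(2) \<open>v > 0\<close> by (intro power_mono) auto
      finally show "pi * I / v \<le> C\<^sup>2" .
    qed auto
    also have "\<dots> = (C * exp ((cmod z + 1)\<^sup>2 / 2))\<^sup>2"
      by (simp add: power_mult_distrib flip: exp_double)
    finally show ?thesis
      by (rule power2_le_imp_le) (use \<open>C > 0\<close> in auto)
  qed
  with \<open>C > 0\<close> show ?thesis by blast
qed

section \<open>The canonical product of genus two\<close>

text \<open>Quadratic growth enters the construction of the product through convergence of the sum of inverse cubes. In this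
  form it passes by comparison to the multiset with some points deleted, which the proofs below rely on.\<close>

locale genus_two_multiset =
  fixes m :: cmult
  assumes locally_finite: "locally_finite m"
    and summable_inverse_cubes: "(\<lambda>w. real (m w) / cmod w ^ 3) summable_on nonzero_pts m"
begin

definition near :: "real \<Rightarrow> complex set" where
  "near r = {w \<in> nonzero_pts m. cmod w \<le> r}"

definition far :: "real \<Rightarrow> complex set" where
  "far r = {w \<in> nonzero_pts m. cmod w > r}"

definition cube_tail :: "real \<Rightarrow> real" where
  "cube_tail r = (\<Sum>\<^sub>\<infinity>w\<in>far r. real (m w) / cmod w ^ 3)"

definition log_factor :: "complex \<Rightarrow> complex \<Rightarrow> complex" where
  "log_factor w z = of_nat (m w) * Ln (weierstrass_factor 2 (z / w))"

text \<open>Defined by the principal logarithm, which is harmless for \<open>\<bar>z\<bar> \<le> r / 2\<close>: then \<open>\<bar>z / w\<bar> < 1 / 2\<close> for the far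
  points, and the elementary factors lie in the right half-plane.\<close>

definition tail_log :: "real \<Rightarrow> complex \<Rightarrow> complex" where
  "tail_log r z = (\<Sum>\<^sub>\<infinity>w\<in>far r. log_factor w z)"

lemma finite_near [simp]: "finite (near r)"
  using locally_finite unfolding locally_finite_def near_def nonzero_pts_def
  by (elim allE[of _ r] rev_finite_subset) auto

lemma near_far: "nonzero_pts m = near r \<union> far r" "near r \<inter> far r = {}"
  by (auto simp: near_def far_def)

lemma summable_far: "(\<lambda>w. real (m w) / cmod w ^ 3) summable_on far r"
  using summable_inverse_cubes by (rule summable_on_subset_banach) (auto simp: far_def)

lemma cube_tail_nonneg: "cube_tail r \<ge> 0"
  unfolding cube_tail_def by (intro infsum_nonneg) auto

lemma weierstrass_factor_2: "weierstrass_factor 2 u = (1 - u) * exp (u + u\<^sup>2 / 2)"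
  by (simp add: weierstrass_factor_def numeral_2_eq_2)

lemma norm_Ln_weierstrass_factor_le:
  assumes "cmod u < 1 / 2"
  shows "cmod (Ln (weierstrass_factor 2 u)) \<le> 6 * cmod u ^ 3"
    and "Re (weierstrass_factor 2 u) > 0"
proof -
  have b: "cmod (weierstrass_factor 2 u - 1) \<le> 3 * cmod u ^ 3"
    using weierstrass_factor_bound[of u 2] assms by (simp add: numeral_3_eq_3)
  also have "3 * cmod u ^ 3 < 3 * (1 / 2) ^ 3"
    using assms by (intro mult_strict_left_mono power_strict_mono) auto
  finally have lt: "cmod (weierstrass_factor 2 u - 1) < 1 / 2" by (simp add: power3_eq_cube)
  show "cmod (Ln (weierstrass_factor 2 u)) \<le> 6 * cmod u ^ 3"
    using norm_Ln_le[OF lt] b by simp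
  show "Re (weierstrass_factor 2 u) > 0"
    using lt abs_Re_le_cmod[of "weierstrass_factor 2 u - 1"] by simp
qed

lemma norm_log_factor_le:
  assumes "cmod z \<le> r / 2" "w \<in> far r" "r > 0"
  shows "cmod (log_factor w z) \<le> 6 * cmod z ^ 3 * (real (m w) / cmod w ^ 3)"
    and "cmod (z / w) < 1 / 2"
proof -
  show lt: "cmod (z / w) < 1 / 2" 
  proof -
    have "2 * cmod z < cmod w" "cmod w > 0" using assms by (auto simp: far_def)
    then show ?thesis by (simp add: norm_divide divide_less_eq)
  qed
  have "cmod (log_factor w z) \<le> real (m w) * (6 * cmod (z / w) ^ 3)"
    unfolding log_factor_def norm_mult using norm_Ln_weierstrass_factor_le(1)[OF lt]
    by (simp add: mult_left_mono)
  then show "cmod (log_factor w z) \<le> 6 * cmod z ^ 3 * (real (m w) / cmod w ^ 3)"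
    by (simp add: norm_divide power_divide mult_ac)
qed

lemma exp_log_factor:
  assumes "cmod z \<le> r / 2" "w \<in> far r" "r > 0"
  shows "exp (log_factor w z) = weierstrass_factor 2 (z / w) ^ m w"
proof -
  have "weierstrass_factor 2 (z / w) \<noteq> 0"
    using norm_Ln_weierstrass_factor_le(2)[OF norm_log_factor_le(2)[OF assms]] by auto
  then show ?thesis by (simp add: log_factor_def exp_of_nat_mult)
qed

lemma has_sum_tail_log:
  assumes "cmod z \<le> r / 2" "r > 0"
  shows "((\<lambda>w. log_factor w z) has_sum tail_log r z) (far r)"
proof -
  have "(\<lambda>w. 6 * cmod z ^ 3 * (real (m w) / cmod w ^ 3)) summable_on far r"
    by (intro summable_on_cmult_right summable_far)
  then have "(\<lambda>w. cmod (log_factor w z)) summable_on far r"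
    by (rule Infinite_Sum.abs_summable_on_comparison_test'[where g = "\<lambda>w. 6 * cmod z ^ 3 * (real (m w) / cmod w ^ 3)"])
       (use norm_log_factor_le(1) assms in auto)
  then have "(\<lambda>w. log_factor w z) summable_on far r"
    by (rule abs_summable_summable)
  then show ?thesis unfolding tail_log_def by (rule has_sum_infsum)
qed

lemma norm_tail_log_le:
  assumes "cmod z \<le> r / 2" "r > 0"
  shows "cmod (tail_log r z) \<le> 6 * cmod z ^ 3 * cube_tail r"
proof (rule norm_infsum_le[OF has_sum_tail_log[OF assms]])
  show "((\<lambda>w. 6 * cmod z ^ 3 * (real (m w) / cmod w ^ 3)) has_sum 6 * cmod z ^ 3 * cube_tail r) (far r)"
    unfolding cube_tail_def by (intro has_sum_cmult_right has_sum_infsum summable_far)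
qed (use norm_log_factor_le(1) assms in auto)

text \<open>The Weierstrass test over the directed family of finite subsets, with the inverse cubes as majorants.\<close>

lemma holomorphic_tail_log:
  assumes "r > 0"
  shows "tail_log r holomorphic_on ball 0 (r / 2)"
proof -
  have ul: "uniform_limit (cball 0 (r / 2)) (\<lambda>F z. \<Sum>w\<in>F. log_factor w z) (tail_log r) (finite_subsets_at_top (far r))"
    unfolding tail_log_def
  proof (rule Weierstrass_m_test_general)
    show "(\<lambda>w. 6 * (r / 2) ^ 3 * (real (m w) / cmod w ^ 3)) summable_on far r"
      by (intro summable_on_cmult_right summable_far)
    fix w z :: complex assume w: "w \<in> far r" and z: "z \<in> cball 0 (r / 2)"
    have "cmod (log_factor w z) \<le> 6 * cmod z ^ 3 * (real (m w) / cmod w ^ 3)"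
      using norm_log_factor_le(1)[of z r w] z w assms by auto
    also have "\<dots> \<le> 6 * (r / 2) ^ 3 * (real (m w) / cmod w ^ 3)"
      using z by (intro mult_right_mono mult_left_mono power_mono) auto
    finally show "cmod (log_factor w z) \<le> 6 * (r / 2) ^ 3 * (real (m w) / cmod w ^ 3)" .
  qed
  have hol: "log_factor w holomorphic_on ball 0 (r / 2)" "continuous_on (cball 0 (r / 2)) (log_factor w)"
    if "w \<in> far r" for w
  proof -
    have ne: "w \<noteq> 0" using that by (auto simp: far_def nonzero_pts_def)
    have nn: "weierstrass_factor 2 (z / w) \<notin> \<real>\<^sub>\<le>\<^sub>0" if "z \<in> cball 0 (r / 2)" for z :: complex
      using norm_Ln_weierstrass_factor_le(2)[OF norm_log_factor_le(2)[of z r w]] that \<open>w \<in> far r\<close> assms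
      by (auto simp: complex_nonpos_Reals_iff)
    show "log_factor w holomorphic_on ball 0 (r / 2)"
      unfolding log_factor_def[abs_def] using nn ne by (intro holomorphic_intros) auto
    show "continuous_on (cball 0 (r / 2)) (log_factor w)"
      unfolding log_factor_def[abs_def] using nn ne by (intro continuous_intros) auto
  qed
  show ?thesis
  proof (rule holomorphic_uniform_limit[OF _ ul])
    show "\<forall>\<^sub>F F in finite_subsets_at_top (far r).
       continuous_on (cball 0 (r / 2)) (\<lambda>z. \<Sum>w\<in>F. log_factor w z) \<and>
       (\<lambda>z. \<Sum>w\<in>F. log_factor w z) holomorphic_on ball 0 (r / 2)"
      by (rule eventually_finite_subsets_at_top_weakI)
         (auto intro!: continuous_intros holomorphic_intros hol)
  qed simp
qed

text \<open>A finite set containing all near points splits the product into the near factors and the exponential of a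
  partial sum of logarithms.\<close>

lemma tendsto_partial_products:
  assumes "cmod z \<le> r / 2" "r > 0"
  shows "((\<lambda>F. \<Prod>w\<in>F. weierstrass_factor 2 (z / w) ^ m w) \<longlongrightarrow>
     (\<Prod>w\<in>near r. weierstrass_factor 2 (z / w) ^ m w) * exp (tail_log r z)) (finite_subsets_at_top (nonzero_pts m))"
proof -
  define a where "a w = (if w \<in> far r then log_factor w z else 0)" for w
  have "(a has_sum tail_log r z) (nonzero_pts m)"
    using has_sum_tail_log[OF assms]
    by (rule has_sum_cong_neutral[THEN iffD1, rotated -1]) (auto simp: a_def far_def)
  then have "((\<lambda>F. exp (sum a F)) \<longlongrightarrow> exp (tail_log r z)) (finite_subsets_at_top (nonzero_pts m))"
    unfolding has_sum_def by (rule tendsto_exp)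
  then have "((\<lambda>F. (\<Prod>w\<in>near r. weierstrass_factor 2 (z / w) ^ m w) * exp (sum a F)) \<longlongrightarrow>
     (\<Prod>w\<in>near r. weierstrass_factor 2 (z / w) ^ m w) * exp (tail_log r z)) (finite_subsets_at_top (nonzero_pts m))"
    by (intro tendsto_mult tendsto_const)
  moreover have "\<forall>\<^sub>F F in finite_subsets_at_top (nonzero_pts m).
     (\<Prod>w\<in>near r. weierstrass_factor 2 (z / w) ^ m w) * exp (sum a F) = (\<Prod>w\<in>F. weierstrass_factor 2 (z / w) ^ m w)"
    unfolding eventually_finite_subsets_at_top
  proof (intro exI[of _ "near r"] conjI allI impI)
    fix F assume F: "finite F \<and> near r \<subseteq> F \<and> F \<subseteq> nonzero_pts m"
    then have FF: "F = near r \<union> (F - near r)" "F - near r \<subseteq> far r" using near_far[of r] by auto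
    have "exp (sum a F) = (\<Prod>w\<in>F. exp (a w))" using F by (simp add: exp_sum)
    also have "\<dots> = (\<Prod>w\<in>F - near r. weierstrass_factor 2 (z / w) ^ m w)"
    proof (rule prod.mono_neutral_cong_right)
      show "\<forall>i\<in>F - (F - near r). exp (a i) = 1" using near_far(2)[of r] by (auto simp: a_def)
      show "exp (a w) = weierstrass_factor 2 (z / w) ^ m w" if "w \<in> F - near r" for w
        using that FF(2) exp_log_factor[OF assms(1) _ assms(2)] by (auto simp: a_def)
    qed (use F in auto)
    finally show "(\<Prod>w\<in>near r. weierstrass_factor 2 (z / w) ^ m w) * exp (sum a F) = (\<Prod>w\<in>F. weierstrass_factor 2 (z / w) ^ m w)"
      using F by (subst (2) FF(1), subst prod.union_disjoint) auto
  qed (simp, auto simp: near_def)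
  ultimately show ?thesis by (rule Lim_transform_eventually)
qed

lemma canonical_product_eq:
  assumes "cmod z \<le> r / 2" "r > 0"
  shows "canonical_product m z = z ^ m 0 * (\<Prod>w\<in>near r. weierstrass_factor 2 (z / w) ^ m w) * exp (tail_log r z)"
  unfolding canonical_product_def
  using tendsto_Lim[OF finite_subsets_at_top_neq_bot tendsto_partial_products[OF assms]] by simp

lemma holomorphic_canonical_product: "canonical_product m holomorphic_on UNIV"
proof -
  have *: "canonical_product m holomorphic_on ball 0 (r / 2)" if "r > 0" for r
  proof (rule holomorphic_transform)
    show "(\<lambda>z. z ^ m 0 * (\<Prod>w\<in>near r. weierstrass_factor 2 (z / w) ^ m w) * exp (tail_log r z)) holomorphic_on ball 0 (r / 2)"
      using that by (intro holomorphic_intros holomorphic_tail_log) (auto simp: near_def nonzero_pts_def)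
    show "z ^ m 0 * (\<Prod>w\<in>near r. weierstrass_factor 2 (z / w) ^ m w) * exp (tail_log r z) = canonical_product m z"
      if "z \<in> ball 0 (r / 2)" for z
      using canonical_product_eq[of z r] that \<open>r > 0\<close> by simp
  qed
  show ?thesis
  proof (rule holomorphic_on_subset)
    show "canonical_product m holomorphic_on (\<Union>n. ball 0 (real (Suc n) / 2))"
      by (intro holomorphic_on_UN_open * open_ball) auto
    show "UNIV \<subseteq> (\<Union>n. ball (0::complex) (real (Suc n) / 2))"
    proof
      fix z :: complex
      obtain n where "real n > 2 * cmod z" using reals_Archimedean2 by blast
      then show "z \<in> (\<Union>n. ball (0::complex) (real (Suc n) / 2))" by (intro UN_I[of n]) auto
    qed
  qed
qed

lemma canonical_product_eq_0_iff: "canonical_product m z = 0 \<longleftrightarrow> m z \<noteq> 0"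
proof -
  define r where "r = 2 * cmod z + 1"
  have r: "r > 0" "cmod z \<le> r / 2" by (auto simp: r_def add_nonneg_pos)
  have "canonical_product m z = 0 \<longleftrightarrow> (z = 0 \<and> m 0 \<noteq> 0) \<or> (\<exists>w\<in>near r. z / w = 1 \<and> m w \<noteq> 0)"
    unfolding canonical_product_eq[OF r(2,1)] by (auto simp: weierstrass_factor_eq_0_iff)
  also have "\<dots> \<longleftrightarrow> m z \<noteq> 0"
    using r by (auto simp: near_def nonzero_pts_def r_def)
  finally show ?thesis .
qed

definition delete :: "complex set \<Rightarrow> cmult" where
  "delete D w = (if w \<in> D then 0 else m w)"

lemma genus_two_multiset_delete: "genus_two_multiset (delete D)"
proof
  show "locally_finite (delete D)"
    unfolding locally_finite_def
  proof
    fix r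
    have "finite {w. cmod w \<le> r \<and> m w \<noteq> 0}" using locally_finite by (simp add: locally_finite_def)
    then show "finite {w. cmod w \<le> r \<and> delete D w \<noteq> 0}"
      by (rule rev_finite_subset) (auto simp: delete_def)
  qed
  have sub: "nonzero_pts (delete D) \<subseteq> nonzero_pts m"
    by (auto simp: nonzero_pts_def delete_def split: if_splits)
  have "(\<lambda>w. real (m w) / cmod w ^ 3) summable_on nonzero_pts (delete D)"
    using summable_inverse_cubes sub by (rule summable_on_subset_banach)
  then show "(\<lambda>w. real (delete D w) / cmod w ^ 3) summable_on nonzero_pts (delete D)"
    by (rule summable_on_cong[THEN iffD1, rotated]) (auto simp: delete_def nonzero_pts_def split: if_splits)
qed

text \<open>What remains of the elementary factors of the points of \<open>D\<close> once the linear factors \<open>z - w\<close> are taken out.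
  The origin is left out because its factor \<open>z\<close> has nothing attached to it.\<close>

definition delete_unit :: "complex set \<Rightarrow> complex \<Rightarrow> complex" where
  "delete_unit D z = (\<Prod>w\<in>D - {0}. (- exp (z / w + (z / w)\<^sup>2 / 2) / w) ^ m w)"

lemma holomorphic_delete_unit: "delete_unit D holomorphic_on A"
  unfolding delete_unit_def[abs_def] by (intro holomorphic_intros) auto

lemma delete_unit_nonzero: "finite D \<Longrightarrow> delete_unit D z \<noteq> 0"
  by (simp add: delete_unit_def)

lemma tail_log_delete:
  assumes "\<And>w. w \<in> D \<Longrightarrow> cmod w \<le> r"
  shows "genus_two_multiset.tail_log (delete D) r z = tail_log r z"
proof -
  interpret d: genus_two_multiset "delete D" by (rule genus_two_multiset_delete)
  have far: "d.far r = far r"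
    using assms by (fastforce simp: d.far_def far_def nonzero_pts_def delete_def split: if_splits)
  show ?thesis
    unfolding d.tail_log_def tail_log_def far
    by (intro infsum_cong) (use assms in \<open>fastforce simp: d.log_factor_def log_factor_def delete_def far_def\<close>)
qed

text \<open>Dividing out zeros leaves a zero-free factor times a canonical product of the same kind. This yields
  the order of vanishing, the relation of \<open>P\<close> to the potential, and the growth estimates of the last sections.\<close>

lemma canonical_product_delete:
  assumes "finite D"
  shows "canonical_product m z = (\<Prod>w\<in>D. (z - w) ^ m w) * delete_unit D z * canonical_product (delete D) z"
proof -
  interpret d: genus_two_multiset "delete D" by (rule genus_two_multiset_delete)
  obtain B where B: "\<And>w. w \<in> D \<Longrightarrow> cmod w \<le> B" using finite_imp_bounded[OF assms] by (auto simp: bounded_iff)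
  define r where "r = max B (2 * cmod z + 1)"
  have r: "r > 0" "cmod z \<le> r / 2" by (auto simp: r_def add_nonneg_pos intro: less_max_iff_disj[THEN iffD2])
  have tl: "d.tail_log r z = tail_log r z"
    using B by (intro tail_log_delete) (fastforce simp: r_def)
  have "(\<Prod>w\<in>near r. weierstrass_factor 2 (z / w) ^ m w) = (\<Prod>w\<in>near r \<union> (D - {0}). weierstrass_factor 2 (z / w) ^ m w)"
  proof (rule prod.mono_neutral_left)
    show "finite (near r \<union> (D - {0}))" using assms by simp
    have "m w = 0" if "w \<in> D" "w \<noteq> 0" "w \<notin> near r" for w
      using that B[of w] by (auto simp: near_def nonzero_pts_def r_def)
    then show "\<forall>w\<in>near r \<union> (D - {0}) - near r. weierstrass_factor 2 (z / w) ^ m w = 1"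
      by (metis DiffD1 DiffD2 UnE insertI1 power_0)
  qed auto
  also have "near r \<union> (D - {0}) = d.near r \<union> (D - {0})"
    by (auto simp: near_def d.near_def nonzero_pts_def delete_def split: if_splits)
  also have "(\<Prod>w\<in>d.near r \<union> (D - {0}). weierstrass_factor 2 (z / w) ^ m w) =
     (\<Prod>w\<in>d.near r. weierstrass_factor 2 (z / w) ^ m w) * (\<Prod>w\<in>D - {0}. weierstrass_factor 2 (z / w) ^ m w)"
    using assms by (intro prod.union_disjoint d.finite_near) (auto simp: d.near_def nonzero_pts_def delete_def)
  also have "(\<Prod>w\<in>d.near r. weierstrass_factor 2 (z / w) ^ m w) = (\<Prod>w\<in>d.near r. weierstrass_factor 2 (z / w) ^ delete D w)"
    by (intro prod.cong) (auto simp: d.near_def nonzero_pts_def delete_def)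
  also have "(\<Prod>w\<in>D - {0}. weierstrass_factor 2 (z / w) ^ m w) = (\<Prod>w\<in>D - {0}. (z - w) ^ m w) * delete_unit D z"
    unfolding delete_unit_def prod.distrib[symmetric] power_mult_distrib[symmetric]
    by (intro prod.cong refl arg_cong[where f = "\<lambda>u. u ^ _"]) (auto simp: weierstrass_factor_2 field_simps)
  finally have near: "(\<Prod>w\<in>near r. weierstrass_factor 2 (z / w) ^ m w) =
     (\<Prod>w\<in>d.near r. weierstrass_factor 2 (z / w) ^ delete D w) * ((\<Prod>w\<in>D - {0}. (z - w) ^ m w) * delete_unit D z)" .
  have zero: "z ^ m 0 * (\<Prod>w\<in>D - {0}. (z - w) ^ m w) = z ^ delete D 0 * (\<Prod>w\<in>D. (z - w) ^ m w)"
    using assms by (cases "0 \<in> D") (auto simp: delete_def prod.remove)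
  have "canonical_product m z = (z ^ m 0 * (\<Prod>w\<in>D - {0}. (z - w) ^ m w)) * delete_unit D z *
      ((\<Prod>w\<in>d.near r. weierstrass_factor 2 (z / w) ^ delete D w) * exp (tail_log r z))"
    unfolding canonical_product_eq[OF r(2,1)] near by (simp add: mult_ac)
  also have "\<dots> = (\<Prod>w\<in>D. (z - w) ^ m w) * delete_unit D z * canonical_product (delete D) z"
    unfolding zero d.canonical_product_eq[OF r(2,1)] tl by (simp add: mult_ac)
  finally show ?thesis .
qed

lemma zorder_canonical_product: "zorder (canonical_product m) z = int (m z)"
proof -
  interpret d: genus_two_multiset "delete {z}" by (rule genus_two_multiset_delete)
  show ?thesis
  proof (rule zorder_eqI[where S = UNIV and g = "\<lambda>u. delete_unit {z} u * canonical_product (delete {z}) u"])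
    show "(\<lambda>u. delete_unit {z} u * canonical_product (delete {z}) u) holomorphic_on UNIV"
      by (intro holomorphic_intros holomorphic_delete_unit d.holomorphic_canonical_product)
    show "delete_unit {z} z * canonical_product (delete {z}) z \<noteq> 0"
      using delete_unit_nonzero[of "{z}" z] d.canonical_product_eq_0_iff[of z] by (simp add: delete_def)
    show "canonical_product m u = delete_unit {z} u * canonical_product (delete {z}) u * (u - z) powi int (m z)"
      if "u \<in> UNIV" "u \<noteq> z" for u
      using canonical_product_delete[of "{z}" u] by (simp add: mult_ac)
  qed auto
qed

text \<open>A locally finite multiset has countable support, so it misses some point of the plane.\<close>

lemma canonical_product_not_zero: "\<exists>z. canonical_product m z \<noteq> 0"
proof -
  have "countable {w. m w \<noteq> 0}"
  proof -
    have "{w. m w \<noteq> 0} = (\<Union>n::nat. {w. cmod w \<le> real n \<and> m w \<noteq> 0})"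
      using real_arch_simple by auto
    also have "countable \<dots>"
    proof (rule countable_UN)
      show "countable {w. cmod w \<le> real n \<and> m w \<noteq> 0}" for n
        using locally_finite unfolding locally_finite_def by (intro countable_finite) blast
    qed simp
    finally show ?thesis .
  qed
  then have "{w. m w \<noteq> 0} \<noteq> UNIV" using uncountable_UNIV_complex by auto
  then show ?thesis using canonical_product_eq_0_iff by auto
qed

end

section \<open>The canonical potential\<close>

text \<open>Below the threshold of the asymptotic bound, monotonicity of the counting function and \<open>r \<ge> 1\<close> suffice.\<close>

lemma quadratic_growth_bound:
  assumes lf: "locally_finite m" and q: "quadratic_growth m"
  shows "\<exists>C. \<forall>r\<ge>1. real (counting_fn m r) \<le> C * r\<^sup>2"
proof -
  from q obtain c where "eventually (\<lambda>r. norm (real (counting_fn m r)) \<le> c * norm (r\<^sup>2)) at_top"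
    unfolding quadratic_growth_def by (elim landau_o.bigE)
  then obtain r0 where r0: "\<And>r. r \<ge> r0 \<Longrightarrow> real (counting_fn m r) \<le> c * r\<^sup>2"
    by (auto simp: eventually_at_top_linorder)
  have mono: "counting_fn m r \<le> counting_fn m s" if "r \<le> s" for r s
    unfolding counting_fn_def using lf that by (intro sum_mono2) (auto simp: locally_finite_def)
  have "real (counting_fn m r) \<le> (\<bar>c\<bar> + real (counting_fn m r0)) * r\<^sup>2" if "r \<ge> 1" for r
  proof (cases "r \<ge> r0")
    case True
    then have "real (counting_fn m r) \<le> c * r\<^sup>2" by (rule r0)
    also have "\<dots> \<le> (\<bar>c\<bar> + real (counting_fn m r0)) * r\<^sup>2" by (intro mult_right_mono) auto
    finally show ?thesis .
  next
    case False
    then have "real (counting_fn m r) \<le> real (counting_fn m r0) * 1" using mono[of r r0] by simp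
    also have "\<dots> \<le> (\<bar>c\<bar> + real (counting_fn m r0)) * r\<^sup>2"
      using that by (intro mult_mono) auto
    finally show ?thesis .
  qed
  then show ?thesis by blast
qed

text \<open>For \<open>\<bar>w\<bar> > 1\<close>, the inverse cube of \<open>\<bar>w\<bar>\<close> is at most the sum of \<open>8 / 8\<^sup>k\<close> over the \<open>k\<close> with \<open>\<bar>w\<bar> \<le> 2\<^sup>k\<close>.
  Summing over \<open>w\<close> first gives the counting function at \<open>2\<^sup>k\<close>, which is \<open>O(4\<^sup>k)\<close>, and hence a geometric series.\<close>

lemma summable_inverse_cubes_if_quadratic_growth:
  assumes lf: "locally_finite m" and q: "quadratic_growth m"
  shows "(\<lambda>w. real (m w) / cmod w ^ 3) summable_on nonzero_pts m"
proof -
  obtain C where C: "\<And>r. r \<ge> 1 \<Longrightarrow> real (counting_fn m r) \<le> C * r\<^sup>2"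
    using quadratic_growth_bound[OF assms] by blast
  have fin: "finite {w. cmod w \<le> r \<and> m w \<noteq> 0}" for r using lf by (simp add: locally_finite_def)
  have "C \<ge> 0" using C[of 1] by simp
  define A where "A = {w \<in> nonzero_pts m. cmod w > 1}"
  define B where "B = {w \<in> nonzero_pts m. cmod w \<le> 1}"
  have "finite B" unfolding B_def nonzero_pts_def by (rule finite_subset[OF _ fin[of 1]]) auto
  have "(\<lambda>w. real (m w) / cmod w ^ 3) summable_on A"
  proof (rule nonneg_bdd_above_summable_on)
    show "bdd_above (sum (\<lambda>w. real (m w) / cmod w ^ 3) ` {F. F \<subseteq> A \<and> finite F})"
    proof (rule bdd_aboveI2)
      fix F assume "F \<in> {F. F \<subseteq> A \<and> finite F}"
      then have F: "F \<subseteq> A" "finite F" by auto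
      obtain M where M: "\<And>w. w \<in> F \<Longrightarrow> cmod w \<le> M" using finite_imp_bounded[OF F(2)] by (auto simp: bounded_iff)
      obtain K where K: "M < 2 ^ K" using real_arch_pow[of 2 M] by auto
      define c where "c k w = (if cmod w \<le> 2 ^ k then 8 / 8 ^ k else (0::real))" for k :: nat and w
      have pt: "1 / cmod w ^ 3 \<le> (\<Sum>k\<le>K. c k w)" if "w \<in> F" for w
      proof -
        \<comment> \<open>The least dyadic radius reaching \<open>w\<close> contributes the single term that already suffices.\<close>
        define k where "k = (LEAST k. cmod w \<le> 2 ^ k)"
        have wK: "cmod w \<le> 2 ^ K" using M[OF that] K by simp
        then have k: "cmod w \<le> 2 ^ k" "k \<le> K" unfolding k_def by (auto intro: LeastI Least_le)
        have "cmod w > 1" using that F(1) by (auto simp: A_def)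
        then have "k \<noteq> 0" using k(1) by (intro notI) simp
        then obtain j where j: "k = Suc j" by (cases k) auto
        have "\<not> cmod w \<le> 2 ^ j" using not_less_Least[of j "\<lambda>k. cmod w \<le> 2 ^ k"] j by (simp add: k_def)
        then have "(2 ^ j) ^ 3 \<le> cmod w ^ 3" by (intro power_mono) auto
        also have "(2 ^ j) ^ 3 = (8::real) ^ j" by (simp flip: power_mult add: mult.commute[of j] power_mult)
        finally have "8 / 8 ^ k \<ge> 1 / cmod w ^ 3" using \<open>cmod w > 1\<close> by (simp add: j frac_le)
        then have "1 / cmod w ^ 3 \<le> c k w" using k(1) by (simp add: c_def)
        also have "\<dots> \<le> (\<Sum>k\<le>K. c k w)" using k(2) by (intro member_le_sum) (auto simp: c_def)
        finally show ?thesis .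
      qed
      have "(\<Sum>w\<in>F. real (m w) / cmod w ^ 3) \<le> (\<Sum>w\<in>F. real (m w) * (\<Sum>k\<le>K. c k w))"
        using mult_left_mono[OF pt, of _ "real (m _)"] by (intro sum_mono) simp
      also have "\<dots> = (\<Sum>k\<le>K. \<Sum>w\<in>F. real (m w) * c k w)"
        unfolding sum_distrib_left by (rule sum.swap)
      also have "\<dots> \<le> (\<Sum>k\<le>K. 8 * C * (1 / 2) ^ k)"
      proof (rule sum_mono)
        fix k
        have "(\<Sum>w\<in>F. real (m w) * c k w) = (\<Sum>w\<in>{w\<in>F. cmod w \<le> 2 ^ k}. real (m w) * (8 / 8 ^ k))"
          using F(2) by (intro sum.mono_neutral_cong_right) (auto simp: c_def)
        also have "\<dots> \<le> (\<Sum>w | cmod w \<le> 2 ^ k \<and> m w \<noteq> 0. real (m w) * (8 / 8 ^ k))"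
          using F(1) by (intro sum_mono2 fin) (auto simp: A_def nonzero_pts_def)
        also have "\<dots> = real (counting_fn m (2 ^ k)) * (8 / 8 ^ k)"
          by (simp add: counting_fn_def sum_distrib_right sum_divide_distrib)
        also have "\<dots> \<le> (C * (2 ^ k)\<^sup>2) * (8 / 8 ^ k)"
          by (intro mult_right_mono C) auto
        also have "\<dots> = 8 * C * (((2 ^ k)\<^sup>2) / 8 ^ k)" by simp
        also have "((2 ^ k)\<^sup>2) / 8 ^ k = (1 / 2 :: real) ^ k"
          by (simp add: power_divide[symmetric] flip: power_mult power_mult_distrib) (simp add: mult.commute[of k] power_mult flip: power_divide)
        finally show "(\<Sum>w\<in>F. real (m w) * c k w) \<le> 8 * C * (1 / 2) ^ k" .
      qed
      also have "\<dots> = 8 * C * (\<Sum>k\<le>K. (1 / 2) ^ k)" by (simp add: sum_distrib_left)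
      also have "(\<Sum>k\<le>K. (1 / 2 :: real) ^ k) \<le> 2"
        unfolding sum_gp0 by (simp add: field_simps)
      finally show "(\<Sum>w\<in>F. real (m w) / cmod w ^ 3) \<le> 8 * C * 2" using \<open>C \<ge> 0\<close> by (simp add: mult_left_mono)
    qed
  qed auto
  moreover have "(\<lambda>w. real (m w) / cmod w ^ 3) summable_on B" using \<open>finite B\<close> by simp
  ultimately have "(\<lambda>w. real (m w) / cmod w ^ 3) summable_on (A \<union> B)"
    by (rule summable_on_Un_disjoint) (auto simp: A_def B_def)
  also have "A \<union> B = nonzero_pts m" by (auto simp: A_def B_def)
  finally show ?thesis .
qed

context genus_two_multiset
begin

definition potential_term :: "complex \<Rightarrow> complex \<Rightarrow> real" where
  "potential_term w z = real (m w) * (log_plus (z - w) - ln (cmod w) + Re (z / w + z\<^sup>2 / (2 * w\<^sup>2)))"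

lemma exp_potential_term_outside:
  assumes "cmod (z - w) \<ge> 1" "w \<noteq> 0"
  shows "exp (potential_term w z) = cmod (weierstrass_factor 2 (z / w) ^ m w)"
proof -
  have "exp (log_plus (z - w) - ln (cmod w) + Re (z / w + z\<^sup>2 / (2 * w\<^sup>2))) = cmod (z - w) / cmod w * exp (Re (z / w + z\<^sup>2 / (2 * w\<^sup>2)))"
    using assms by (auto simp: log_plus_def max_absorb2 exp_add exp_diff)
  also have "cmod (z - w) / cmod w = cmod (1 - z / w)"
    using assms by (simp add: norm_divide[symmetric] diff_divide_distrib norm_minus_commute)
  also have "\<dots> * exp (Re (z / w + z\<^sup>2 / (2 * w\<^sup>2))) = cmod (weierstrass_factor 2 (z / w))"
    by (simp add: weierstrass_factor_2 norm_mult power_divide mult.commute)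
  finally show ?thesis by (simp add: potential_term_def exp_of_nat_mult norm_power)
qed

lemma exp_potential_term_inside:
  assumes "cmod (z - w) \<le> 1" "w \<noteq> 0"
  shows "exp (potential_term w z) = cmod ((- exp (z / w + (z / w)\<^sup>2 / 2) / w) ^ m w)"
  using assms
  by (simp add: potential_term_def exp_of_nat_mult norm_power log_plus_def max_absorb1 exp_add exp_diff
        norm_divide power_divide mult.commute exp_minus field_simps)

text \<open>Outside the unit disc around \<open>w\<close>, truncating the logarithm has no effect.\<close>

lemma potential_term_far:
  assumes "cmod z \<le> r / 2 - 1" "w \<in> far r"
  shows "potential_term w z = Re (log_factor w z)"
proof -
  have "cmod z \<ge> 0" by simp
  then have r: "cmod z \<le> r / 2" "r > 0" using assms(1) by linarith+
  have "cmod w > r" "w \<noteq> 0" using assms(2) by (auto simp: far_def nonzero_pts_def)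
  moreover have "cmod w - cmod z \<le> cmod (z - w)" by (metis norm_minus_commute norm_triangle_ineq2)
  ultimately have "cmod (z - w) \<ge> 1" using assms(1) r by linarith
  then have "exp (potential_term w z) = exp (Re (log_factor w z))"
    using exp_log_factor[OF r(1) assms(2) r(2)] \<open>w \<noteq> 0\<close>
    by (simp add: exp_potential_term_outside flip: norm_exp_eq_Re)
  then show ?thesis by simp
qed

lemma canonical_potential_eq:
  assumes "cmod z \<le> r / 2 - 1"
  shows "canonical_potential m z = real (m 0) * log_plus z + (\<Sum>w\<in>near r. potential_term w z) + Re (tail_log r z)"
proof -
  have "cmod z \<ge> 0" by simp
  then have r: "cmod z \<le> r / 2" "r > 0" using assms by linarith+
  have "((\<lambda>w. Re (log_factor w z)) has_sum Re (tail_log r z)) (far r)"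
    by (rule has_sum_Re[OF has_sum_tail_log[OF r]])
  then have "((\<lambda>w. potential_term w z) has_sum Re (tail_log r z)) (far r)"
    by (rule has_sum_cong[THEN iffD1, rotated]) (simp add: potential_term_far[OF assms])
  moreover have "((\<lambda>w. potential_term w z) has_sum (\<Sum>w\<in>near r. potential_term w z)) (near r)"
    by (rule has_sum_finite) simp
  ultimately have "((\<lambda>w. potential_term w z) has_sum ((\<Sum>w\<in>near r. potential_term w z) + Re (tail_log r z))) (nonzero_pts m)"
    using near_far[of r] has_sum_Un_disjoint by metis
  then show ?thesis
    unfolding canonical_potential_def by (subst infsumI) (auto simp: potential_term_def)
qed

lemma continuous_canonical_potential: "continuous_on UNIV (canonical_potential m)"
proof -
  have *: "continuous_on (ball 0 (r / 2 - 1)) (canonical_potential m)" if r: "r > 0" for r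
  proof (rule continuous_on_eq)
    have "continuous_on (ball 0 (r / 2 - 1)) (\<lambda>z. log_plus (z - w))" for w
      unfolding log_plus_def by (intro continuous_intros) (auto simp: max_def)
    note c = this this[of 0, simplified]
    have "continuous_on (ball 0 (r / 2)) (tail_log r)"
      by (intro holomorphic_on_imp_continuous_on holomorphic_tail_log r)
    then have "continuous_on (ball 0 (r / 2 - 1)) (tail_log r)"
      by (rule continuous_on_subset) auto
    then show "continuous_on (ball 0 (r / 2 - 1))
        (\<lambda>z. real (m 0) * log_plus z + (\<Sum>w\<in>near r. potential_term w z) + Re (tail_log r z))"
      unfolding potential_term_def
      by (intro continuous_intros c) (auto simp: near_def nonzero_pts_def)
    show "real (m 0) * log_plus z + (\<Sum>w\<in>near r. potential_term w z) + Re (tail_log r z) = canonical_potential m z"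
      if "z \<in> ball 0 (r / 2 - 1)" for z
      using canonical_potential_eq[of z r] that by simp
  qed
  show ?thesis
  proof (rule continuous_on_subset)
    show "continuous_on (\<Union>n. ball 0 (real (Suc n) / 2 - 1)) (canonical_potential m)"
      by (intro continuous_on_open_UN * open_ball) auto
    show "UNIV \<subseteq> (\<Union>n. ball (0::complex) (real (Suc n) / 2 - 1))"
    proof
      fix z :: complex
      obtain n where "real n > 2 * cmod z + 2" using reals_Archimedean2 by blast
      then show "z \<in> (\<Union>n. ball (0::complex) (real (Suc n) / 2 - 1))" by (intro UN_I[of n]) auto
    qed
  qed
qed

definition unit_neighbours :: "complex \<Rightarrow> complex set" where
  "unit_neighbours z = {w. cmod (z - w) \<le> 1 \<and> m w \<noteq> 0}"

lemma unit_neighbours_bound: "w \<in> unit_neighbours z \<Longrightarrow> cmod w \<le> cmod z + 1"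
  unfolding unit_neighbours_def using norm_triangle_ineq2[of w z] by (auto simp: norm_minus_commute)

lemma finite_unit_neighbours [simp]: "finite (unit_neighbours z)"
proof -
  have "finite {w. cmod w \<le> cmod z + 1 \<and> m w \<noteq> 0}" using locally_finite by (simp add: locally_finite_def)
  then show ?thesis
    by (rule rev_finite_subset) (use unit_neighbours_bound in \<open>auto simp: unit_neighbours_def\<close>)
qed

text \<open>A point \<open>w\<close> within distance 1 of \<open>z\<close> contributes to \<open>U z\<close> as if the factor \<open>z - w\<close> were absent, every other point as
  it does to \<open>ln \<bar>P z\<bar>\<close>.\<close>

lemma exp_canonical_potential:
  defines "D \<equiv> unit_neighbours"
  shows "exp (canonical_potential m z) = cmod (delete_unit (D z) z * canonical_product (delete (D z)) z)"
proof -
  interpret d: genus_two_multiset "delete (D z)" by (rule genus_two_multiset_delete)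
  define r where "r = 2 * cmod z + 2"
  have "cmod z \<ge> 0" "r / 2 = cmod z + 1" by (simp_all add: r_def)
  then have r: "cmod z \<le> r / 2 - 1" "cmod z \<le> r / 2" "r > 0" "cmod z + 1 \<le> r" by linarith+
  have DB: "cmod w \<le> r" if "w \<in> D z" for w
    using unit_neighbours_bound[of w z] that r(4) by (simp add: D_def)
  have Dz: "w \<in> D z \<longleftrightarrow> cmod (z - w) \<le> 1 \<and> m w \<noteq> 0" for w by (simp add: D_def unit_neighbours_def)
  have dn: "d.near r = {w. w \<notin> D z \<and> w \<noteq> 0 \<and> m w \<noteq> 0 \<and> cmod w \<le> r}"
    by (auto simp: d.near_def nonzero_pts_def delete_def)
  have near: "near r = d.near r \<union> (D z - {0})" "d.near r \<inter> (D z - {0}) = {}"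
    using DB by (auto simp: near_def dn nonzero_pts_def Dz)
  \<comment> \<open>The origin obeys the same rule: for \<open>\<bar>z\<bar> \<le> 1\<close> its factor is truncated, and it is deleted if it is in the support.\<close>
  have z0: "exp (real (m 0) * log_plus z) = cmod z ^ delete (D z) 0"
  proof (cases "cmod z \<le> 1")
    case True
    then show ?thesis by (simp add: log_plus_def delete_def D_def unit_neighbours_def)
  next
    case False
    then have "0 \<notin> D z" by (simp add: D_def unit_neighbours_def)
    moreover have "exp (ln (cmod z)) = cmod z" using False by (intro exp_ln) linarith
    ultimately show ?thesis using False by (simp add: log_plus_def delete_def exp_of_nat_mult max_absorb2)
  qed
  have "exp (\<Sum>w\<in>near r. potential_term w z) = (\<Prod>w\<in>near r. exp (potential_term w z))"
    by (simp add: exp_sum)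
  also have "\<dots> = (\<Prod>w\<in>d.near r. exp (potential_term w z)) * (\<Prod>w\<in>D z - {0}. exp (potential_term w z))"
    unfolding near(1) by (intro prod.union_disjoint near(2) d.finite_near) (simp add: D_def)
  also have "(\<Prod>w\<in>d.near r. exp (potential_term w z)) = cmod (\<Prod>w\<in>d.near r. weierstrass_factor 2 (z / w) ^ delete (D z) w)"
    unfolding prod_norm[symmetric]
    by (intro prod.cong refl, subst exp_potential_term_outside)
       (auto simp: dn Dz delete_def)
  also have "(\<Prod>w\<in>D z - {0}. exp (potential_term w z)) = cmod (delete_unit (D z) z)"
    unfolding delete_unit_def prod_norm[symmetric]
    by (intro prod.cong refl, subst exp_potential_term_inside) (auto simp: Dz)
  finally have s: "exp (\<Sum>w\<in>near r. potential_term w z) =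
    cmod (\<Prod>w\<in>d.near r. weierstrass_factor 2 (z / w) ^ delete (D z) w) * cmod (delete_unit (D z) z)" .
  have tl: "d.tail_log r z = tail_log r z" using DB by (intro tail_log_delete)
  show ?thesis
    unfolding canonical_potential_eq[OF r(1)] d.canonical_product_eq[OF r(2,3)] exp_add z0 s tl
    by (simp add: norm_mult norm_power mult_ac)
qed

text \<open>The factors divided out in \<open>exp_canonical_potential\<close> have modulus at most 1.\<close>

lemma canonical_product_le_exp_potential: "cmod (canonical_product m z) \<le> exp (canonical_potential m z)"
proof -
  let ?D = "unit_neighbours z"
  have "cmod (canonical_product m z) = cmod (\<Prod>w\<in>?D. (z - w) ^ m w) * exp (canonical_potential m z)"
    by (subst canonical_product_delete[of ?D]) (simp_all add: exp_canonical_potential norm_mult mult_ac)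
  also have "\<dots> \<le> 1 * exp (canonical_potential m z)"
    unfolding prod_norm[symmetric]
    by (intro mult_right_mono prod_le_1) (auto simp: unit_neighbours_def norm_power intro!: power_le_one)
  finally show ?thesis by simp
qed

end

section \<open>Zeros and growth of entire functions\<close>

lemma entire_eventually_nonzero:
  assumes "f holomorphic_on UNIV" "\<exists>z. f z \<noteq> 0"
  shows "eventually (\<lambda>w. f w \<noteq> 0) (at z)"
  using assms non_zero_neighbour_alt[of f UNIV z] by auto

text \<open>The quotient by a power of \<open>z - a\<close> has a removable singularity at \<open>a\<close>, filled by the local cofactor.\<close>

lemma entire_divide_zero:
  assumes f: "f holomorphic_on UNIV" and nz: "\<exists>z. f z \<noteq> 0"
  shows "\<exists>h. h holomorphic_on UNIV \<and> (\<forall>z. f z = (z - a) ^ nat (zorder f a) * h z) \<and> h a \<noteq> 0 \<and>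
     (\<forall>u. u \<noteq> a \<longrightarrow> zorder h u = zorder f u)"
proof -
  define k where "k = nat (zorder f a)"
  define g where "g = zor_poly f a"
  obtain r where r: "r > 0" "g holomorphic_on cball a r"
    "\<And>w. w \<in> cball a r \<Longrightarrow> f w = g w * (w - a) ^ k \<and> g w \<noteq> 0"
    using zorder_exist_zero[of f UNIV a] f nz unfolding k_def g_def by (auto simp del: mem_cball)
  define h where "h z = (if z = a then g a else f z / (z - a) ^ k)" for z
  have hg: "h z = g z" if "z \<in> cball a r" for z using r(3)[OF that] by (auto simp: h_def)
  have "h holomorphic_on ball a r"
    by (rule holomorphic_transform[of g])
       (use r(2) hg in \<open>auto intro: holomorphic_on_subset\<close>)
  moreover have "h holomorphic_on (- {a})"
    by (rule holomorphic_transform[of "\<lambda>z. f z / (z - a) ^ k"])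
       (auto simp: h_def intro!: holomorphic_intros holomorphic_on_subset[OF f])
  ultimately have "h holomorphic_on (ball a r \<union> - {a})"
    by (intro holomorphic_on_Un) auto
  moreover have "ball a r \<union> - {a} = UNIV" using r(1) by auto
  ultimately have h: "h holomorphic_on UNIV" by simp
  have eq: "f z = (z - a) ^ k * h z" for z
    using r(3)[of a] r(1) by (cases "z = a") (auto simp: h_def)
  have "h a \<noteq> 0" using hg[of a] r(3)[of a] r(1) by simp
  have "zorder h u = zorder f u" if "u \<noteq> a" for u
  proof -
    have "f = (\<lambda>z. (z - a) ^ k * h z)" by (rule ext) (rule eq)
    then have "zorder f u = zorder (\<lambda>z. (z - a) ^ k * h z) u" by simp
    also have "\<dots> = zorder (\<lambda>z. (z - a) ^ k) u + zorder h u"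
    proof (rule zorder_times_analytic)
      show "h analytic_on {u}" using h analytic_on_holomorphic by blast
      show "\<forall>\<^sub>F z in at u. (z - a) ^ k * h z \<noteq> 0"
        using entire_eventually_nonzero[OF f nz, of u] by (simp flip: eq)
    qed (auto intro!: analytic_intros)
    also have "zorder (\<lambda>z. (z - a) ^ k) u = 0"
      using that by (intro zorder_eq_0I) (auto intro!: analytic_intros)
    finally show ?thesis by simp
  qed
  with h eq \<open>h a \<noteq> 0\<close> show ?thesis unfolding k_def by blast
qed

lemma entire_divide_zeros:
  assumes "finite D" "f holomorphic_on UNIV" "\<exists>z. f z \<noteq> 0"
  shows "\<exists>h. h holomorphic_on UNIV \<and> (\<exists>z. h z \<noteq> 0) \<and> (\<forall>z. f z = (\<Prod>w\<in>D. (z - w) ^ nat (zorder f w)) * h z)"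
  using assms
proof (induction D arbitrary: f rule: finite_induct)
  case empty
  then show ?case by auto
next
  case (insert a D)
  obtain h where h: "h holomorphic_on UNIV" "\<And>z. f z = (z - a) ^ nat (zorder f a) * h z" "h a \<noteq> 0"
    "\<And>u. u \<noteq> a \<Longrightarrow> zorder h u = zorder f u"
    using entire_divide_zero[OF insert.prems, of a] by blast
  obtain q where q: "q holomorphic_on UNIV" "\<exists>z. q z \<noteq> 0" "\<And>z. h z = (\<Prod>w\<in>D. (z - w) ^ nat (zorder h w)) * q z"
    using insert.IH[OF h(1)] h(3) by blast
  have "(\<Prod>w\<in>D. (z - w) ^ nat (zorder h w)) = (\<Prod>w\<in>D. (z - w) ^ nat (zorder f w))" for z
    using insert.hyps h(4) by (intro prod.cong refl) metis
  then have "f z = (\<Prod>w\<in>insert a D. (z - w) ^ nat (zorder f w)) * q z" for z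
    using insert.hyps h(2)[of z] q(3)[of z] by (simp add: mult_ac)
  with q show ?case by blast
qed

lemma entire_max_modulus:
  assumes h: "h holomorphic_on UNIV" and le: "\<And>z. cmod z = R \<Longrightarrow> cmod (h z) \<le> B" and z: "cmod z \<le> R"
  shows "cmod (h z) \<le> B"
proof (rule maximum_modulus_frontier[where S = "cball 0 R" and f = h and \<xi> = z])
  show "h holomorphic_on interior (cball 0 R)" using h by (rule holomorphic_on_subset) simp
  show "continuous_on (closure (cball 0 R)) h"
    using holomorphic_on_imp_continuous_on[OF h] by (rule continuous_on_subset) simp
qed (use le z in auto)

text \<open>A weak form of Jensen's inequality from the maximum principle. Divide out the zeros in \<open>\<bar>w\<bar> \<le> r\<close>. On
  \<open>\<bar>z\<bar> = 3 r\<close> each linear factor has modulus at least \<open>2 \<bar>w\<bar>\<close>, twice its modulus at the origin, so every zero costs a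
  factor 2 in the comparison of the value at the origin with the maximum on the circle.\<close>

lemma quadratic_growth_of_zeros:
  assumes lf: "locally_finite m" and zm: "has_zero_multiset f m" and "C > 0"
    and growth: "\<And>z. cmod (f z) \<le> C * exp ((cmod z + 1)\<^sup>2 / 2)"
  shows "quadratic_growth m"
proof -
  from zm have f: "f holomorphic_on UNIV" "\<exists>z. f z \<noteq> 0" and zo: "\<And>z. zorder f z = int (m z)"
    by (auto simp: has_zero_multiset_def)
  have fin: "finite {w. cmod w \<le> r \<and> m w \<noteq> 0}" for r using lf by (simp add: locally_finite_def)
  obtain f1 where f1: "f1 holomorphic_on UNIV" "\<And>z. f z = (z - 0) ^ nat (zorder f 0) * f1 z" "f1 0 \<noteq> 0"
    "\<And>u. u \<noteq> 0 \<Longrightarrow> zorder f1 u = zorder f u"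
    using entire_divide_zero[OF f, of 0] by blast
  have bound: "real (counting_fn m r) * ln 2 \<le> real (m 0) + ln C + (3 * r + 1)\<^sup>2 / 2 - ln (cmod (f1 0))"
    if r: "r \<ge> 1" for r
  proof -
    define D where "D = {w. cmod w \<le> r \<and> m w \<noteq> 0} - {0}"
    have "finite D" using fin by (simp add: D_def)
    have "\<exists>z. f1 z \<noteq> 0" using f1(3) by blast
    from entire_divide_zeros[OF \<open>finite D\<close> f1(1) this]
    obtain h where h: "h holomorphic_on UNIV"
      and h2: "\<forall>z. f1 z = (\<Prod>w\<in>D. (z - w) ^ nat (zorder f1 w)) * h z" by blast
    have h': "f1 z = (\<Prod>w\<in>D. (z - w) ^ m w) * h z" for z
    proof -
      have "(\<Prod>w\<in>D. (z - w) ^ nat (zorder f1 w)) = (\<Prod>w\<in>D. (z - w) ^ m w)"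
        by (intro prod.cong refl) (simp add: D_def f1(4) zo)
      with h2 show ?thesis by simp
    qed
    define M where "M = C * exp ((3 * r + 1)\<^sup>2 / 2)"
    define p where "p = (\<Prod>w\<in>D. (2 * cmod w) ^ m w)"
    have "M > 0" using \<open>C > 0\<close> by (simp add: M_def)
    have "p > 0" unfolding p_def by (intro prod_pos) (auto simp: D_def)
    have "cmod (h z) \<le> M / p" if z: "cmod z = 3 * r" for z
    proof -
      have "cmod (f1 z) \<le> cmod z ^ nat (zorder f 0) * cmod (f1 z)"
        using z r mult_right_mono[OF one_le_power[of "cmod z" "nat (zorder f 0)"], of "cmod (f1 z)"] by simp
      also have "\<dots> = cmod (f z)" by (subst f1(2)) (simp add: norm_mult norm_power)
      also have "\<dots> \<le> M" using growth[of z] by (simp add: M_def z)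
      finally have "cmod (f1 z) \<le> M" .
      have "p \<le> (\<Prod>w\<in>D. cmod (z - w) ^ m w)"
        unfolding p_def
      proof (intro prod_mono conjI power_mono)
        fix w assume "w \<in> D"
        then have "cmod w \<le> r" by (simp add: D_def)
        then show "2 * cmod w \<le> cmod (z - w)" using norm_triangle_ineq2[of z w] z by simp
      qed auto
      then have "p * cmod (h z) \<le> (\<Prod>w\<in>D. cmod (z - w) ^ m w) * cmod (h z)" by (intro mult_right_mono) auto
      also have "\<dots> = cmod (f1 z)" by (subst h') (simp add: norm_mult norm_power prod_norm[symmetric])
      also have "\<dots> \<le> M" by fact
      finally show ?thesis using \<open>p > 0\<close> by (simp add: field_simps)
    qed
    then have "cmod (h 0) \<le> M / p"
      by (rule entire_max_modulus[OF h, where R = "3 * r"]) (use r in auto)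
    define N where "N = (\<Sum>w\<in>D. m w)"
    have p2: "p = 2 ^ N * (\<Prod>w\<in>D. cmod w ^ m w)"
      by (simp add: p_def N_def power_mult_distrib prod.distrib power_sum)
    have "cmod (f1 0) = (\<Prod>w\<in>D. cmod w ^ m w) * cmod (h 0)"
      by (subst h') (simp add: norm_mult norm_power prod_norm[symmetric])
    then have "2 ^ N * cmod (f1 0) = p * cmod (h 0)" by (simp add: p2)
    also have "\<dots> \<le> p * (M / p)" using \<open>p > 0\<close> by (intro mult_left_mono \<open>cmod (h 0) \<le> M / p\<close>) auto
    also have "\<dots> = M" using \<open>p > 0\<close> by simp
    finally have "2 ^ N * cmod (f1 0) \<le> M" .
    then have "ln (2 ^ N * cmod (f1 0)) \<le> ln M"
      using f1(3) \<open>M > 0\<close> by (subst ln_le_cancel_iff) auto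
    then have NN: "real N * ln 2 \<le> ln C + (3 * r + 1)\<^sup>2 / 2 - ln (cmod (f1 0))"
      using f1(3) \<open>C > 0\<close> by (simp add: M_def ln_mult ln_realpow)
    have "counting_fn m r \<le> (\<Sum>w\<in>insert 0 D. m w)"
      unfolding counting_fn_def using \<open>finite D\<close> by (intro sum_mono2) (auto simp: D_def)
    also have "\<dots> = m 0 + N"
      unfolding N_def by (rule sum.insert[OF \<open>finite D\<close>]) (simp add: D_def)
    finally have "real (counting_fn m r) * ln 2 \<le> (real (m 0) + real N) * ln 2"
      by (intro mult_right_mono) auto
    also have "\<dots> \<le> real (m 0) + real N * ln 2"
      using mult_left_mono[of "ln 2" 1 "real (m 0)"] ln_2_less_1 by (simp add: algebra_simps)
    finally show ?thesis using NN by simp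
  qed
  define K where "K = real (m 0) + ln C - ln (cmod (f1 0))"
  have "(\<lambda>r. real (counting_fn m r)) \<in> O(\<lambda>r. (K + (3 * r + 1)\<^sup>2 / 2) / ln 2)"
  proof (rule landau_o.big_mono)
    show "\<forall>\<^sub>F r in at_top. norm (real (counting_fn m r)) \<le> norm ((K + (3 * r + 1)\<^sup>2 / 2) / ln 2)"
      using eventually_ge_at_top[of 1]
    proof eventually_elim
      case (elim r)
      have "real (counting_fn m r) \<le> (K + (3 * r + 1)\<^sup>2 / 2) / ln 2"
        using bound[OF elim] by (simp add: K_def field_simps)
      then show ?case
        using abs_ge_self[of "(K + (3 * r + 1)\<^sup>2 / 2) / ln 2"]
        unfolding real_norm_def abs_of_nat by linarith
    qed
  qed
  also have "(\<lambda>r. (K + (3 * r + 1)\<^sup>2 / 2) / ln 2) \<in> O(\<lambda>r::real. r\<^sup>2)" by real_asymp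
  finally show ?thesis by (simp add: quadratic_growth_def)
qed

text \<open>With \<open>u = G - G 0\<close> rescaled to the unit disc, \<open>Re u < B\<close> makes \<open>u\<close> closer to 0 than to \<open>2 B\<close>, so \<open>u / (2 B - u)\<close> is a
  self-map of the disc fixing 0. The Schwarz lemma bounds \<open>u\<close> on the circle of radius \<open>1 / 2\<close>, and
  Cauchy's estimate does the rest. The 1 in \<open>A + 1\<close> makes the inequality \<open>Re u < B\<close> strict.\<close>

lemma borel_caratheodory_derivatives:
  assumes G: "G holomorphic_on UNIV" and "R > 0" and re: "\<And>z. cmod z < R \<Longrightarrow> Re (G z) \<le> A"
  shows "cmod ((deriv ^^ n) G 0) \<le> fact n * (2 * (A + 1 - Re (G 0)) + cmod (G 0)) / (R / 2) ^ n"
proof -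
  define B where "B = A + 1 - Re (G 0)"
  have "B > 0" using re[of 0] \<open>R > 0\<close> by (simp add: B_def)
  define u where "u z = G (of_real R * z) - G 0" for z
  have u: "u holomorphic_on UNIV"
    unfolding u_def[abs_def] by (intro holomorphic_intros holomorphic_on_compose_gen[OF _ G, unfolded o_def]) auto
  have re_u: "Re (u z) < B" if "cmod z < 1" for z
  proof -
    have "cmod (of_real R * z) < R" using that \<open>R > 0\<close> by (simp add: norm_mult)
    from re[OF this] show ?thesis by (simp add: u_def B_def)
  qed
  define \<phi> where "\<phi> z = u z / (2 * of_real B - u z)" for z
  have ne: "2 * of_real B - u z \<noteq> 0" if "cmod z < 1" for z
  proof
    assume "2 * of_real B - u z = 0"
    then have "u z = of_real (2 * B)" by simp
    then show False using re_u[OF that] \<open>B > 0\<close> by simp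
  qed
  have less: "cmod (u z) < cmod (2 * of_real B - u z)" if "cmod z < 1" for z
  proof -
    have "(cmod (2 * of_real B - u z))\<^sup>2 - (cmod (u z))\<^sup>2 = 4 * B * (B - Re (u z))"
      unfolding cmod_power2 by (simp add: power2_eq_square algebra_simps)
    also have "\<dots> > 0" using re_u[OF that] \<open>B > 0\<close> by simp
    finally show ?thesis by (simp add: power2_less_imp_less)
  qed
  have schwarz: "cmod (\<phi> z) \<le> cmod z" if "cmod z < 1" for z
  proof (rule Schwarz_Lemma(1)[of \<phi>])
    show "\<phi> holomorphic_on ball 0 1"
      unfolding \<phi>_def[abs_def] using ne
      by (intro holomorphic_intros holomorphic_on_subset[OF u]) auto
    show "cmod (\<phi> z) < 1" if "cmod z < 1" for z
      using less[OF that] ne[OF that] by (simp add: \<phi>_def norm_divide)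
  qed (use that in \<open>auto simp: \<phi>_def u_def\<close>)
  have bd: "cmod (u z) \<le> 2 * B" if "cmod z = 1 / 2" for z
  proof -
    have "u z = \<phi> z * (2 * of_real B - u z)" using ne[of z] that by (simp add: \<phi>_def)
    then have "cmod (u z) = cmod (\<phi> z) * cmod (2 * of_real B - u z)" by (metis norm_mult)
    also have "\<dots> \<le> (1 / 2) * (2 * B + cmod (u z))"
    proof (intro mult_mono)
      show "cmod (2 * of_real B - u z) \<le> 2 * B + cmod (u z)"
        using norm_triangle_ineq4[of "2 * of_real B" "u z"] \<open>B > 0\<close> by (simp add: norm_mult)
    qed (use schwarz[of z] that in auto)
    finally show ?thesis by simp
  qed
  have "cmod ((deriv ^^ n) G 0) \<le> fact n * (2 * B + cmod (G 0)) / (R / 2) ^ n"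
  proof (rule Cauchy_inequality)
    show "cmod (G x) \<le> 2 * B + cmod (G 0)" if "cmod (0 - x) = R / 2" for x
    proof -
      have "cmod (u (x / of_real R)) \<le> 2 * B" using that \<open>R > 0\<close> by (intro bd) (simp add: norm_divide)
      then have "cmod (G x - G 0) \<le> 2 * B" using \<open>R > 0\<close> by (simp add: u_def)
      then show ?thesis using norm_triangle_ineq2[of "G x" "G 0"] by simp
    qed
  qed (use \<open>R > 0\<close> G in \<open>auto intro: holomorphic_on_subset holomorphic_on_imp_continuous_on\<close>)
  then show ?thesis by (simp add: B_def)
qed

lemma higher_deriv_quadratic:
  assumes "n \<ge> 3"
  shows "(deriv ^^ n) (\<lambda>z. a * z + b * z\<^sup>2 :: complex) = (\<lambda>_. 0)"
proof -
  obtain k where k: "n = Suc (Suc (Suc k))" using assms by (metis Suc_le_D numeral_3_eq_3 Suc_le_mono)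
  have 1: "deriv (\<lambda>z. a * z + b * z\<^sup>2) = (\<lambda>z. a + 2 * b * z)"
    by (rule ext, rule DERIV_imp_deriv) (auto intro!: derivative_eq_intros)
  have 2: "deriv (\<lambda>z. a + 2 * b * z) = (\<lambda>z. 2 * b)"
    by (rule ext, rule DERIV_imp_deriv) (auto intro!: derivative_eq_intros)
  have 3: "deriv (\<lambda>z::complex. 2 * b) = (\<lambda>z. 0)" by (rule ext) simp
  show ?thesis unfolding k funpow_Suc_right o_def 1 2 3 by (auto simp: higher_deriv_const)
qed

lemma entire_quadratic_if_higher_derivs_vanish:
  assumes g: "g holomorphic_on UNIV" and 0: "\<And>n. n \<ge> 3 \<Longrightarrow> (deriv ^^ n) g 0 = (0::complex)"
  shows "\<exists>a b c. \<forall>z. g z = a * z + b * z\<^sup>2 + c"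
proof -
  have "g z = deriv g 0 * z + (deriv ^^ 2) g 0 / 2 * z\<^sup>2 + g 0" for z
  proof -
    have "(\<lambda>n. (deriv ^^ n) g 0 / fact n * (z - 0) ^ n) sums g z"
      by (rule holomorphic_power_series[where r = "cmod z + 1"]) (auto intro: holomorphic_on_subset[OF g] simp: add_nonneg_pos)
    moreover have "(\<lambda>n. (deriv ^^ n) g 0 / fact n * (z - 0) ^ n) sums (\<Sum>n<3. (deriv ^^ n) g 0 / fact n * (z - 0) ^ n)"
      by (rule sums_finite) (auto simp: 0)
    ultimately have "g z = (\<Sum>n<3. (deriv ^^ n) g 0 / fact n * (z - 0) ^ n)" by (rule sums_unique2)
    then show ?thesis by (simp add: eval_nat_numeral)
  qed
  then show ?thesis by blast
qed

context genus_two_multiset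
begin

text \<open>Once \<open>r\<close> exceeds the moduli in a finite set that carries all but \<open>e\<close> of the sum, the tail is below \<open>e\<close>.\<close>

lemma cube_tail_tendsto_0: "(cube_tail \<longlongrightarrow> 0) at_top"
proof (rule order_tendstoI)
  fix a :: real assume "a < 0"
  then show "\<forall>\<^sub>F r in at_top. cube_tail r > a"
    using cube_tail_nonneg by (intro always_eventually) (metis less_le_trans)
next
  fix e :: real assume e: "0 < e"
  define S where "S = (\<Sum>\<^sub>\<infinity>w\<in>nonzero_pts m. real (m w) / cmod w ^ 3)"
  have "((\<lambda>w. real (m w) / cmod w ^ 3) has_sum S) (nonzero_pts m)"
    unfolding S_def by (rule has_sum_infsum[OF summable_inverse_cubes])
  then have "\<forall>\<^sub>F F in finite_subsets_at_top (nonzero_pts m). (\<Sum>w\<in>F. real (m w) / cmod w ^ 3) > S - e"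
    unfolding has_sum_def using e by (intro order_tendstoD(1)) auto
  then obtain F where F: "finite F" "F \<subseteq> nonzero_pts m" "(\<Sum>w\<in>F. real (m w) / cmod w ^ 3) > S - e"
    unfolding eventually_finite_subsets_at_top by blast
  obtain M where M: "\<And>w. w \<in> F \<Longrightarrow> cmod w \<le> M" using finite_imp_bounded[OF F(1)] by (auto simp: bounded_iff)
  show "\<forall>\<^sub>F r in at_top. cube_tail r < e"
    using eventually_ge_at_top[of M]
  proof eventually_elim
    case (elim r)
    have "S = (\<Sum>w\<in>near r. real (m w) / cmod w ^ 3) + cube_tail r"
      unfolding S_def cube_tail_def near_far(1)[of r]
      by (subst infsum_Un_disjoint) (auto intro: summable_far simp: near_far(2))
    moreover have "(\<Sum>w\<in>F. real (m w) / cmod w ^ 3) \<le> (\<Sum>w\<in>near r. real (m w) / cmod w ^ 3)"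
    proof (rule sum_mono2)
      show "F \<subseteq> near r" using F(2) M elim unfolding near_def by (blast intro: order_trans)
    qed auto
    ultimately show ?case using F(3) by simp
  qed
qed

text \<open>Let \<open>h\<close> be the function with the zeros in \<open>\<bar>w\<bar> \<le> r\<close> divided out by the factors \<open>z\<close> and \<open>1 - z / w\<close>. These have modulus at
  least 1 on \<open>\<bar>z\<bar> = 3 r\<close>, so \<open>ln \<bar>h\<bar>\<close> is at most \<open>O(r\<^sup>2)\<close> in the whole disc. For \<open>\<bar>z\<bar> < r / 2\<close>, \<open>h\<close> is the
  exponential of \<open>g + Q + tail_log r\<close> with \<open>Q\<close> a quadratic polynomial and the tail \<open>o(r\<^sup>3)\<close>. So the real part of
  \<open>g + Q\<close> is at most \<open>o(r\<^sup>3)\<close>. The derivatives of \<open>g + Q\<close> of order at least 3 are those of \<open>g\<close>, and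
  the Borel--Caratheodory bound for them tends to 0.\<close>

lemma quadratic_exponent:
  assumes g: "g holomorphic_on UNIV" and "C > 0"
    and growth: "\<And>z. cmod (canonical_product m z * exp (g z)) \<le> C * exp ((cmod z + 1)\<^sup>2 / 2)"
  shows "\<exists>a b c. \<forall>z. g z = a * z + b * z\<^sup>2 + c"
proof (rule entire_quadratic_if_higher_derivs_vanish[OF g])
  fix n :: nat assume n: "n \<ge> 3"
  define A where "A r = ln C + (3 * r + 1)\<^sup>2 / 2 + 6 * (r / 2) ^ 3 * cube_tail r" for r
  have bound: "cmod ((deriv ^^ n) g 0) \<le> fact n * (2 * (A r + 1 - Re (g 0)) + cmod (g 0)) / (r / 2 / 2) ^ n" if r: "r \<ge> 1" for r
  proof -
    \<comment> \<open>The origin is deleted as well, so that the remaining canonical product has no zero in \<open>\<bar>z\<bar> \<le> r\<close>.\<close>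
    define D where "D = insert 0 (near r)"
    have D0: "finite D" "D - {0} = near r" by (simp add: D_def) (auto simp: D_def near_def nonzero_pts_def)
    interpret d: genus_two_multiset "delete D" by (rule genus_two_multiset_delete)
    define a where "a = (\<Sum>w\<in>near r. of_nat (m w) / w)"
    define b where "b = (\<Sum>w\<in>near r. of_nat (m w) / (2 * w\<^sup>2))"
    define Q where "Q z = a * z + b * z\<^sup>2" for z
    have Q: "Q z = (\<Sum>w\<in>near r. of_nat (m w) * (z / w + (z / w)\<^sup>2 / 2))" for z
      by (simp add: Q_def a_def b_def sum_distrib_right sum.distrib[symmetric] power_divide ring_distribs mult.commute[of 2])
    have Qh: "Q holomorphic_on UNIV" unfolding Q_def[abs_def] by (intro holomorphic_intros)
    define h where "h z = exp (g z + Q z) * canonical_product (delete D) z" for z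
    have h: "h holomorphic_on UNIV"
      unfolding h_def[abs_def] by (intro holomorphic_intros g Qh d.holomorphic_canonical_product)
    have fh: "cmod (canonical_product m z * exp (g z)) = cmod z ^ m 0 * (\<Prod>w\<in>near r. (cmod (z - w) / cmod w) ^ m w) * cmod (h z)" for z
    proof -
      have "cmod (\<Prod>w\<in>D. (z - w) ^ m w) = cmod z ^ m 0 * (\<Prod>w\<in>near r. cmod (z - w) ^ m w)"
      proof -
        have "0 \<notin> near r" by (simp add: near_def nonzero_pts_def)
        then have "(\<Prod>w\<in>D. (z - w) ^ m w) = z ^ m 0 * (\<Prod>w\<in>near r. (z - w) ^ m w)"
          unfolding D_def by simp
        then show ?thesis by (simp add: norm_mult norm_power prod_norm[symmetric])
      qed
      moreover have "cmod (delete_unit D z) = (\<Prod>w\<in>near r. (1 / cmod w) ^ m w) * exp (Re (Q z))"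
      proof -
        have "exp (Re (Q z)) = (\<Prod>w\<in>near r. exp (Re (z / w + (z / w)\<^sup>2 / 2)) ^ m w)"
          by (simp add: Q exp_sum exp_of_nat_mult)
        then show ?thesis
          unfolding delete_unit_def D0(2) prod_norm[symmetric] prod.distrib[symmetric]
          by (simp add: norm_power norm_divide power_divide prod.distrib prod_dividef)
      qed
      ultimately show ?thesis
        by (subst canonical_product_delete[OF D0(1)])
           (simp add: h_def norm_mult exp_add power_divide prod_dividef mult_ac)
    qed
    define M where "M = C * exp ((3 * r + 1)\<^sup>2 / 2)"
    have hM: "cmod (h z) \<le> M" if z: "cmod z \<le> 3 * r" for z
    proof (rule entire_max_modulus[OF h _ z])
      fix z assume z: "cmod z = 3 * r"
      have "1 \<le> cmod z ^ m 0" using z r by (intro one_le_power) auto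
      moreover have "1 \<le> (\<Prod>w\<in>near r. (cmod (z - w) / cmod w) ^ m w)"
      proof (intro prod_ge_1 one_le_power)
        fix w assume "w \<in> near r"
        then have "cmod w \<le> r" "cmod w > 0" by (auto simp: near_def nonzero_pts_def)
        then show "1 \<le> cmod (z - w) / cmod w" using norm_triangle_ineq2[of z w] z r by (simp add: field_simps)
      qed
      ultimately have "1 * 1 \<le> cmod z ^ m 0 * (\<Prod>w\<in>near r. (cmod (z - w) / cmod w) ^ m w)"
        by (intro mult_mono) auto
      then have "1 * cmod (h z) \<le> cmod z ^ m 0 * (\<Prod>w\<in>near r. (cmod (z - w) / cmod w) ^ m w) * cmod (h z)"
        by (intro mult_right_mono) auto
      also have "\<dots> \<le> M" using growth[of z] unfolding fh by (simp add: M_def z)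
      finally show "cmod (h z) \<le> M" by simp
    qed
    have Re_le: "Re (g z + Q z) \<le> A r" if z: "cmod z < r / 2" for z
    proof -
      have zr: "cmod z \<le> r / 2" "r > 0" using z r by auto
      have "w \<in> D \<longleftrightarrow> w = 0 \<or> m w \<noteq> 0 \<and> cmod w \<le> r" for w
        by (auto simp: D_def near_def nonzero_pts_def)
      then have "d.near r = {}"
        by (auto simp: d.near_def nonzero_pts_def delete_def)
      moreover have "d.tail_log r z = tail_log r z"
        by (rule tail_log_delete) (use r in \<open>auto simp: D_def near_def\<close>)
      ultimately have P: "canonical_product (delete D) z = exp (tail_log r z)"
        using d.canonical_product_eq[OF zr] by (simp add: delete_def D_def)
      have "exp (Re (g z + Q z + tail_log r z)) = cmod (h z)"
        by (simp add: h_def P norm_mult exp_add)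
      also have "\<dots> \<le> exp (ln C + (3 * r + 1)\<^sup>2 / 2)"
        using hM[of z] zr \<open>C > 0\<close> by (simp add: M_def exp_add)
      finally have "Re (g z + Q z) \<le> ln C + (3 * r + 1)\<^sup>2 / 2 - Re (tail_log r z)" by simp
      moreover have "- Re (tail_log r z) \<le> 6 * cmod z ^ 3 * cube_tail r"
        using abs_Re_le_cmod[of "tail_log r z"] norm_tail_log_le[OF zr] by linarith
      moreover have "6 * cmod z ^ 3 * cube_tail r \<le> 6 * (r / 2) ^ 3 * cube_tail r"
        using zr by (intro mult_right_mono mult_left_mono power_mono cube_tail_nonneg) auto
      ultimately show ?thesis by (simp add: A_def)
    qed
    have "(deriv ^^ n) (\<lambda>z. g z + Q z) 0 = (deriv ^^ n) g 0"
      using higher_deriv_add[OF g Qh, of 0 n] higher_deriv_quadratic[OF n, of a b] by (simp add: Q_def[abs_def])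
    moreover have "cmod ((deriv ^^ n) (\<lambda>z. g z + Q z) 0) \<le> fact n * (2 * (A r + 1 - Re (g 0 + Q 0)) + cmod (g 0 + Q 0)) / (r / 2 / 2) ^ n"
      using r by (intro borel_caratheodory_derivatives Re_le holomorphic_intros g Qh) auto
    ultimately show ?thesis by (simp add: Q_def)
  qed
  define c where "c = ln C + 1 - Re (g 0)"
  have lim: "((\<lambda>r. fact n * 4 ^ n * ((2 * (c + (3 * r + 1)\<^sup>2 / 2) + cmod (g 0)) / r ^ 3 + 12 / 8 * cube_tail r)) \<longlongrightarrow>
      fact n * 4 ^ n * (0 + 12 / 8 * 0)) at_top"
    by (intro tendsto_intros cube_tail_tendsto_0) real_asymp
  have "cmod ((deriv ^^ n) g 0) \<le> 0"
  proof (rule tendsto_le[OF _ lim[simplified mult_zero_right add_0_right] tendsto_const])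
    show "\<forall>\<^sub>F r in at_top. cmod ((deriv ^^ n) g 0) \<le>
      fact n * 4 ^ n * ((2 * (c + (3 * r + 1)\<^sup>2 / 2) + cmod (g 0)) / r ^ 3 + 12 / 8 * cube_tail r)"
      using eventually_ge_at_top[of 1]
    proof eventually_elim
      case (elim r)
      define X where "X = 2 * (A r + 1 - Re (g 0)) + cmod (g 0)"
      have le: "cmod ((deriv ^^ n) g 0) \<le> fact n * X / (r / 2 / 2) ^ n"
        using bound[OF elim] by (simp add: X_def)
      have "0 \<le> fact n * X / (r / 2 / 2) ^ n" using le norm_ge_zero order_trans by blast
      have "X \<ge> 0"
      proof (rule ccontr)
        assume "\<not> X \<ge> 0"
        then have "fact n * X / (r / 2 / 2) ^ n < 0"
          using elim by (intro divide_neg_pos mult_pos_neg) auto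
        with \<open>0 \<le> fact n * X / (r / 2 / 2) ^ n\<close> show False by simp
      qed
      have "fact n * X / (r / 2 / 2) ^ n = fact n * 4 ^ n * (X / r ^ n)"
        by (simp add: power_divide)
      also have "\<dots> \<le> fact n * 4 ^ n * (X / r ^ 3)"
        using elim n \<open>X \<ge> 0\<close> by (intro mult_left_mono divide_left_mono power_increasing) auto
      also have "X / r ^ 3 = (2 * (c + (3 * r + 1)\<^sup>2 / 2) + cmod (g 0)) / r ^ 3 + 12 / 8 * cube_tail r"
        using elim by (simp add: X_def A_def c_def field_simps)
      finally show ?case using le by linarith
    qed
  qed simp
  then show "(deriv ^^ n) g 0 = 0" by simp
qed

end

section \<open>Fock space functions with prescribed zeros\<close>

context genus_two_multiset
begin

text \<open>The function \<open>G\<close> is \<open>u \<mapsto> f (z + u) exp (- cnj z u)\<close> with each zero in the closed unit disc reflected: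
  \<open>u - (w - z)\<close> is replaced by \<open>1 - cnj (w - z) u\<close>, which has the same modulus on the unit circle and the value 1 at the
  centre. So \<open>\<bar>G 0\<bar>\<close> is \<open>exp (U z + Re (q z))\<close>, while on the circle \<open>\<bar>G\<bar>\<close> is the modulus of the original function.\<close>

lemma exp_potential_le_circle_mean:
  fixes a b c z :: complex
  defines "q \<equiv> \<lambda>z. a * z + b * z\<^sup>2 + c"
  defines "f \<equiv> \<lambda>z. canonical_product m z * exp (q z)"
  shows "ennreal (exp (2 * canonical_potential m z + 2 * Re (q z))) \<le>
    (\<integral>\<^sup>+t\<in>{0..1}. ennreal ((cmod (f (z + cis (2 * pi * t))))\<^sup>2 * exp (- 2 * Re (cnj z * cis (2 * pi * t)))) \<partial>lborel)"
proof -
  let ?D = "unit_neighbours z"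
  interpret d: genus_two_multiset "delete ?D" by (rule genus_two_multiset_delete)
  define G where "G u = (\<Prod>w\<in>?D. (1 - cnj (w - z) * u) ^ m w) *
     (delete_unit ?D (z + u) * canonical_product (delete ?D) (z + u)) * exp (q (z + u)) * exp (- cnj z * u)" for u
  have shift: "(\<lambda>u. k (z + u)) holomorphic_on UNIV" if "k holomorphic_on UNIV" for k
    by (rule holomorphic_on_compose_gen[OF _ that, unfolded o_def]) (auto intro!: holomorphic_intros)
  have "q holomorphic_on UNIV" unfolding q_def by (intro holomorphic_intros)
  then have G: "G holomorphic_on UNIV"
    unfolding G_def[abs_def]
    by (intro holomorphic_intros shift[of "delete_unit ?D"] shift[of "canonical_product (delete ?D)"] shift[of q]
        holomorphic_delete_unit d.holomorphic_canonical_product)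
  have "cmod (G 0) = exp (canonical_potential m z) * exp (Re (q z))"
    by (simp add: G_def exp_canonical_potential norm_mult)
  then have G0: "(cmod (G 0))\<^sup>2 = exp (2 * canonical_potential m z + 2 * Re (q z))"
    by (simp add: power2_eq_square flip: exp_add)
  have Gu: "(cmod (G u))\<^sup>2 = (cmod (f (z + u)))\<^sup>2 * exp (- 2 * Re (cnj z * u))" if u: "cmod u = 1" for u
  proof -
    have reflect: "cmod (1 - cnj (w - z) * u) = cmod (z + u - w)" for w
    proof -
      have "cmod (1 - cnj (w - z) * u) = cmod (cnj u * (1 - cnj (w - z) * u))"
        using u by (simp add: norm_mult)
      also have "cnj u * (1 - cnj (w - z) * u) = cnj (z + u - w)"
      proof -
        have "cnj u * u = 1" using complex_norm_square[of u] u by (simp add: mult.commute)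
        then have "cnj (w - z) * (cnj u * u) = cnj (w - z)" by simp
        then show ?thesis by (simp add: algebra_simps)
      qed
      finally show ?thesis by (simp only: complex_mod_cnj)
    qed
    have "cmod (\<Prod>w\<in>?D. (1 - cnj (w - z) * u) ^ m w) = cmod (\<Prod>w\<in>?D. (z + u - w) ^ m w)"
      by (simp only: prod_norm[symmetric] norm_power reflect)
    then have "cmod (G u) = cmod (f (z + u)) * exp (- Re (cnj z * u))"
      unfolding G_def f_def canonical_product_delete[OF finite_unit_neighbours, of "z + u" z] norm_mult
      by simp
    then show ?thesis by (simp add: power_mult_distrib flip: exp_double)
  qed
  have "ennreal ((cmod (G 0))\<^sup>2) \<le> (\<integral>\<^sup>+t\<in>{0..1}. ennreal ((cmod (G (0 + 1 * cis (2 * pi * t))))\<^sup>2) \<partial>lborel)"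
    by (rule circle_submean_affine[OF G])
  also have "\<dots> = (\<integral>\<^sup>+t\<in>{0..1}. ennreal ((cmod (f (z + cis (2 * pi * t))))\<^sup>2 * exp (- 2 * Re (cnj z * cis (2 * pi * t)))) \<partial>lborel)"
    by (simp only: add_0 mult_1 Gu norm_cis)
  finally show ?thesis unfolding G0 .
qed

text \<open>For \<open>\<bar>u\<bar> = 1\<close> the weights satisfy \<open>exp (- \<bar>z\<bar>\<^sup>2) exp (- 2 Re (cnj z u)) = e exp (- \<bar>z + u\<bar>\<^sup>2)\<close>. Integrating the circle mean
  over \<open>z\<close> and using translation invariance for each \<open>u\<close> bounds the energy by \<open>e\<close> times the Fock norm.\<close>

lemma energy_finite_if_fock:
  assumes f: "(\<lambda>z. canonical_product m z * exp (a * z + b * z\<^sup>2 + c)) \<in> fock_space"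
  shows "energy (canonical_potential m) (a, b) < \<infinity>"
proof -
  define q where "q z = a * z + b * z\<^sup>2 + c" for z
  define f where "f z = canonical_product m z * exp (q z)" for z
  have fock: "f \<in> fock_space" using f by (simp add: f_def[abs_def] q_def)
  have "f holomorphic_on UNIV" using fock by (simp add: fock_space_def)
  then have "continuous_on UNIV f" by (rule holomorphic_on_imp_continuous_on)
  then have [measurable]: "f \<in> borel_measurable borel" by (rule borel_measurable_continuous_onI)
  have [measurable]: "cis \<in> borel_measurable borel"
    by (rule borel_measurable_continuous_onI) (auto simp: cis_conv_exp intro!: continuous_intros)
  have [measurable]: "canonical_potential m \<in> borel_measurable borel"
    by (rule borel_measurable_continuous_onI[OF continuous_canonical_potential])
  have [measurable]: "q \<in> borel_measurable borel"
    unfolding q_def[abs_def] by (intro borel_measurable_continuous_onI continuous_intros)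
  define F where "F x = ennreal (exp (- (cmod x)\<^sup>2) / pi) * ennreal ((cmod (f x))\<^sup>2)" for x
  have [measurable]: "F \<in> borel_measurable borel" unfolding F_def[abs_def] by measurable
  have F_fin: "(\<integral>\<^sup>+x. F x \<partial>lborel) < \<infinity>"
    using fock unfolding F_def by (simp add: fock_space_def nn_integral_gauss_measure)
  have pt: "ennreal (exp (- (cmod z)\<^sup>2) / pi) * ennreal (exp (2 * canonical_potential m z + 2 * Re (q z)))
      \<le> (\<integral>\<^sup>+t. ennreal (exp 1) * (F (z + cis (2 * pi * t)) * indicator {0..1} t) \<partial>lborel)" for z
  proof -
    have "ennreal (exp (- (cmod z)\<^sup>2) / pi) * ennreal (exp (2 * canonical_potential m z + 2 * Re (q z)))
       \<le> ennreal (exp (- (cmod z)\<^sup>2) / pi) * (\<integral>\<^sup>+t\<in>{0..1}. ennreal ((cmod (f (z + cis (2 * pi * t))))\<^sup>2 * exp (- 2 * Re (cnj z * cis (2 * pi * t)))) \<partial>lborel)"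
      using exp_potential_le_circle_mean[of z a b c] unfolding f_def q_def by (intro mult_left_mono) auto
    also have "\<dots> = (\<integral>\<^sup>+t. ennreal (exp (- (cmod z)\<^sup>2) / pi) * (ennreal ((cmod (f (z + cis (2 * pi * t))))\<^sup>2 * exp (- 2 * Re (cnj z * cis (2 * pi * t)))) * indicator {0..1} t) \<partial>lborel)"
      by (rule nn_integral_cmult[symmetric]) measurable
    also have "\<dots> = (\<integral>\<^sup>+t. ennreal (exp 1) * (F (z + cis (2 * pi * t)) * indicator {0..1} t) \<partial>lborel)"
    proof (rule nn_integral_cong)
      fix t :: real
      let ?u = "cis (2 * pi * t)"
      have "(cmod (z + ?u))\<^sup>2 = (cmod z)\<^sup>2 + 2 * Re (cnj z * ?u) + (cmod ?u)\<^sup>2"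
        unfolding cmod_power2 by (simp add: power2_eq_square algebra_simps)
      then have "(cmod (z + ?u))\<^sup>2 = (cmod z)\<^sup>2 + 2 * Re (cnj z * ?u) + 1" by simp
      then have "exp (- (cmod z)\<^sup>2) * exp (- 2 * Re (cnj z * ?u)) = exp 1 * exp (- (cmod (z + ?u))\<^sup>2)"
        by (simp flip: exp_add)
      then have "exp (- (cmod z)\<^sup>2) / pi * ((cmod (f (z + ?u)))\<^sup>2 * exp (- 2 * Re (cnj z * ?u)))
         = exp 1 * (exp (- (cmod (z + ?u))\<^sup>2) / pi * (cmod (f (z + ?u)))\<^sup>2)"
        by (simp add: field_simps)
      then have "ennreal (exp (- (cmod z)\<^sup>2) / pi) * ennreal ((cmod (f (z + ?u)))\<^sup>2 * exp (- 2 * Re (cnj z * ?u)))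
         = ennreal (exp 1) * F (z + ?u)"
        unfolding F_def by (simp flip: ennreal_mult)
      then show "ennreal (exp (- (cmod z)\<^sup>2) / pi) * (ennreal ((cmod (f (z + ?u)))\<^sup>2 * exp (- 2 * Re (cnj z * ?u))) * indicator {0..1} t)
         = ennreal (exp 1) * (F (z + ?u) * indicator {0..1} t)"
        by (simp only: mult.assoc[symmetric])
    qed
    finally show ?thesis .
  qed
  have "(\<integral>\<^sup>+z. ennreal (exp (2 * canonical_potential m z + 2 * Re (q z))) \<partial>gauss_measure)
     = (\<integral>\<^sup>+z. ennreal (exp (- (cmod z)\<^sup>2) / pi) * ennreal (exp (2 * canonical_potential m z + 2 * Re (q z))) \<partial>lborel)"
    by (rule nn_integral_gauss_measure) measurable
  also have "\<dots> \<le> (\<integral>\<^sup>+z. (\<integral>\<^sup>+t. ennreal (exp 1) * (F (z + cis (2 * pi * t)) * indicator {0..1} t) \<partial>lborel) \<partial>lborel)"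
    by (intro nn_integral_mono pt)
  also have "\<dots> = (\<integral>\<^sup>+t. (\<integral>\<^sup>+z. ennreal (exp 1) * (F (z + cis (2 * pi * t)) * indicator {0..1} t) \<partial>lborel) \<partial>lborel)"
    by (rule lborel_pair.Fubini') measurable
  also have "\<dots> = (\<integral>\<^sup>+t. (ennreal (exp 1) * (\<integral>\<^sup>+z. F z \<partial>lborel)) * indicator {0..1::real} t \<partial>lborel)"
  proof (rule nn_integral_cong)
    fix t :: real
    have "(\<integral>\<^sup>+z. F (z + cis (2 * pi * t)) \<partial>lborel) = (\<integral>\<^sup>+z. F z \<partial>lborel)"
      using nn_integral_lborel_translate[of F "cis (2 * pi * t)"] by (simp add: add.commute)
    then show "(\<integral>\<^sup>+z. ennreal (exp 1) * (F (z + cis (2 * pi * t)) * indicator {0..1} t) \<partial>lborel)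
        = (ennreal (exp 1) * (\<integral>\<^sup>+z. F z \<partial>lborel)) * indicator {0..1::real} t"
      by (subst nn_integral_cmult, simp, subst nn_integral_multc) (simp_all add: mult.assoc)
  qed
  also have "\<dots> = ennreal (exp 1) * (\<integral>\<^sup>+z. F z \<partial>lborel)"
    by (subst nn_integral_cmult_indicator) auto
  also have "\<dots> < \<infinity>" using F_fin by (simp add: ennreal_mult_less_top)
  finally have fin: "(\<integral>\<^sup>+z. ennreal (exp (2 * canonical_potential m z + 2 * Re (q z))) \<partial>gauss_measure) < \<infinity>" .
  have "energy (canonical_potential m) (a, b) = (\<integral>\<^sup>+z. ennreal (exp (- 2 * Re c)) * ennreal (exp (2 * canonical_potential m z + 2 * Re (q z))) \<partial>gauss_measure)"
    unfolding energy_def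
    by (intro nn_integral_cong) (simp add: tilt_def q_def algebra_simps flip: ennreal_mult exp_add)
  also have "\<dots> = ennreal (exp (- 2 * Re c)) * (\<integral>\<^sup>+z. ennreal (exp (2 * canonical_potential m z + 2 * Re (q z))) \<partial>gauss_measure)"
    by (rule nn_integral_cmult) measurable
  also have "\<dots> < \<infinity>" using fin by (simp add: ennreal_mult_less_top)
  finally show ?thesis .
qed

lemma fock_if_energy_finite:
  assumes "energy (canonical_potential m) (a, b) < \<infinity>"
  shows "(\<lambda>z. canonical_product m z * exp (a * z + b * z\<^sup>2)) \<in> fock_space"
proof -
  have "(\<integral>\<^sup>+z. ennreal ((cmod (canonical_product m z * exp (a * z + b * z\<^sup>2)))\<^sup>2) \<partial>gauss_measure)
      \<le> energy (canonical_potential m) (a, b)"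
    unfolding energy_def
  proof (intro nn_integral_mono ennreal_leI)
    fix z
    have "(cmod (canonical_product m z * exp (a * z + b * z\<^sup>2)))\<^sup>2 \<le> (exp (canonical_potential m z) * exp (tilt (a, b) z))\<^sup>2"
      unfolding norm_mult by (intro power_mono mult_mono canonical_product_le_exp_potential) (auto simp: tilt_def)
    then show "(cmod (canonical_product m z * exp (a * z + b * z\<^sup>2)))\<^sup>2 \<le> exp (2 * canonical_potential m z + 2 * tilt (a, b) z)"
      by (simp add: power2_eq_square flip: exp_add)
  qed
  then show ?thesis
    using assms unfolding fock_space_def by (auto intro!: holomorphic_intros holomorphic_canonical_product)
qed

lemma has_zero_multiset_times_exp:
  assumes "g holomorphic_on UNIV"
  shows "has_zero_multiset (\<lambda>z. canonical_product m z * exp (g z)) m"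
  unfolding has_zero_multiset_def
proof (intro conjI allI)
  show hol: "(\<lambda>z. canonical_product m z * exp (g z)) holomorphic_on UNIV"
    by (intro holomorphic_intros holomorphic_canonical_product assms)
  show nz: "\<exists>z. canonical_product m z * exp (g z) \<noteq> 0"
    using canonical_product_not_zero by simp
  fix z
  have "(\<lambda>z. exp (g z)) holomorphic_on UNIV" by (intro holomorphic_intros assms)
  then have an: "canonical_product m analytic_on {z}" "(\<lambda>z. exp (g z)) analytic_on {z}"
    using holomorphic_canonical_product analytic_on_holomorphic by blast+
  have "zorder (\<lambda>z. canonical_product m z * exp (g z)) z = zorder (canonical_product m) z + zorder (\<lambda>z. exp (g z)) z"
    by (intro zorder_times_analytic an entire_eventually_nonzero[OF hol nz])
  also have "zorder (\<lambda>z. exp (g z)) z = 0" by (intro zorder_eq_0I an) simp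
  finally show "zorder (\<lambda>z. canonical_product m z * exp (g z)) z = int (m z)"
    by (simp add: zorder_canonical_product)
qed

text \<open>The quotient by \<open>P\<close> is entire without zeros, hence \<open>exp g\<close>, and the growth of Fock space functions makes \<open>g\<close>
  quadratic.\<close>

lemma fock_function_factorization:
  assumes f: "f \<in> fock_space" and zm: "has_zero_multiset f m"
  shows "\<exists>a b c. f = (\<lambda>z. canonical_product m z * exp (a * z + b * z\<^sup>2 + c))"
proof -
  from zm have hf: "f holomorphic_on UNIV" "\<exists>z. f z \<noteq> 0" and zo: "\<And>z. zorder f z = int (m z)"
    by (auto simp: has_zero_multiset_def)
  have "canonical_product m z = 0 \<longleftrightarrow> f z = 0" for z
  proof -
    have "f analytic_on {z}" using hf(1) analytic_on_holomorphic by blast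
    moreover have "\<exists>\<^sub>F w in at z. f w \<noteq> 0"
      by (intro eventually_frequently entire_eventually_nonzero hf) simp
    ultimately have "zorder f z = 0 \<longleftrightarrow> f z \<noteq> 0" by (rule zorder_eq_0_iff)
    then show ?thesis by (auto simp: canonical_product_eq_0_iff zo)
  qed
  then obtain h where h: "h holomorphic_on UNIV" "\<And>z. h z \<noteq> 0" "\<And>z. f z = h z * canonical_product m z"
    using holomorphic_zorder_factorization[of f UNIV "canonical_product m"] hf(1) holomorphic_canonical_product
    by (auto simp: zorder_canonical_product zo)
  obtain g where g: "g holomorphic_on UNIV" "\<And>z. h z = exp (g z)"
    using contractible_imp_holomorphic_log[OF h(1)] h(2) convex_imp_contractible[OF convex_UNIV] by (metis UNIV_I)
  obtain C where C: "C > 0" "\<And>z. cmod (f z) \<le> C * exp ((cmod z + 1)\<^sup>2 / 2)"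
    using fock_space_growth[OF f] by blast
  have feq: "f z = canonical_product m z * exp (g z)" for z using h(3) g(2) by (simp add: mult.commute)
  obtain a b c where "\<forall>z. g z = a * z + b * z\<^sup>2 + c"
    using quadratic_exponent[OF g(1) C(1)] C(2) by (auto simp: feq)
  then have "f = (\<lambda>z. canonical_product m z * exp (a * z + b * z\<^sup>2 + c))" by (simp add: fun_eq_iff feq)
  then show ?thesis by blast
qed

end

lemma gauss_energy_eq: "gauss_energy m a b = energy (canonical_potential m) (a, b)"
  by (simp add: gauss_energy_def energy_def tilt_def)

lemma entropy_functional_eq:
  "entropy_functional m = (SUP \<mu>\<in>test_measures. ereal (free_energy (canonical_potential m) \<mu>))"
  unfolding entropy_functional_def
  by (intro SUP_cong refl) (simp add: test_measure_entropy(2) free_energy_def)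

theorem theoremC:
  fixes m :: "complex \<Rightarrow> nat"
  assumes "locally_finite m"
  shows "(fock_zero_set m \<longleftrightarrow> quadratic_growth m \<and> entropy_functional m < \<infinity>) \<and>
    (quadratic_growth m \<longrightarrow>
       exp_ereal (entropy_functional m) = (INF (a, b)\<in>UNIV. gauss_energy m a b) \<and>
       ((INF (a, b)\<in>UNIV. gauss_energy m a b) < \<infinity> \<longrightarrow>
          (\<exists>a b.
             gauss_energy m a b = (INF (a', b')\<in>UNIV. gauss_energy m a' b') \<and>
             (\<forall>a' b'. gauss_energy m a' b' = (INF (a'', b'')\<in>UNIV. gauss_energy m a'' b'') \<longrightarrow>
                a' = a \<and> b' = b) \<and>
             (\<lambda>z. canonical_product m z * exp (a * z + b * z\<^sup>2)) \<in> fock_space \<and>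
             has_zero_multiset (\<lambda>z. canonical_product m z * exp (a * z + b * z\<^sup>2)) m)))"
proof -
  define V where "V = canonical_potential m"
  have inf_eq: "(INF (a, b)\<in>UNIV. gauss_energy m a b) = (INF p. energy V p)"
    by (simp add: gauss_energy_eq V_def)
  have genus: "genus_two_multiset m" if "quadratic_growth m"
    using assms that by (intro genus_two_multiset.intro summable_inverse_cubes_if_quadratic_growth)
  have duality: "exp_ereal (entropy_functional m) = (INF p. energy V p)" if "quadratic_growth m"
    unfolding entropy_functional_eq V_def
    by (rule entropy_duality(1)[OF genus_two_multiset.continuous_canonical_potential[OF genus[OF that]]])
  have finite_iff: "entropy_functional m < \<infinity> \<longleftrightarrow> exp_ereal (entropy_functional m) < \<infinity>"
    by (cases "entropy_functional m") (auto simp: exp_ereal_def)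
  have minimiser: "\<exists>a b. energy V (a, b) = (INF p. energy V p) \<and>
      (\<forall>a' b'. energy V (a', b') = (INF p. energy V p) \<longrightarrow> a' = a \<and> b' = b) \<and>
      (\<lambda>z. canonical_product m z * exp (a * z + b * z\<^sup>2)) \<in> fock_space \<and>
      has_zero_multiset (\<lambda>z. canonical_product m z * exp (a * z + b * z\<^sup>2)) m"
    if q: "quadratic_growth m" and fin: "(INF p. energy V p) < \<infinity>"
  proof -
    interpret genus_two_multiset m by (rule genus[OF q])
    have V: "continuous_on UNIV V" unfolding V_def by (rule continuous_canonical_potential)
    obtain a b where ab: "energy V (a, b) = (INF p. energy V p)"
      using entropy_duality(2)[OF V fin] by (metis surj_pair)
    have "a' = a \<and> b' = b" if "energy V (a', b') = (INF p. energy V p)" for a' b'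
      using energy_minimiser_unique[OF V fin that ab] by simp
    moreover have "(\<lambda>z. canonical_product m z * exp (a * z + b * z\<^sup>2)) \<in> fock_space"
      by (rule fock_if_energy_finite) (use ab fin V_def in simp)
    moreover have "has_zero_multiset (\<lambda>z. canonical_product m z * exp (a * z + b * z\<^sup>2)) m"
      by (rule has_zero_multiset_times_exp) (intro holomorphic_intros)
    ultimately show ?thesis using ab by blast
  qed
  have "fock_zero_set m \<longleftrightarrow> quadratic_growth m \<and> entropy_functional m < \<infinity>"
  proof
    assume "fock_zero_set m"
    then obtain f where f: "f \<in> fock_space" "has_zero_multiset f m" by (auto simp: fock_zero_set_def)
    obtain C where C: "C > 0" "\<And>z. cmod (f z) \<le> C * exp ((cmod z + 1)\<^sup>2 / 2)"
      using fock_space_growth[OF f(1)] by blast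
    have q: "quadratic_growth m" by (rule quadratic_growth_of_zeros[OF assms f(2) C])
    interpret genus_two_multiset m by (rule genus[OF q])
    obtain a b c where "f = (\<lambda>z. canonical_product m z * exp (a * z + b * z\<^sup>2 + c))"
      using fock_function_factorization[OF f] by blast
    then have "energy V (a, b) < \<infinity>" using energy_finite_if_fock f(1) by (simp add: V_def)
    then have "(INF p. energy V p) < \<infinity>" by (meson INF_lower UNIV_I le_less_trans)
    then show "quadratic_growth m \<and> entropy_functional m < \<infinity>"
      using q duality finite_iff by simp
  next
    assume *: "quadratic_growth m \<and> entropy_functional m < \<infinity>"
    then have "(INF p. energy V p) < \<infinity>" using duality finite_iff by simp
    then show "fock_zero_set m" using minimiser * unfolding fock_zero_set_def by blast
  qed
  with duality minimiser show ?thesis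
    unfolding inf_eq by (simp only: gauss_energy_eq V_def[symmetric]) blast
qed

end
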